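(* Suppose that $S\subseteq 2^{<\omega_1}$ is a complete coherent Suslin tree and $c:[S]^2\to2$ is a coloring. Then $\mathrm{PFA}(S)$ implies that $\varphi_0(c)$ fails.
   Context: Trees: a Suslin tree here is a downward closed subset $S\subseteq 2^{<\omega_1}$ ordered by end-extension $<_S$, which is a Suslin tree. $ht(t)=dom(t)$. For $s,t\in 2^{<\omega_1}$: $\Delta(s,t)=\max\{\alpha\le\min(dom\, s,dom\, t): s\restriction_\alpha=t\restriction_\alpha\}$, $D_{s,t}=\{\xi<\min(dom\, s,dom\, t): s(\xi)\ne t(\xi)\}$. $S$ is coherent if all $D_{s,t}$ ($s,t\in S$) are finite, complete coherent if moreover $t\in S$ whenever $s\in S$, $t\in 2^{ht(s)}$, $D_{s,t}$ finite. $s^\frown i$ is $s$ extended by value $i$ at $ht(s)$. Height order: $s<_{ho}t$ iff $ht(s)<ht(t)$, or $ht(s)=ht(t)$ and $s(\Delta(s,t))<t(\Delta(s,t))$; for finite $a\subseteq 2^{<\omega_1}$, $a(0),\dots,a(|a|-1)$ is the $<_{ho}$-increasing enumeration. $\mathrm{PFA}(S)$: for every proper poset $\mathcal{P}$ with $\Vdash_{\mathcal{P}}$ "$S$ is Suslin" and every family of $\omega_1$ dense subsets of $\mathcal{P}$, there is a filter meeting them all. $\mathcal{C}^0_n$ ($0<n<\omega$): uncountable $A\subseteq[S]^{2n}$ with some $s=stem(A)\in S$ such that for all $a\in A$: $s^\frown0<_S a(0)<_S\cdots<_S a(n-1)$, $s^\frown1<_S a(n)<_S\cdots<_S a(2n-1)$,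 $ht(a(n-1))<ht(a(n))$, $D_{a(n-1),a(n)}=\{ht(s)\}$; and for $a\ne b$ in $A$, $ht(a(2n-1))<ht(b(0))$ or $ht(b(2n-1))<ht(a(0))$. $\mathcal{C}^0=\bigcup_n\mathcal{C}^0_n$, $N_A$ the $n$ with $A\in\mathcal{C}^0_n$. $\varphi_0(c)$: for all $0<n<\omega$, $A_0,\dots,A_{n-1}\in\mathcal{C}^0$, pairwise distinct $\langle s_\alpha\in S:\alpha<\omega_1\rangle$ and $\langle x^i_\alpha\in[A_i]^{<\omega}:i<n,\alpha<\omega_1\rangle$ with each $\langle x^i_\alpha:\alpha<\omega_1\rangle$ pairwise disjoint, there are $\alpha<\beta$ with $s_\alpha<_S s_\beta$ and for every $i<n$, $a\in x^i_\alpha$, $b\in x^i_\beta$ some $j<2$ satisfies $c(a(k),b(k'))=j$ and $c(a(N_{A_i}+k),b(N_{A_i}+k'))=1-j$ for all $k,k'<N_{A_i}$. *)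

theory Defs
  imports "HOL-Library.Countable_Set_Type" "HOL-Library.Disjoint_Sets"
begin

unbundle cardinal_syntax

section \<open>The ordinal \<open>\<omega>\<^sub>1\<close>\<close>

typedef omega1 = "Field (cardSuc natLeq)"
proof -
  have "Card_order (cardSuc natLeq)"
    by (simp add: cardSuc_Card_order natLeq_Card_order)
  moreover have "natLeq <o cardSuc natLeq"
    by (simp add: cardSuc_greater natLeq_Card_order)
  ultimately have "\<not> finite (Field (cardSuc natLeq))"
    by (metis cardSuc_finite Field_natLeq infinite_UNIV_nat natLeq_Card_order)
  then show ?thesis
    by (metis ex_in_conv finite.emptyI)
qed

lemma Well_order_cardSuc_natLeq: "Well_order (cardSuc natLeq)"
  using cardSuc_Card_order[OF natLeq_Card_order] by (simp add: card_order_on_def)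

instantiation omega1 :: wellorder
begin

definition less_eq_omega1 :: "omega1 \<Rightarrow> omega1 \<Rightarrow> bool" where
  "less_eq_omega1 \<alpha> \<beta> \<longleftrightarrow> (Rep_omega1 \<alpha>, Rep_omega1 \<beta>) \<in> cardSuc natLeq"

definition less_omega1 :: "omega1 \<Rightarrow> omega1 \<Rightarrow> bool" where
  "less_omega1 \<alpha> \<beta> \<longleftrightarrow> \<alpha> \<le> \<beta> \<and> \<alpha> \<noteq> \<beta>"

instance
proof
  note wo = Well_order_cardSuc_natLeq[unfolded order_on_defs]
  have antisym: "\<alpha> = \<beta>" if "\<alpha> \<le> \<beta>" "\<beta> \<le> \<alpha>" for \<alpha> \<beta> :: omega1
    using that wo unfolding less_eq_omega1_def
    by (meson Rep_omega1_inject antisymD)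
  show "(\<alpha> < \<beta>) = (\<alpha> \<le> \<beta> \<and> \<not> \<beta> \<le> \<alpha>)" for \<alpha> \<beta> :: omega1
    using antisym unfolding less_omega1_def by blast
  show refl: "\<alpha> \<le> \<alpha>" for \<alpha> :: omega1
    using wo Rep_omega1[of \<alpha>] unfolding less_eq_omega1_def by (auto simp: refl_on_def)
  show "\<alpha> \<le> \<gamma>" if "\<alpha> \<le> \<beta>" "\<beta> \<le> \<gamma>" for \<alpha> \<beta> \<gamma> :: omega1
    using that wo unfolding less_eq_omega1_def by (meson transD)
  show "\<alpha> = \<beta>" if "\<alpha> \<le> \<beta>" "\<beta> \<le> \<alpha>" for \<alpha> \<beta> :: omega1
    using antisym that .
  show "\<alpha> \<le> \<beta> \<or> \<beta> \<le> \<alpha>" for \<alpha> \<beta> :: omega1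
  proof (cases "\<alpha> = \<beta>")
    case False
    then have "Rep_omega1 \<alpha> \<noteq> Rep_omega1 \<beta>" by (simp add: Rep_omega1_inject)
    then show ?thesis
      using wo Rep_omega1[of \<alpha>] Rep_omega1[of \<beta>]
      unfolding less_eq_omega1_def total_on_def by blast
  qed (use refl in simp)
  show "P \<alpha>" if step: "\<And>\<beta>. (\<And>\<gamma>. \<gamma> < \<beta> \<Longrightarrow> P \<gamma>) \<Longrightarrow> P \<beta>" for P and \<alpha> :: omega1
  proof -
    have "wf (inv_image (cardSuc natLeq - Id) Rep_omega1)"
      using wo by (intro wf_inv_image) blast
    then show ?thesis
    proof (induction \<alpha> rule: wf_induct_rule)
      case (less \<beta>)
      show ?case
      proof (rule step)
        fix \<gamma> assume "\<gamma> < \<beta>"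
        then have "(\<gamma>, \<beta>) \<in> inv_image (cardSuc natLeq - Id) Rep_omega1"
          by (auto simp: less_omega1_def less_eq_omega1_def Rep_omega1_inject)
        then show "P \<gamma>" by (rule less)
      qed
    qed
  qed
qed

end

lemma bij_betw_Rep_omega1: "bij_betw Rep_omega1 UNIV (Field (cardSuc natLeq))"
  unfolding bij_betw_def using type_definition.Rep_range[OF type_definition_omega1]
  by (simp add: inj_on_def Rep_omega1_inject)

lemma uncountable_omega1: "uncountable (UNIV :: omega1 set)"
proof
  assume "countable (UNIV :: omega1 set)"
  then have "countable (Field (cardSuc natLeq))"
    using bij_betw_Rep_omega1 by (metis bij_betw_def countable_image)
  then have "|Field (cardSuc natLeq)| \<le>o natLeq"
    by (simp add: countable_card_le_natLeq)
  then have "cardSuc natLeq \<le>o natLeq"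
    using card_of_Field_ordIso[OF cardSuc_Card_order[OF natLeq_Card_order]]
    by (meson ordIso_ordLeq_trans ordIso_symmetric)
  then show False
    using cardSuc_greater[OF natLeq_Card_order] not_ordLess_ordLeq by blast
qed

lemma countable_initial_segment_omega1: "countable {..<\<alpha>::omega1}"
proof -
  let ?r = "cardSuc natLeq"
  have "|underS ?r (Rep_omega1 \<alpha>)| <o ?r"
    using card_of_underS[OF cardSuc_Card_order[OF natLeq_Card_order] Rep_omega1] .
  then have "|underS ?r (Rep_omega1 \<alpha>)| \<le>o natLeq"
    using cardSuc_ordLeq_ordLess[OF natLeq_Card_order card_of_Card_order] by blast
  then have "countable (underS ?r (Rep_omega1 \<alpha>))"
    by (simp add: countable_card_le_natLeq)
  moreover have "Rep_omega1 ` {..<\<alpha>} \<subseteq> underS ?r (Rep_omega1 \<alpha>)"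
    by (auto simp: underS_def less_omega1_def less_eq_omega1_def Rep_omega1_inject)
  ultimately have "countable (Rep_omega1 ` {..<\<alpha>})"
    by (rule countable_subset[rotated])
  then show ?thesis
    by (rule countable_image_inj_on) (simp add: inj_on_def Rep_omega1_inject)
qed


section \<open>Coherent Suslin trees\<close>

text \<open>
  An ordinal is identified with its set of predecessors, so that a transfinite binary sequence of
  length \<open>\<alpha>\<close> is a partial function with domain \<open>{..<\<alpha>}\<close>; the values \<open>0, 1\<close> are \<open>False, True\<close>.
\<close>

type_synonym node = "omega1 \<rightharpoonup> bool"

definition binary_seqs :: "node set" where
  "binary_seqs = {t. \<exists>\<alpha>. dom t = {..<\<alpha>}}"

definition ht :: "node \<Rightarrow> omega1" where
  "ht t = (THE \<alpha>. dom t = {..<\<alpha>})"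

lemma ht_eq: "dom t = {..<\<alpha>} \<Longrightarrow> ht t = \<alpha>"
  unfolding ht_def by (rule the_equality) auto

definition tree_less :: "node \<Rightarrow> node \<Rightarrow> bool" where
  "tree_less s t \<longleftrightarrow> s \<subseteq>\<^sub>m t \<and> s \<noteq> t"

definition comparable :: "node \<Rightarrow> node \<Rightarrow> bool" where
  "comparable s t \<longleftrightarrow> tree_less s t \<or> s = t \<or> tree_less t s"

definition downward_closed :: "node set \<Rightarrow> bool" where
  "downward_closed S \<longleftrightarrow> (\<forall>t\<in>S. \<forall>\<alpha>\<le>ht t. t |` {..<\<alpha>} \<in> S)"

text \<open>
  A tree is Suslin if it is uncountable and has neither uncountable chains nor uncountable
  antichains.  Its levels are then countable, so its height is \<open>\<omega>\<^sub>1\<close>.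
\<close>

definition suslin_tree :: "node set \<Rightarrow> bool" where
  "suslin_tree S \<longleftrightarrow>
     S \<subseteq> binary_seqs \<and> downward_closed S \<and> uncountable S \<and>
     (\<forall>C\<subseteq>S. (\<forall>s\<in>C. \<forall>t\<in>C. comparable s t) \<longrightarrow> countable C) \<and>
     (\<forall>A\<subseteq>S. (\<forall>s\<in>A. \<forall>t\<in>A. comparable s t \<longrightarrow> s = t) \<longrightarrow> countable A)"

definition Delta :: "node \<Rightarrow> node \<Rightarrow> omega1" where
  "Delta s t = (GREATEST \<alpha>. \<alpha> \<le> min (ht s) (ht t) \<and> s |` {..<\<alpha>} = t |` {..<\<alpha>})"

definition diff_set :: "node \<Rightarrow> node \<Rightarrow> omega1 set" where
  "diff_set s t = {\<xi>. \<xi> < min (ht s) (ht t) \<and> s \<xi> \<noteq> t \<xi>}"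

definition coherent :: "node set \<Rightarrow> bool" where
  "coherent S \<longleftrightarrow> (\<forall>s\<in>S. \<forall>t\<in>S. finite (diff_set s t))"

definition complete_coherent :: "node set \<Rightarrow> bool" where
  "complete_coherent S \<longleftrightarrow>
     coherent S \<and>
     (\<forall>s\<in>S. \<forall>t\<in>binary_seqs. ht t = ht s \<longrightarrow> finite (diff_set s t) \<longrightarrow> t \<in> S)"

definition snoc :: "node \<Rightarrow> bool \<Rightarrow> node" where
  "snoc s i = s(ht s \<mapsto> i)"

definition ho_less :: "node \<Rightarrow> node \<Rightarrow> bool" where
  "ho_less s t \<longleftrightarrow>
     ht s < ht t \<or> ht s = ht t \<and> \<not> the (s (Delta s t)) \<and> the (t (Delta s t))"

definition ho_enum :: "node set \<Rightarrow> node list" where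
  "ho_enum a = (THE ts. sorted_wrt ho_less ts \<and> set ts = a)"

abbreviation ho_nth :: "node set \<Rightarrow> nat \<Rightarrow> node" where
  "ho_nth a k \<equiv> ho_enum a ! k"


section \<open>Forcing\<close>

text \<open>
  A forcing notion is a nonempty partial order \<open>r\<close> on a set \<open>P\<close>, where \<open>(p, q) \<in> r\<close> means that
  \<open>p\<close> is stronger than \<open>q\<close>.
\<close>

definition dense_in :: "'p set \<Rightarrow> 'p rel \<Rightarrow> 'p set \<Rightarrow> bool" where
  "dense_in P r D \<longleftrightarrow> D \<subseteq> P \<and> (\<forall>p\<in>P. \<exists>d\<in>D. (d, p) \<in> r)"

definition poset_filter :: "'p set \<Rightarrow> 'p rel \<Rightarrow> 'p set \<Rightarrow> bool" where
  "poset_filter P r G \<longleftrightarrow>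
     G \<subseteq> P \<and> G \<noteq> {} \<and>
     (\<forall>p\<in>G. \<forall>q\<in>P. (p, q) \<in> r \<longrightarrow> q \<in> G) \<and>
     (\<forall>p\<in>G. \<forall>q\<in>G. \<exists>u\<in>G. (u, p) \<in> r \<and> (u, q) \<in> r)"

definition compatible :: "'p set \<Rightarrow> 'p rel \<Rightarrow> 'p \<Rightarrow> 'p \<Rightarrow> bool" where
  "compatible P r p q \<longleftrightarrow> (\<exists>u\<in>P. (u, p) \<in> r \<and> (u, q) \<in> r)"

subsection \<open>The forcing relation\<close>

text \<open>
  A statement of the forcing language is represented by the set of conditions that force it, and
  \<open>\<lambda>_. b\<close> represents a statement \<open>b\<close> about the ground model.  The clauses below are the usual
  recursive clauses of the forcing relation.  A name for a subset of a ground-model set \<open>X\<close> is a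
  set of pairs in \<open>X \<times> P\<close>, and every subset of \<open>X\<close> in the extension has such a name.  Hence
  quantification over the subsets of \<open>X\<close> in the extension is quantification over these names.
\<close>

type_synonym 'p fstmt = "'p \<Rightarrow> bool"

definition fmem :: "'p set \<Rightarrow> 'p rel \<Rightarrow> 'x \<Rightarrow> ('x \<times> 'p) set \<Rightarrow> 'p fstmt" where
  "fmem P r x \<tau> p \<longleftrightarrow>
     (\<forall>q\<in>P. (q, p) \<in> r \<longrightarrow> (\<exists>u\<in>P. (u, q) \<in> r \<and> (\<exists>v\<in>P. (u, v) \<in> r \<and> (x, v) \<in> \<tau>)))"

definition fnot :: "'p set \<Rightarrow> 'p rel \<Rightarrow> 'p fstmt \<Rightarrow> 'p fstmt" where
  "fnot P r \<phi> p \<longleftrightarrow> (\<forall>q\<in>P. (q, p) \<in> r \<longrightarrow> \<not> \<phi> q)"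

definition fimp :: "'p set \<Rightarrow> 'p rel \<Rightarrow> 'p fstmt \<Rightarrow> 'p fstmt \<Rightarrow> 'p fstmt" where
  "fimp P r \<phi> \<psi> p \<longleftrightarrow> (\<forall>q\<in>P. (q, p) \<in> r \<longrightarrow> \<phi> q \<longrightarrow> \<psi> q)"

definition fand :: "'p fstmt \<Rightarrow> 'p fstmt \<Rightarrow> 'p fstmt" where
  "fand \<phi> \<psi> p \<longleftrightarrow> \<phi> p \<and> \<psi> p"

definition fall :: "'x set \<Rightarrow> ('x \<Rightarrow> 'p fstmt) \<Rightarrow> 'p fstmt" where
  "fall X \<Phi> p \<longleftrightarrow> (\<forall>x\<in>X. \<Phi> x p)"

definition fex :: "'p set \<Rightarrow> 'p rel \<Rightarrow> 'x set \<Rightarrow> ('x \<Rightarrow> 'p fstmt) \<Rightarrow> 'p fstmt" where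
  "fex P r X \<Phi> p \<longleftrightarrow> (\<forall>q\<in>P. (q, p) \<in> r \<longrightarrow> (\<exists>u\<in>P. (u, q) \<in> r \<and> (\<exists>x\<in>X. \<Phi> x u)))"

text \<open>
  The set named by \<open>\<tau>\<close>, a subset of \<open>X\<close>, is countable: it is contained in the range of a partial
  function from \<open>\<omega>\<close> to \<open>X\<close>.
\<close>

definition fcountable :: "'p set \<Rightarrow> 'p rel \<Rightarrow> 'x set \<Rightarrow> ('x \<times> 'p) set \<Rightarrow> 'p fstmt" where
  "fcountable P r X \<tau> =
     fex P r (Pow ((UNIV \<times> X) \<times> P)) (\<lambda>f.
       fand
         (fall (UNIV :: nat set) (\<lambda>n. fall X (\<lambda>x. fall X (\<lambda>y.
            fimp P r (fmem P r (n, x) f) (fimp P r (fmem P r (n, y) f) (\<lambda>_. x = y))))))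
         (fall X (\<lambda>x. fimp P r (fmem P r x \<tau>)
            (fex P r (UNIV :: nat set) (\<lambda>n. fmem P r (n, x) f)))))"

text \<open>
  The statement ``\<open>S\<close> is Suslin'' of the forcing language, clause by clause as in
  \<^const>\<open>suslin_tree\<close>; \<open>S \<times> P\<close> is the canonical name of \<open>S\<close>.  The remaining clauses
  of \<^const>\<open>suslin_tree\<close> do not change between the ground model and the extension.
\<close>

definition fsuslin :: "'p set \<Rightarrow> 'p rel \<Rightarrow> node set \<Rightarrow> 'p fstmt" where
  "fsuslin P r S =
     fand (fnot P r (fcountable P r S (S \<times> P)))
    (fand
      (fall (Pow (S \<times> P)) (\<lambda>C.
        fimp P r
          (fall S (\<lambda>s. fall S (\<lambda>t.
             fimp P r (fmem P r s C) (fimp P r (fmem P r t C) (\<lambda>_. comparable s t)))))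
          (fcountable P r S C)))
      (fall (Pow (S \<times> P)) (\<lambda>A.
        fimp P r
          (fall S (\<lambda>s. fall S (\<lambda>t.
             fimp P r (fmem P r s A) (fimp P r (fmem P r t A)
               (\<lambda>_. comparable s t \<longrightarrow> s = t)))))
          (fcountable P r S A))))"

definition forces_suslin :: "'p set \<Rightarrow> 'p rel \<Rightarrow> node set \<Rightarrow> bool" where
  "forces_suslin P r S \<longleftrightarrow> (\<forall>p\<in>P. fsuslin P r S p)"

subsection \<open>The structure \<open>H(\<theta>)\<close>\<close>

text \<open>
  The type \<open>'q hset\<close> is \<open>H(\<theta>)\<close> for \<open>\<theta>\<close> the successor of the cardinality of \<open>'q\<close>: its elements are
  the sets of hereditary cardinality at most that of \<open>'q\<close>.  Such a set is coded by a well-founded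
  tree whose root has a (partial) \<open>'q\<close>-indexed family of subtrees coding the elements.
\<close>

datatype 'q hcode = HCode "'q \<Rightarrow> 'q hcode option"

inductive hcode_eq :: "'q hcode \<Rightarrow> 'q hcode \<Rightarrow> bool" where
  "(\<forall>x\<in>ran f. \<exists>y\<in>ran g. hcode_eq x y) \<Longrightarrow> (\<forall>y\<in>ran g. \<exists>x\<in>ran f. hcode_eq x y) \<Longrightarrow>
   hcode_eq (HCode f) (HCode g)"

lemma hcode_eq_HCode:
  "hcode_eq (HCode f) (HCode g) \<longleftrightarrow>
     (\<forall>x\<in>ran f. \<exists>y\<in>ran g. hcode_eq x y) \<and> (\<forall>y\<in>ran g. \<exists>x\<in>ran f. hcode_eq x y)"
  by (subst hcode_eq.simps) auto

lemma hcode_induct [case_names HCode]: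
  assumes "\<And>f. (\<And>x. x \<in> ran f \<Longrightarrow> Q x) \<Longrightarrow> Q (HCode f)"
  shows "Q (c :: 'q hcode)"
proof (induction c)
  case (HCode f)
  show ?case
  proof (rule assms)
    fix x assume "x \<in> ran f"
    then obtain i where "f i = Some x" by (auto simp: ran_def)
    then show "Q x" using HCode[of "Some x" x] by (metis option.set_intros rangeI)
  qed
qed

lemma hcode_eq_refl: "hcode_eq c c"
proof (induction c rule: hcode_induct)
  case (HCode f)
  then show ?case by (auto simp: hcode_eq_HCode)
qed

lemma hcode_eq_sym: "hcode_eq c d \<Longrightarrow> hcode_eq d c"
proof (induction rule: hcode_eq.induct)
  case (1 f g)
  then show ?case by (auto simp: hcode_eq_HCode)
qed

lemma hcode_eq_trans: "hcode_eq c d \<Longrightarrow> hcode_eq d e \<Longrightarrow> hcode_eq c e"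
proof (induction c arbitrary: d e rule: hcode_induct)
  case (HCode f)
  obtain g h where [simp]: "d = HCode g" "e = HCode h" by (meson hcode.exhaust)
  from HCode.prems show ?case
    unfolding \<open>d = HCode g\<close> \<open>e = HCode h\<close> hcode_eq_HCode using HCode.IH by meson
qed

quotient_type 'q hset = "'q hcode" / hcode_eq
  by (intro equivpI reflpI sympI transpI) (blast intro: hcode_eq_refl hcode_eq_sym hcode_eq_trans)+

lift_definition hmem :: "'q hset \<Rightarrow> 'q hset \<Rightarrow> bool" is
  "\<lambda>x y. case y of HCode f \<Rightarrow> \<exists>z\<in>ran f. hcode_eq x z"
proof -
  fix x x' y y' :: "'q hcode"
  assume x: "hcode_eq x x'" and y: "hcode_eq y y'"
  obtain f g where fg: "y = HCode f" "y' = HCode g" by (meson hcode.exhaust)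
  show "(case y of HCode f \<Rightarrow> \<exists>z\<in>ran f. hcode_eq x z) =
        (case y' of HCode f \<Rightarrow> \<exists>z\<in>ran f. hcode_eq x' z)"
    using x y unfolding fg hcode_eq_HCode hcode.case
    by (meson hcode_eq_sym hcode_eq_trans)
qed

definition hset_of :: "'q hset set \<Rightarrow> 'q hset" where
  "hset_of A = (THE x. \<forall>y. hmem y x \<longleftrightarrow> y \<in> A)"

lemma hset_extensional:
  assumes "\<And>z. hmem z x \<longleftrightarrow> hmem z y"
  shows "x = y"
  using assms
proof transfer
  fix c d :: "'q hcode"
  assume *: "\<And>z. (case c of HCode f \<Rightarrow> \<exists>y\<in>ran f. hcode_eq z y) =
                  (case d of HCode f \<Rightarrow> \<exists>y\<in>ran f. hcode_eq z y)"
  obtain f g where fg: "c = HCode f" "d = HCode g" by (meson hcode.exhaust)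
  have **: "(\<exists>y\<in>ran f. hcode_eq z y) \<longleftrightarrow> (\<exists>y\<in>ran g. hcode_eq z y)" for z
    using *[of z] by (simp add: fg)
  show "hcode_eq c d"
    unfolding fg hcode_eq_HCode using ** hcode_eq_refl hcode_eq_sym by meson
qed

lemma hmem_abs_HCode: "hmem y (abs_hset (HCode f)) \<longleftrightarrow> (\<exists>z\<in>ran f. y = abs_hset z)"
proof -
  obtain c where y: "y = abs_hset c"
    by (metis Quotient3_abs_rep Quotient3_hset)
  show ?thesis
    unfolding y by (simp add: hmem.abs_eq hset.abs_eq_iff)
qed

lemma hmem_hset_of:
  assumes "|A| \<le>o |UNIV :: 'q set|"
  shows "hmem y (hset_of A) \<longleftrightarrow> y \<in> (A :: 'q hset set)"
proof -
  obtain j :: "'q hset \<Rightarrow> 'q" where j: "inj_on j A"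
    using assms card_of_ordLeq[of A "UNIV :: 'q set"] by auto
  define f where "f i = (if i \<in> j ` A then Some (rep_hset (inv_into A j i)) else None)" for i
  have "ran f = rep_hset ` A"
  proof
    show "ran f \<subseteq> rep_hset ` A"
      by (auto simp: f_def ran_def inv_into_into split: if_splits)
    have "f (j a) = Some (rep_hset a)" if "a \<in> A" for a
      using that j by (simp add: f_def)
    then show "rep_hset ` A \<subseteq> ran f"
      by (auto intro: ranI)
  qed
  then have f: "\<forall>y. hmem y (abs_hset (HCode f)) \<longleftrightarrow> y \<in> A"
    by (auto simp: hmem_abs_HCode Quotient3_abs_rep[OF Quotient3_hset])
  have "\<forall>y. hmem y (hset_of A) \<longleftrightarrow> y \<in> A"
    unfolding hset_of_def
  proof (rule theI)
    show "\<forall>y. hmem y (abs_hset (HCode f)) \<longleftrightarrow> y \<in> A" by (rule f)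
    show "x = abs_hset (HCode f)" if "\<forall>y. hmem y x \<longleftrightarrow> y \<in> A" for x
      using that f by (intro hset_extensional) blast
  qed
  then show ?thesis ..
qed

lemma card_hset_elements:
  "|{y. hmem y x}| \<le>o |UNIV :: 'q set|" for x :: "'q hset"
proof -
  obtain f where x: "x = abs_hset (HCode f)"
    by (metis Quotient3_abs_rep Quotient3_hset hcode.exhaust)
  have "{y. hmem y x} \<subseteq> (\<lambda>i. abs_hset (the (f i))) ` UNIV"
    by (auto simp: x hmem_abs_HCode ran_def image_iff) (metis option.sel)
  then show ?thesis
    by (meson card_of_image card_of_mono1 ordLeq_transitive)
qed

definition hpair :: "'q hset \<Rightarrow> 'q hset \<Rightarrow> 'q hset" where
  "hpair x y = hset_of {hset_of {x}, hset_of {x, y}}"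

subsection \<open>Elementary submodels and properness\<close>

datatype fm = Mem nat nat | Eq nat nat | Neg fm | Conj fm fm | Ex nat fm

primrec sat :: "'u set \<Rightarrow> ('u \<Rightarrow> 'u \<Rightarrow> bool) \<Rightarrow> fm \<Rightarrow> (nat \<Rightarrow> 'u) \<Rightarrow> bool" where
  "sat M E (Mem i j) v \<longleftrightarrow> E (v i) (v j)"
| "sat M E (Eq i j) v \<longleftrightarrow> v i = v j"
| "sat M E (Neg \<phi>) v \<longleftrightarrow> \<not> sat M E \<phi> v"
| "sat M E (Conj \<phi> \<psi>) v \<longleftrightarrow> sat M E \<phi> v \<and> sat M E \<psi> v"
| "sat M E (Ex i \<phi>) v \<longleftrightarrow> (\<exists>x\<in>M. sat M E \<phi> (v(i := x)))"

definition elementary_submodel :: "'q hset set \<Rightarrow> bool" where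
  "elementary_submodel M \<longleftrightarrow>
     M \<noteq> {} \<and> (\<forall>\<phi> v. range v \<subseteq> M \<longrightarrow> sat M hmem \<phi> v = sat UNIV hmem \<phi> v)"

text \<open>
  Properness is the standard definition with \<open>\<theta> = (2\<^sup>\<kappa>)\<^sup>+\<close>, where \<open>\<kappa>\<close> is the cardinality of the type
  \<open>'p\<close> of conditions.  As conditions are not literally elements of \<open>H(\<theta>)\<close>, the poset is replaced
  by its isomorphic copies \<open>poset_code e P r\<close> whose conditions are elements \<open>e p\<close> of \<open>H(\<theta>)\<close>;
  the choice of \<open>e\<close> is immaterial.
\<close>

definition poset_code :: "('p \<Rightarrow> 'q hset) \<Rightarrow> 'p set \<Rightarrow> 'p rel \<Rightarrow> 'q hset" where
  "poset_code e P r = hpair (hset_of (e ` P)) (hset_of ((\<lambda>(p, q). hpair (e p) (e q)) ` r))"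

definition generic_condition ::
  "('p \<Rightarrow> 'q hset) \<Rightarrow> 'p set \<Rightarrow> 'p rel \<Rightarrow> 'q hset set \<Rightarrow> 'p \<Rightarrow> bool" where
  "generic_condition e P r M q \<longleftrightarrow>
     (\<forall>D. dense_in P r D \<longrightarrow> hset_of (e ` D) \<in> M \<longrightarrow>
        (\<forall>q'\<in>P. (q', q) \<in> r \<longrightarrow> (\<exists>d\<in>D. e d \<in> M \<and> compatible P r d q')))"

definition proper :: "'p set \<Rightarrow> 'p rel \<Rightarrow> bool" where
  "proper P r \<longleftrightarrow>
     (\<forall>(e :: 'p \<Rightarrow> 'p set hset) M.
        inj_on e P \<longrightarrow> countable M \<longrightarrow> elementary_submodel M \<longrightarrow> poset_code e P r \<in> M \<longrightarrow>
        (\<forall>p\<in>P. e p \<in> M \<longrightarrow> (\<exists>q\<in>P. (q, p) \<in> r \<and> generic_condition e P r M q)))"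

subsection \<open>The axiom \<open>PFA(S)\<close>\<close>

text \<open>
  A formula of HOL cannot quantify over types, so the type \<open>'p\<close> in which the posets live is a
  parameter: \<open>PFA_S TYPE('p) S\<close> is \<open>PFA(S)\<close> for the posets whose underlying set has at most as many
  elements as \<open>'p\<close>.  It becomes stronger as \<open>'p\<close> becomes larger, and \<open>PFA(S)\<close> for arbitrary
  posets implies every instance.  For small \<open>'p\<close> it says nothing (a minimal condition of a
  finite poset lies in every dense set), so a user of it has to require that \<open>'p\<close> is sufficiently large.
\<close>

definition PFA_S :: "'p itself \<Rightarrow> node set \<Rightarrow> bool" where
  "PFA_S _ S \<longleftrightarrow>
     (\<forall>(P :: 'p set) r.
        P \<noteq> {} \<longrightarrow> partial_order_on P r \<longrightarrow> proper P r \<longrightarrow> forces_suslin P r S \<longrightarrow>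
        (\<forall>D :: omega1 \<Rightarrow> 'p set. (\<forall>\<alpha>. dense_in P r (D \<alpha>)) \<longrightarrow>
           (\<exists>G. poset_filter P r G \<and> (\<forall>\<alpha>. G \<inter> D \<alpha> \<noteq> {}))))"


section \<open>The families \<open>\<C>\<^sup>0\<^sub>n\<close> and the property \<open>\<phi>\<^sub>0(c)\<close>\<close>

definition is_stem :: "node \<Rightarrow> nat \<Rightarrow> node set set \<Rightarrow> bool" where
  "is_stem s n A \<longleftrightarrow>
     (\<forall>a\<in>A.
        tree_less (snoc s False) (ho_nth a 0) \<and>
        (\<forall>k. k + 1 < n \<longrightarrow> tree_less (ho_nth a k) (ho_nth a (k + 1))) \<and>
        tree_less (snoc s True) (ho_nth a n) \<and>
        (\<forall>k. n \<le> k \<and> k + 1 < 2 * n \<longrightarrow> tree_less (ho_nth a k) (ho_nth a (k + 1))) \<and>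
        ht (ho_nth a (n - 1)) < ht (ho_nth a n) \<and>
        diff_set (ho_nth a (n - 1)) (ho_nth a n) = {ht s})"

definition C0n :: "node set \<Rightarrow> nat \<Rightarrow> node set set set" where
  "C0n S n =
     {A. uncountable A \<and>
         (\<forall>a\<in>A. a \<subseteq> S \<and> finite a \<and> card a = 2 * n) \<and>
         (\<exists>s\<in>S. is_stem s n A) \<and>
         (\<forall>a\<in>A. \<forall>b\<in>A. a \<noteq> b \<longrightarrow>
            ht (ho_nth a (2 * n - 1)) < ht (ho_nth b 0) \<or>
            ht (ho_nth b (2 * n - 1)) < ht (ho_nth a 0))}"

definition C0 :: "node set \<Rightarrow> node set set set" where
  "C0 S = (\<Union>n\<in>{0<..}. C0n S n)"

definition N_of :: "node set \<Rightarrow> node set set \<Rightarrow> nat" where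
  "N_of S A = (THE n. 0 < n \<and> A \<in> C0n S n)"

text \<open>
  A colouring \<open>[S]\<^sup>2 \<rightarrow> 2\<close> is a function on sets of nodes of which only the values at two-element
  subsets of \<open>S\<close> matter.
\<close>

definition phi0 :: "node set \<Rightarrow> (node set \<Rightarrow> bool) \<Rightarrow> bool" where
  "phi0 S c \<longleftrightarrow>
     (\<forall>n>0. \<forall>(A :: nat \<Rightarrow> node set set) (s :: omega1 \<Rightarrow> node) (x :: nat \<Rightarrow> omega1 \<Rightarrow> node set set).
        (\<forall>i<n. A i \<in> C0 S) \<longrightarrow>
        (\<forall>\<alpha>. s \<alpha> \<in> S) \<longrightarrow> inj s \<longrightarrow>
        (\<forall>i<n. \<forall>\<alpha>. finite (x i \<alpha>) \<and> x i \<alpha> \<subseteq> A i) \<longrightarrow>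
        (\<forall>i<n. disjoint_family (x i)) \<longrightarrow>
        (\<exists>\<alpha> \<beta>. \<alpha> < \<beta> \<and> tree_less (s \<alpha>) (s \<beta>) \<and>
           (\<forall>i<n. \<forall>a\<in>x i \<alpha>. \<forall>b\<in>x i \<beta>. \<exists>j :: bool.
              \<forall>k<N_of S (A i). \<forall>k'<N_of S (A i).
                c {ho_nth a k, ho_nth b k'} = j \<and>
                c {ho_nth a (N_of S (A i) + k), ho_nth b (N_of S (A i) + k')} = (\<not> j))))"

end

theory Submission
  imports Defs
begin

text \<open>
  Assume \<open>\<phi>\<^sub>0(c)\<close>.  The key point is that any family of nodes that is unbounded above \<open>s\<^sub>0\<close> contains,
  for a suitable \<open>v\<close> above \<open>s\<^sub>0\<close> and any \<open>n\<close> nodes \<open>y\<close> above \<open>v\<close>, a node \<open>x\<close> below \<open>v\<close> with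
  \<open>c{x, y} = 0\<close> for all of them, even if the nodes \<open>y\<close> are pairwise incomparable.  Otherwise
  every \<open>v\<close> has a bad tuple above it.  Take a bad tuple \<open>(y\<^sub>j)\<close> on the side of \<open>0\<close> of a stem and, for every
  \<open>j\<close>, a bad tuple \<open>(y'\<^sub>j\<^sub>k)\<close> above the flip of \<open>y\<^sub>j\<close>.  Applied to the pairs \<open>{y\<^sub>j, y'\<^sub>j\<^sub>k}\<close>,
  \<open>\<phi>\<^sub>0(c)\<close> yields \<open>x\<close> and \<open>x'\<close> on the two sides such that \<open>c{x, y\<^sub>j}\<close> and \<open>c{x', y'\<^sub>j\<^sub>k}\<close> always differ.  If
  \<open>c{x, y\<^sub>j} = 1\<close>, then \<open>c{x', y'\<^sub>j\<^sub>k} = 0\<close> for every \<open>k\<close>, so one of the two tuples is not bad.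

  Consequently the poset of finite subsets of \<open>S\<close> on whose comparable pairs \<open>c\<close> is \<open>0\<close>, with finite chains
  of countable models as side conditions, is proper, and so is its product with \<open>S\<close>; hence it preserves
  \<open>S\<close>.  \<open>PFA(S)\<close> provides an uncountable set on whose comparable pairs \<open>c\<close> is \<open>0\<close>, which contradicts the
  key point for \<open>\<not> c\<close>.
\<close>

section \<open>Coherent Suslin trees\<close>

text \<open>\<open>phi0\<close> controls a pair of indices only when \<open>s \<alpha>\<close> lies
  below \<open>s \<beta>\<close>, so a colour can be avoided only along a branch of the tree. Hence
  unboundedness is always relative to a node (\<open>large\<close>), and a condition of the poset is
  always treated together with a node \<open>t\<close>; genericity for the poset and for its product
  with \<open>S\<close> then come from one lemma. The obstacle is that a node of a condition outside
  a model need not extend the branch \<open>t\<close> along which one works inside the model. By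
  coherence its restriction to the height \<delta> of the model is \<open>t\<close> restricted to
  \<delta> with finitely many values switched, and these finitely many coordinates are in the model.
  So avoidance has to be proved for tuples above finitely many flips of one node
  (\<open>avoids\<close>). New nodes are found one at a time inside the model. The ordinal
  thresholds needed for this are countably many once the parameters are bounded by a countable
  ordinal, so they merge into one function on the countable ordinals, and the model contains it.
  This is why a side condition records just the ordinals and functions of a model, and why the nodes
  above it must be so far apart that these functions do not lead from one to the next.\<close>

lemma countable_atMost_omega1: "countable {..\<alpha>::omega1}"
proof -
  have "{..\<alpha>} = insert \<alpha> {..<\<alpha>}" by auto
  then show ?thesis using countable_initial_segment_omega1[of \<alpha>] by simp
qed

lemma omega1_bounded:
  assumes "countable (A :: omega1 set)"
  shows "\<exists>\<beta>. \<forall>\<alpha>\<in>A. \<alpha> < \<beta>"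
proof (rule ccontr)
  assume "\<not> ?thesis"
  then have "UNIV = (\<Union>\<alpha>\<in>A. {..\<alpha>})"
    by (auto simp: not_less)
  then show False
    using assms uncountable_omega1 countable_atMost_omega1 by (metis countable_UN)
qed

text \<open>For finite \<open>E\<close> these maps are automorphisms of a complete coherent tree,
  and by coherence they act transitively on each level.\<close>

definition flip :: "omega1 set \<Rightarrow> node \<Rightarrow> node" where
  "flip E t = (\<lambda>\<xi>. if \<xi> \<in> E then map_option Not (t \<xi>) else t \<xi>)"

lemma dom_flip [simp]: "dom (flip E t) = dom t"
  by (auto simp: flip_def dom_def)

lemma ht_flip [simp]: "ht (flip E t) = ht t"
  by (simp add: ht_def)

lemma flip_flip [simp]: "flip E (flip E t) = t"
proof -
  have "Not \<circ> Not = id" by auto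
  then show ?thesis by (auto simp: flip_def option.map_comp option.map_id)
qed

lemma flip_mono: "s \<subseteq>\<^sub>m t \<Longrightarrow> flip E s \<subseteq>\<^sub>m flip E t"
  unfolding map_le_def
proof
  fix a assume *: "\<forall>a\<in>dom s. s a = t a" and "a \<in> dom (flip E s)"
  then have "s a = t a" by (metis dom_flip)
  then show "flip E s a = flip E t a" by (simp add: flip_def)
qed

lemma flip_mono_iff [simp]: "flip E s \<subseteq>\<^sub>m flip E t \<longleftrightarrow> s \<subseteq>\<^sub>m t"
  using flip_mono[of s t E] flip_mono[of "flip E s" "flip E t" E] by auto

section \<open>Levels, extensions and upward closed sets in a complete coherent Suslin tree\<close>

locale cc_suslin =
  fixes S :: "node set"
  assumes suslin: "suslin_tree S" and cc: "complete_coherent S"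
begin

lemma dom_node: "t \<in> S \<Longrightarrow> dom t = {..<ht t}"
proof -
  assume "t \<in> S"
  then have "t \<in> binary_seqs" using suslin unfolding suslin_tree_def by (meson subsetD)
  then obtain \<alpha> where "dom t = {..<\<alpha>}" unfolding binary_seqs_def by auto
  then show ?thesis using ht_eq[of t \<alpha>] by (simp only:)
qed

lemma node_Some_iff: "t \<in> S \<Longrightarrow> t \<xi> \<noteq> None \<longleftrightarrow> \<xi> < ht t"
  using dom_node[of t] by (metis domIff lessThan_iff)

lemma cut_in: "t \<in> S \<Longrightarrow> \<alpha> \<le> ht t \<Longrightarrow> t |` {..<\<alpha>} \<in> S"
  using suslin unfolding suslin_tree_def downward_closed_def by blast

lemma ht_cut: "t \<in> S \<Longrightarrow> \<alpha> \<le> ht t \<Longrightarrow> ht (t |` {..<\<alpha>}) = \<alpha>"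
  by (rule ht_eq) (auto simp: dom_node)

lemma cut_le: "t |` A \<subseteq>\<^sub>m t"
  by (auto simp: map_le_def restrict_map_def split: if_splits)

lemma sub_ht: "s \<in> S \<Longrightarrow> t \<in> S \<Longrightarrow> s \<subseteq>\<^sub>m t \<Longrightarrow> ht s \<le> ht t"
  using dom_node map_le_implies_dom_le
  by (metis lessThan_subset_iff)

lemma sub_chain:
  assumes "s \<in> S" "t \<in> S" "s \<subseteq>\<^sub>m w" "t \<subseteq>\<^sub>m w" "ht s \<le> ht t"
  shows "s \<subseteq>\<^sub>m t"
  unfolding map_le_def
proof
  fix a assume a: "a \<in> dom s"
  then have "a \<in> dom t" using assms dom_node by auto
  then show "s a = t a" using a assms by (metis map_le_def)
qed

lemma sub_eq: "s \<in> S \<Longrightarrow> t \<in> S \<Longrightarrow> s \<subseteq>\<^sub>m t \<Longrightarrow> ht t \<le> ht s \<Longrightarrow> s = t"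
  by (meson map_le_antisym map_le_refl sub_chain)

lemma binary_seqI: "dom t = {..<\<alpha>} \<Longrightarrow> t \<in> binary_seqs"
  by (auto simp: binary_seqs_def)

lemma modify_in:
  assumes "s \<in> S" "dom t = {..<ht s}" "finite {\<xi>. \<xi> < ht s \<and> s \<xi> \<noteq> t \<xi>}"
  shows "t \<in> S"
proof -
  have "ht t = ht s" using assms(2) by (rule ht_eq)
  then show ?thesis
    using cc assms binary_seqI[OF assms(2)] unfolding complete_coherent_def diff_set_def by auto
qed

lemma flip_in: "s \<in> S \<Longrightarrow> finite E \<Longrightarrow> flip E s \<in> S"
  by (rule modify_in[of s]) (auto simp del: domIff simp: dom_node, auto simp: flip_def elim: rev_finite_subset)

lemma coherence:
  assumes "s \<in> S" "t \<in> S" "ht s = ht t"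
  obtains E where "finite E" "E \<subseteq> {..<ht s}" "t = flip E s"
proof
  let ?E = "diff_set s t"
  show "finite ?E" using cc assms unfolding complete_coherent_def coherent_def by auto
  show "?E \<subseteq> {..<ht s}" by (auto simp: diff_set_def)
  show "t = flip ?E s"
  proof
    fix \<xi>
    show "t \<xi> = flip ?E s \<xi>"
      using node_Some_iff[OF assms(1), of \<xi>] node_Some_iff[OF assms(2), of \<xi>] assms(3)
      by (cases "s \<xi>"; cases "t \<xi>") (auto simp: flip_def diff_set_def)
  qed
qed

lemma countable_level: "countable {t \<in> S. ht t = \<alpha>}"
proof -
  have "s = t" if "s \<in> S" "t \<in> S" "ht s = \<alpha>" "ht t = \<alpha>" "comparable s t" for s t
    using that sub_eq[of s t] sub_eq[of t s] unfolding comparable_def tree_less_def by auto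
  then have "\<forall>s\<in>{t \<in> S. ht t = \<alpha>}. \<forall>t\<in>{t \<in> S. ht t = \<alpha>}. comparable s t \<longrightarrow> s = t" by blast
  moreover have "{t \<in> S. ht t = \<alpha>} \<subseteq> S" by blast
  ultimately show ?thesis using suslin unfolding suslin_tree_def by blast
qed

lemma countable_below: "countable {t \<in> S. ht t \<le> \<alpha>}"
proof -
  have "{t \<in> S. ht t \<le> \<alpha>} = (\<Union>\<beta>\<in>{..\<alpha>}. {t \<in> S. ht t = \<beta>})" by auto
  then show ?thesis using countable_level countable_atMost_omega1 by auto
qed

lemma uncountable_S: "uncountable S"
  using suslin unfolding suslin_tree_def by blast

text \<open>Let \<open>s\<close> overwrite the bottom part of a restriction of some tall node
  \<open>w\<close>. By coherence only finitely many values change, so completeness puts the result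
  into \<open>S\<close>.\<close>

lemma extension:
  assumes "s \<in> S" "ht s \<le> \<alpha>"
  obtains t where "t \<in> S" "s \<subseteq>\<^sub>m t" "ht t = \<alpha>"
proof -
  obtain w where w: "w \<in> S" "\<alpha> \<le> ht w"
    using countable_subset[OF _ countable_below[of \<alpha>], of S] uncountable_S by (metis (mono_tags, lifting) linorder_le_cases mem_Collect_eq subsetI)
  let ?w = "w |` {..<\<alpha>}"
  let ?t = "?w ++ s"
  have w': "?w \<in> S" "ht ?w = \<alpha>" using cut_in ht_cut w by auto
  have "dom ?t = {..<\<alpha>}" using dom_node[OF w'(1)] dom_node[OF assms(1)] w'(2) assms(2) by auto
  moreover have "{\<xi>. \<xi> < ht ?w \<and> ?w \<xi> \<noteq> ?t \<xi>} \<subseteq> diff_set s ?w"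
  proof
    fix \<xi> assume "\<xi> \<in> {\<xi>. \<xi> < ht ?w \<and> ?w \<xi> \<noteq> ?t \<xi>}"
    then show "\<xi> \<in> diff_set s ?w"
      using w'(2) assms(2) node_Some_iff[OF assms(1), of \<xi>]
      by (cases "s \<xi>") (auto simp: diff_set_def map_add_def)
  qed
  moreover have "finite (diff_set s ?w)"
    using cc assms(1) w' unfolding complete_coherent_def coherent_def by auto
  ultimately have "?t \<in> S"
    using modify_in[OF w'(1), of ?t] w'(2) finite_subset by (metis (no_types, lifting))
  moreover have "ht ?t = \<alpha>" using \<open>dom ?t = _\<close> by (rule ht_eq)
  ultimately show ?thesis using that by (metis map_le_map_add)
qed

lemma extension_above:
  assumes "s \<in> S" "countable A"
  obtains t where "t \<in> S" "s \<subseteq>\<^sub>m t" "ht s < ht t" "\<And>\<alpha>. \<alpha> \<in> A \<Longrightarrow> \<alpha> < ht t"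
proof -
  obtain \<beta> where "\<forall>\<alpha>\<in>insert (ht s) A. \<alpha> < \<beta>" using omega1_bounded[of "insert (ht s) A"] assms by auto
  moreover from this have "ht s \<le> \<beta>" by auto
  then obtain t where "t \<in> S" "s \<subseteq>\<^sub>m t" "ht t = \<beta>"
    using extension[OF assms(1), of \<beta>] by metis
  ultimately show ?thesis using that[of t] by auto
qed

text \<open>The minimal elements of \<open>B\<close> form an antichain, hence a countable set, and
  \<gamma> lies above their heights. In terms of forcing with \<open>S\<close>: from level \<gamma>
  on, every node decides whether the generic branch enters \<open>B\<close>.\<close>

lemma suslin_dense:
  assumes "\<And>v w. v \<in> B \<Longrightarrow> w \<in> S \<Longrightarrow> v \<subseteq>\<^sub>m w \<Longrightarrow> w \<in> B" "B \<subseteq> S"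
  obtains \<gamma> where "\<And>v w. v \<in> S \<Longrightarrow> \<gamma> \<le> ht v \<Longrightarrow> w \<in> B \<Longrightarrow> v \<subseteq>\<^sub>m w \<Longrightarrow> v \<in> B"
proof -
  define A where "A = {v \<in> B. \<forall>w\<in>B. w \<subseteq>\<^sub>m v \<longrightarrow> w = v}"
  have "countable A"
  proof -
    have "s = t" if "s \<in> A" "t \<in> A" "comparable s t" for s t
      using that unfolding A_def comparable_def tree_less_def by auto
    then have "\<forall>s\<in>A. \<forall>t\<in>A. comparable s t \<longrightarrow> s = t" by blast
    moreover have "A \<subseteq> S" using assms(2) A_def by auto
    ultimately show ?thesis using suslin unfolding suslin_tree_def by blast
  qed
  then obtain \<gamma> where \<gamma>: "\<forall>\<alpha>\<in>ht ` A. \<alpha> < \<gamma>" using omega1_bounded[of "ht ` A"] by auto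
  show ?thesis
  proof
    fix v w assume v: "v \<in> S" "\<gamma> \<le> ht v" "w \<in> B" "v \<subseteq>\<^sub>m w"
    then have w: "w \<in> S" using assms by auto
    let ?P = "\<lambda>\<alpha>. \<exists>u\<in>B. u \<subseteq>\<^sub>m w \<and> ht u = \<alpha>"
    define \<alpha> where "\<alpha> = (LEAST \<alpha>. ?P \<alpha>)"
    have "?P (ht w)" using v(3) map_le_refl by blast
    then have "?P \<alpha>" unfolding \<alpha>_def by (rule LeastI)
    then obtain u where u: "u \<in> B" "u \<subseteq>\<^sub>m w" "ht u = \<alpha>" by auto
    have "u' = u" if "u' \<in> B" "u' \<subseteq>\<^sub>m u" for u'
    proof -
      have "?P (ht u')" using that u map_le_trans by blast
      then have "\<alpha> \<le> ht u'" unfolding \<alpha>_def by (rule Least_le)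
      then show ?thesis using sub_eq that u assms by blast
    qed
    then have "u \<in> A" using u by (auto simp: A_def)
    then have "u \<subseteq>\<^sub>m v" using \<gamma> v u w assms(2) sub_chain[of u v w] by force
    then show "v \<in> B" using assms(1) u(1) v(1) by auto
  qed
qed

end

section \<open>Avoiding a colour by \<open>\<phi>\<^sub>0\<close>\<close>

lemma ho_enum_pair:
  assumes "ht a < ht b"
  shows "ho_enum {a, b} = [a, b]"
  unfolding ho_enum_def
proof (rule the_equality)
  show "sorted_wrt ho_less [a, b] \<and> set [a, b] = {a, b}"
    using assms by (auto simp: ho_less_def)
next
  fix ts assume ts: "sorted_wrt ho_less ts \<and> set ts = {a, b}"
  have irrefl: "\<not> ho_less t t" for t by (simp add: ho_less_def)
  have "\<not> ho_less b a" using assms by (auto simp: ho_less_def)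
  have "distinct ts"
    unfolding distinct_conv_nth using ts irrefl
    by (metis linorder_neqE_nat sorted_wrt_nth_less)
  then have "length ts = card {a, b}"
    using ts distinct_card[of ts] by simp
  moreover have "a \<noteq> b" using assms by auto
  ultimately have "length ts = 2" by simp
  then obtain p q where "ts = [p, q]"
    by (metis (no_types, opaque_lifting) One_nat_def Suc_1 Suc_length_conv length_0_conv)
  then show "ts = [a, b]"
    using ts irrefl \<open>\<not> ho_less b a\<close> by (auto simp: doubleton_eq_iff)
qed

text \<open>Padding by \<open>v\<close> gives all bad tuples the same nonzero length
  \<open>Suc n\<close>, also when \<open>Y\<close> is small or empty.\<close>

lemma finite_enum_padded:
  assumes "finite Y" "card Y \<le> n"
  obtains y :: "nat \<Rightarrow> 'a" where "y ` {..<Suc n} = insert v Y"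
proof -
  obtain h where h: "bij_betw h {0..<card Y} Y"
    using ex_bij_betw_nat_finite[OF assms(1)] by auto
  have "(\<lambda>j. if j < card Y then h j else v) ` {..<Suc n} = insert v Y"
  proof -
    have "{..<Suc n} = {0..<card Y} \<union> {card Y..n}" using assms(2) by auto
    moreover have "(\<lambda>j. if j < card Y then h j else v) ` {0..<card Y} = h ` {0..<card Y}" by auto
    moreover have "(\<lambda>j. if j < card Y then h j else v) ` {card Y..n} = {v}" using assms(2) by auto
    ultimately show ?thesis using h by (simp only: image_Un bij_betw_def) auto
  qed
  then show ?thesis using that by blast
qed

section \<open>Names for unbounded sets of nodes, and flip pairs over a stem\<close>

context cc_suslin
begin

text \<open>\<open>K\<close> acts as a name in the forcing \<open>S\<close>: a pair
  \<open>(x, \<sigma>)\<close> means that \<open>\<sigma>\<close> puts \<open>x\<close> into the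
  named set. In these terms, \<open>s0\<close> forces that the heights of the members of this set
  are unbounded.\<close>

definition large :: "(node \<times> node) set \<Rightarrow> node \<Rightarrow> bool" where
  "large K s0 \<longleftrightarrow>
     (\<forall>s\<in>S. s0 \<subseteq>\<^sub>m s \<longrightarrow> (\<forall>\<alpha>. \<exists>x \<sigma>. (x, \<sigma>) \<in> K \<and> s \<subseteq>\<^sub>m \<sigma> \<and> \<alpha> \<le> ht x))"

text \<open>The members of a family in \<open>C0n S 1\<close> with stem \<open>s\<close>. Since
  \<open>b\<close> is taller, it extends the flip of \<open>a\<close> at the single coordinate
  \<open>ht s\<close>.\<close>

definition flip_pair :: "node \<Rightarrow> node \<Rightarrow> node \<Rightarrow> bool" where
  "flip_pair s a b \<longleftrightarrow> a \<in> S \<and> b \<in> S \<and> ht a < ht b \<and> diff_set a b = {ht s} \<and>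
     tree_less (snoc s False) a \<and> tree_less (snoc s True) b"

lemma sub_flip_ht:
  assumes "s \<in> S" "s \<subseteq>\<^sub>m t"
  shows "s \<subseteq>\<^sub>m flip {ht s} t"
proof -
  have "ht s \<notin> dom s" using dom_node[OF assms(1)] by simp
  then show ?thesis using assms(2) by (auto simp: map_le_def flip_def)
qed

lemma tree_less_snoc:
  assumes "s \<in> S" "x \<in> S" "s \<subseteq>\<^sub>m x" "x (ht s) = Some b" "ht s < \<eta>" "\<eta> < ht x"
  shows "tree_less (snoc s b) x"
proof -
  have "snoc s b \<subseteq>\<^sub>m x" using assms(3,4) by (auto simp: snoc_def map_le_def)
  moreover have "x \<eta> \<noteq> None" "snoc s b \<eta> = None"
    using node_Some_iff[OF assms(2), of \<eta>] node_Some_iff[OF assms(1), of \<eta>] assms(5,6)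
    by (auto simp: snoc_def)
  ultimately show ?thesis unfolding tree_less_def by auto
qed

lemma flip_pairI:
  assumes s: "s \<in> S" and a: "a \<in> S" "s \<subseteq>\<^sub>m a" "a (ht s) = Some False"
    and b: "b \<in> S" "flip {ht s} a \<subseteq>\<^sub>m b" "ht a < ht b" and \<eta>: "ht s < \<eta>" "\<eta> < ht a"
  shows "flip_pair s a b"
proof -
  have ab: "b \<xi> = flip {ht s} a \<xi>" if "\<xi> < ht a" for \<xi>
  proof -
    have "\<xi> \<in> dom (flip {ht s} a)" using that dom_node[OF a(1)] by simp
    then show ?thesis using b(2) by (simp add: map_le_def)
  qed
  have "ht s < ht a" using \<eta> by simp
  have "diff_set a b = {ht s}"
  proof (intro equalityI subsetI)
    fix \<xi> assume "\<xi> \<in> diff_set a b"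
    then show "\<xi> \<in> {ht s}" using ab[of \<xi>] by (auto simp: diff_set_def flip_def split: if_splits)
  next
    fix \<xi> assume "\<xi> \<in> {ht s}"
    then show "\<xi> \<in> diff_set a b" using ab[of \<xi>] a(3) b(3) \<open>ht s < ht a\<close>
      by (auto simp: diff_set_def flip_def)
  qed
  moreover have "b (ht s) = Some True" using ab[OF \<open>ht s < ht a\<close>] a(3) by (simp add: flip_def)
  moreover have "s \<subseteq>\<^sub>m b" using sub_flip_ht[OF s a(2)] b(2) map_le_trans by blast
  moreover have "\<eta> < ht b" using \<eta> b by simp
  ultimately show ?thesis
    unfolding flip_pair_def using assms tree_less_snoc by blast
qed

lemma C0n_1I:
  assumes s: "s \<in> S" and unc: "uncountable A"
    and A: "\<And>a. a \<in> A \<Longrightarrow> \<exists>p q. a = {p, q} \<and> flip_pair s p q"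
    and sep: "\<And>p q p' q'. {p, q} \<in> A \<Longrightarrow> {p', q'} \<in> A \<Longrightarrow> flip_pair s p q \<Longrightarrow> flip_pair s p' q' \<Longrightarrow>
       {p, q} \<noteq> {p', q'} \<Longrightarrow> ht q < ht p' \<or> ht q' < ht p"
  shows "A \<in> C0n S 1"
proof -
  have *: "\<exists>p q. a = {p, q} \<and> flip_pair s p q \<and> ho_enum a = [p, q]" if "a \<in> A" for a
    using A[OF that] ho_enum_pair unfolding flip_pair_def by blast
  have "a \<subseteq> S \<and> finite a \<and> card a = 2 * 1" if "a \<in> A" for a
  proof -
    obtain p q where "a = {p, q}" "flip_pair s p q" using A[OF \<open>a \<in> A\<close>] by blast
    moreover from this have "p \<noteq> q" by (auto simp: flip_pair_def)
    ultimately show ?thesis by (auto simp: flip_pair_def)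
  qed
  moreover have "is_stem s 1 A"
    unfolding is_stem_def
  proof
    fix a assume "a \<in> A"
    from *[OF this] obtain p q where "flip_pair s p q" "ho_enum a = [p, q]" by blast
    then show "tree_less (snoc s False) (ho_nth a 0) \<and>
        (\<forall>k. k + 1 < 1 \<longrightarrow> tree_less (ho_nth a k) (ho_nth a (k + 1))) \<and>
        tree_less (snoc s True) (ho_nth a 1) \<and>
        (\<forall>k. 1 \<le> k \<and> k + 1 < 2 * 1 \<longrightarrow> tree_less (ho_nth a k) (ho_nth a (k + 1))) \<and>
        ht (ho_nth a (1 - 1)) < ht (ho_nth a 1) \<and>
        diff_set (ho_nth a (1 - 1)) (ho_nth a 1) = {ht s}"
      by (auto simp: flip_pair_def)
  qed
  moreover have "ht (ho_nth a (2 * 1 - 1)) < ht (ho_nth b 0) \<or> ht (ho_nth b (2 * 1 - 1)) < ht (ho_nth a 0)"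
    if "a \<in> A" "b \<in> A" "a \<noteq> b" for a b
  proof -
    obtain p q p' q' where "a = {p, q}" "b = {p', q'}" "flip_pair s p q" "flip_pair s p' q'"
      "ho_enum a = [p, q]" "ho_enum b = [p', q']"
      using *[OF \<open>a \<in> A\<close>] *[OF \<open>b \<in> A\<close>] by blast
    then show ?thesis using sep[of p q p' q'] that by simp
  qed
  ultimately show ?thesis using s unc unfolding C0n_def by blast
qed

lemma N_of_C0n:
  assumes "A \<in> C0n S n" "0 < n"
  shows "N_of S A = n"
  unfolding N_of_def
proof (rule the_equality)
  show "0 < n \<and> A \<in> C0n S n" using assms by simp
  fix m assume m: "0 < m \<and> A \<in> C0n S m"
  have "uncountable A" using assms unfolding C0n_def by simp
  then obtain a where "a \<in> A" by fastforce
  then have "card a = 2 * n" "card a = 2 * m" using m assms unfolding C0n_def by auto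
  then show "m = n" by simp
qed

lemma large_mono: "large K s \<Longrightarrow> s \<subseteq>\<^sub>m s' \<Longrightarrow> large K s'"
  unfolding large_def using map_le_trans by blast

text \<open>Members of a family in \<open>C0n\<close> are chains on either side of the stem, while
  the nodes of \<open>Y\<close> may be incomparable. So each pair of positions \<open>(j, k)\<close>
  gets its own family of two-element sets, and \<open>phi0\<close> is applied to all these
  \<open>?m * ?m\<close> families at once.\<close>

lemma phi0_avoid:
  assumes phi: "phi0 S c" and K: "K \<subseteq> S \<times> S" "\<And>x \<sigma>. (x, \<sigma>) \<in> K \<Longrightarrow> x \<subseteq>\<^sub>m \<sigma>"
    and s0: "s0 \<in> S" "large K s0"
  shows "\<exists>v\<in>S. s0 \<subseteq>\<^sub>m v \<and> (\<forall>Y\<subseteq>{y \<in> S. v \<subseteq>\<^sub>m y}. finite Y \<longrightarrow> card Y \<le> n \<longrightarrow>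
    (\<exists>x \<sigma>. (x, \<sigma>) \<in> K \<and> \<sigma> \<subseteq>\<^sub>m v \<and> ht x < ht v \<and> (\<forall>y\<in>Y. \<not> c {x, y})))"
proof (rule ccontr)
  assume neg: "\<not> ?thesis"
  let ?m = "Suc n"
  let ?bad = "\<lambda>v y. (\<forall>j<?m. y j \<in> S \<and> v \<subseteq>\<^sub>m y j) \<and>
       (\<forall>x \<sigma>. (x, \<sigma>) \<in> K \<longrightarrow> \<sigma> \<subseteq>\<^sub>m v \<longrightarrow> ht x < ht v \<longrightarrow> (\<exists>j<?m. c {x, y j}))"
  have "\<exists>y. ?bad v y" if v: "v \<in> S" "s0 \<subseteq>\<^sub>m v" for v
  proof -
    obtain Y where Y: "Y \<subseteq> {y \<in> S. v \<subseteq>\<^sub>m y}" "finite Y" "card Y \<le> n"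
      and *: "\<And>x \<sigma>. (x, \<sigma>) \<in> K \<Longrightarrow> \<sigma> \<subseteq>\<^sub>m v \<Longrightarrow> ht x < ht v \<Longrightarrow> \<exists>y\<in>Y. c {x, y}"
      using neg v by meson
    obtain y where y: "y ` {..<?m} = insert v Y"
      using finite_enum_padded[OF Y(2,3)] by metis
    have "y j \<in> S \<and> v \<subseteq>\<^sub>m y j" if "j < ?m" for j
    proof -
      have "y j \<in> insert v Y" using y that by blast
      then show ?thesis using Y v by auto
    qed
    moreover have "\<exists>j<?m. c {x, y j}" if x: "(x, \<sigma>) \<in> K" "\<sigma> \<subseteq>\<^sub>m v" "ht x < ht v" for x \<sigma>
    proof -
      obtain z where "z \<in> Y" "c {x, z}" using *[OF x] by blast
      moreover from this obtain j where "j \<in> {..<?m}" "z = y j" using y by blast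
      ultimately show ?thesis by auto
    qed
    ultimately show ?thesis by blast
  qed
  then obtain yy where yy: "\<And>v. v \<in> S \<Longrightarrow> s0 \<subseteq>\<^sub>m v \<Longrightarrow> ?bad v (yy v)"
    by metis
  define fl where "fl = flip {ht s0}"
  have fl_in: "fl t \<in> S" if "t \<in> S" for t using that flip_in by (simp add: fl_def)
  have fl_s0: "s0 \<subseteq>\<^sub>m fl t" if "s0 \<subseteq>\<^sub>m t" for t using sub_flip_ht[OF s0(1) that] by (simp add: fl_def)
  have [simp]: "ht (fl t) = ht t" "fl (fl t) = t" "fl s \<subseteq>\<^sub>m fl t \<longleftrightarrow> s \<subseteq>\<^sub>m t" for s t by (simp_all add: fl_def)
  obtain \<tau> where \<tau>: "\<tau> \<in> S" "s0 \<subseteq>\<^sub>m \<tau>" "ht s0 < ht \<tau>" "\<tau> (ht s0) = Some False"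
  proof -
    obtain t where t: "t \<in> S" "s0 \<subseteq>\<^sub>m t" "ht s0 < ht t" using extension_above[OF s0(1), of "{}"] by auto
    then obtain b where b: "t (ht s0) = Some b" using node_Some_iff[of t "ht s0"] by auto
    show ?thesis
    proof (cases b)
      case True
      then have "fl t (ht s0) = Some False" using b by (simp add: fl_def flip_def)
      then show ?thesis using that[of "fl t"] t fl_in fl_s0 by simp
    next
      case False
      then show ?thesis using that t b by simp
    qed
  qed
  have pairI: "flip_pair s0 a b"
    if "a \<in> S" "\<tau> \<subseteq>\<^sub>m a" "ht \<tau> < ht a" "b \<in> S" "fl a \<subseteq>\<^sub>m b" "ht a < ht b" for a b
  proof (rule flip_pairI[OF s0(1) that(1)])
    show "s0 \<subseteq>\<^sub>m a" using \<tau>(2) that(2) map_le_trans by blast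
    have "ht s0 \<in> dom \<tau>" using \<tau> by auto
    then show "a (ht s0) = Some False" using \<tau> that(2) by (metis map_le_def)
  qed (use that \<tau> in \<open>auto simp: fl_def\<close>)
  \<comment> \<open>One block: \<open>x\<close> and \<open>x'\<close> from \<open>K\<close> on the
    two sides of the stem, a node \<open>v\<close> such that \<open>x\<close> has a witness below
    \<open>v\<close> and \<open>x'\<close> one below the flip of \<open>v\<close>, a bad tuple
    \<open>y\<close> for \<open>v\<close>, and for each \<open>j\<close> a tuple \<open>y' j\<close>
    above the flip of \<open>y j\<close> that is bad for the flip of \<open>v\<close>. All these
    pairs have heights between \<gamma> and \<theta>.\<close>
  define Q where "Q \<gamma> = (\<lambda>(x, x', v, y :: nat \<Rightarrow> node, y' :: nat \<Rightarrow> nat \<Rightarrow> node, \<theta> :: omega1).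
     \<gamma> < ht x \<and> ht x' < ht v \<and> v \<in> S \<and> flip_pair s0 x x' \<and>
     (\<forall>j<?m. \<forall>k<?m. v \<subseteq>\<^sub>m y j \<and> flip_pair s0 (y j) (y' j k) \<and> ht (y' j k) < \<theta>) \<and>
     (\<exists>\<sigma>. (x, \<sigma>) \<in> K \<and> \<sigma> \<subseteq>\<^sub>m v) \<and> (\<exists>\<sigma>. (x', \<sigma>) \<in> K \<and> \<sigma> \<subseteq>\<^sub>m fl v) \<and>
     (\<forall>x \<sigma>. (x, \<sigma>) \<in> K \<longrightarrow> \<sigma> \<subseteq>\<^sub>m v \<longrightarrow> ht x < ht v \<longrightarrow> (\<exists>j<?m. c {x, y j})) \<and>
     (\<forall>j<?m. \<forall>x \<sigma>. (x, \<sigma>) \<in> K \<longrightarrow> \<sigma> \<subseteq>\<^sub>m fl v \<longrightarrow> ht x < ht v \<longrightarrow> (\<exists>k<?m. c {x, y' j k})))" for \<gamma>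
  have block: "\<exists>b. Q \<gamma> b" for \<gamma>
  proof -
    obtain \<beta> where \<beta>: "\<forall>\<alpha>\<in>{\<gamma>, ht \<tau>}. \<alpha> < \<beta>" using omega1_bounded[of "{\<gamma>, ht \<tau>}"] by auto
    obtain x \<sigma> where x: "(x, \<sigma>) \<in> K" "\<tau> \<subseteq>\<^sub>m \<sigma>" "\<beta> \<le> ht x"
      using s0(2) \<tau>(1,2) unfolding large_def by blast
    have xS: "x \<in> S" "\<sigma> \<in> S" "x \<subseteq>\<^sub>m \<sigma>" using x K by auto
    have tx: "ht \<tau> < ht x" "\<gamma> < ht x" using x(3) \<beta> by (auto intro: less_le_trans)
    have "\<tau> \<subseteq>\<^sub>m x" using sub_chain[OF \<tau>(1) xS(1) x(2) xS(3)] tx by auto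
    obtain \<beta>' where \<beta>': "\<forall>\<alpha>\<in>{ht \<sigma>}. \<alpha> < \<beta>'" using omega1_bounded[of "{ht \<sigma>}"] by auto
    have "s0 \<subseteq>\<^sub>m \<sigma>" using \<tau>(2) x(2) map_le_trans by blast
    then obtain x' \<sigma>' where x': "(x', \<sigma>') \<in> K" "fl \<sigma> \<subseteq>\<^sub>m \<sigma>'" "\<beta>' \<le> ht x'"
      using s0(2) fl_in[OF xS(2)] fl_s0 unfolding large_def by blast
    have xS': "x' \<in> S" "\<sigma>' \<in> S" "x' \<subseteq>\<^sub>m \<sigma>'" using x' K by auto
    have tx': "ht \<sigma> < ht x'" using x'(3) \<beta>' by (auto intro: less_le_trans)
    have "fl \<sigma> \<subseteq>\<^sub>m x'" using sub_chain[OF fl_in[OF xS(2)] xS'(1) x'(2) xS'(3)] tx' by auto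
    moreover have "fl x \<subseteq>\<^sub>m fl \<sigma>" using xS by simp
    ultimately have "fl x \<subseteq>\<^sub>m x'" using map_le_trans by blast
    have "ht x < ht x'" using sub_ht[OF xS] tx' by order
    have pair_x: "flip_pair s0 x x'"
      using pairI[OF xS(1) \<open>\<tau> \<subseteq>\<^sub>m x\<close> tx(1) xS'(1) \<open>fl x \<subseteq>\<^sub>m x'\<close> \<open>ht x < ht x'\<close>] .
    \<comment> \<open>The flip of \<open>\<sigma>'\<close> extends \<open>\<sigma>\<close>, so
      \<open>\<sigma>\<close> lies below \<open>v\<close> while \<open>\<sigma>'\<close> lies below
      the flip of \<open>v\<close>.\<close>
    obtain v where v: "v \<in> S" "fl \<sigma>' \<subseteq>\<^sub>m v" "ht x' < ht v"
      using extension_above[OF fl_in[OF xS'(2)], of "{ht x'}"] by auto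
    have "\<sigma>' \<subseteq>\<^sub>m fl v" using flip_mono[OF v(2), of "{ht s0}"] by (fold fl_def) simp
    have "\<sigma> \<subseteq>\<^sub>m fl \<sigma>'" using flip_mono[OF x'(2), of "{ht s0}"] by (fold fl_def) simp
    then have "\<sigma> \<subseteq>\<^sub>m v" using v map_le_trans by blast
    then have "\<tau> \<subseteq>\<^sub>m v" "s0 \<subseteq>\<^sub>m v" using x(2) \<tau>(2) map_le_trans by blast+
    have \<tau>v: "ht \<tau> < ht v" using tx(1) \<open>ht x < ht x'\<close> v(3) by order
    define y where "y = yy v"
    have y: "y j \<in> S" "v \<subseteq>\<^sub>m y j" if "j < ?m" for j
      using yy[OF v(1) \<open>s0 \<subseteq>\<^sub>m v\<close>] that by (auto simp: y_def)
    \<comment> \<open>Going from the flip of \<open>y j\<close> to a taller node makes every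
      \<open>y' j k\<close> strictly taller than \<open>y j\<close>, as a flip pair
      requires.\<close>
    have "\<exists>w. j < ?m \<longrightarrow> w \<in> S \<and> fl (y j) \<subseteq>\<^sub>m w \<and> ht (y j) < ht w" for j
    proof (cases "j < ?m")
      case True
      then have "fl (y j) \<in> S" using y(1) fl_in by blast
      then show ?thesis using extension_above[of "fl (y j)" "{}"] by (metis \<open>\<And>t. ht (fl t) = ht t\<close> countable_empty)
    qed simp
    then obtain w where w: "\<And>j. j < ?m \<Longrightarrow> w j \<in> S \<and> fl (y j) \<subseteq>\<^sub>m w j \<and> ht (y j) < ht (w j)"
      by metis
    have s0w: "s0 \<subseteq>\<^sub>m w j" if "j < ?m" for j
    proof -
      have "s0 \<subseteq>\<^sub>m fl (y j)" using y(2)[OF that] \<open>s0 \<subseteq>\<^sub>m v\<close> fl_s0 map_le_trans by blast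
      then show ?thesis using w[OF that] map_le_trans by blast
    qed
    have badw: "?bad (w j) (yy (w j))" if "j < ?m" for j using yy[of "w j"] s0w[OF that] w[OF that] by blast
    define y' where "y' j k = yy (w j) k" for j k
    have vy: "ht v \<le> ht (y j)" if "j < ?m" for j using sub_ht[OF v(1) y[OF that]] .
    have pair_y: "flip_pair s0 (y j) (y' j k)" if jk: "j < ?m" "k < ?m" for j k
    proof (rule pairI)
      have 1: "y' j k \<in> S" "w j \<subseteq>\<^sub>m y' j k" using badw[OF jk(1)] jk(2) by (auto simp: y'_def)
      show "\<tau> \<subseteq>\<^sub>m y j" using \<open>\<tau> \<subseteq>\<^sub>m v\<close> y jk map_le_trans by blast
      show "ht \<tau> < ht (y j)" using \<tau>v vy[OF jk(1)] by order
      show "fl (y j) \<subseteq>\<^sub>m y' j k" using w[OF jk(1)] 1 map_le_trans by blast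
      show "ht (y j) < ht (y' j k)" using w[OF jk(1)] 1 sub_ht[of "w j" "y' j k"] by (auto intro: less_le_trans)
    qed (use y jk badw in \<open>auto simp: y'_def\<close>)
    obtain \<theta> where \<theta>: "\<forall>\<alpha>\<in>(\<lambda>(j, k). ht (y' j k)) ` ({..<?m} \<times> {..<?m}). \<alpha> < \<theta>"
      using omega1_bounded[of "(\<lambda>(j, k). ht (y' j k)) ` ({..<?m} \<times> {..<?m})"] by auto
    have flvw: "fl v \<subseteq>\<^sub>m w j" "ht v \<le> ht (w j)" if "j < ?m" for j
    proof -
      have "fl v \<subseteq>\<^sub>m fl (y j)" using y(2)[OF that] by simp
      then show "fl v \<subseteq>\<^sub>m w j" using w[OF that] map_le_trans by blast
      show "ht v \<le> ht (w j)" using vy[OF that] conjunct2[OF conjunct2[OF w[OF that]]] by order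
    qed
    have bad2: "\<exists>k<?m. c {x, y' j k}" if "j < ?m" "(x, \<sigma>) \<in> K" "\<sigma> \<subseteq>\<^sub>m fl v" "ht x < ht v" for j x \<sigma>
    proof -
      have "\<sigma> \<subseteq>\<^sub>m w j" "ht x < ht (w j)" using flvw[OF that(1)] that map_le_trans by (blast, simp)
      then show ?thesis using badw[OF that(1)] that(2) unfolding y'_def by blast
    qed
    have bad1: "\<exists>j<?m. c {x, y j}" if "(x, \<sigma>) \<in> K" "\<sigma> \<subseteq>\<^sub>m v" "ht x < ht v" for x \<sigma>
      using yy[OF v(1) \<open>s0 \<subseteq>\<^sub>m v\<close>] that unfolding y_def by blast
    have "Q \<gamma> (x, x', v, y, y', \<theta>)"
      unfolding Q_def split_conv
    proof (intro conjI)
      show "\<forall>j<?m. \<forall>k<?m. v \<subseteq>\<^sub>m y j \<and> flip_pair s0 (y j) (y' j k) \<and> ht (y' j k) < \<theta>"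
        using y(2) pair_y \<theta> by auto
      show "\<exists>\<sigma>. (x, \<sigma>) \<in> K \<and> \<sigma> \<subseteq>\<^sub>m v" using x(1) \<open>\<sigma> \<subseteq>\<^sub>m v\<close> by (intro exI conjI)
      show "\<exists>\<sigma>. (x', \<sigma>) \<in> K \<and> \<sigma> \<subseteq>\<^sub>m fl v" using x'(1) \<open>\<sigma>' \<subseteq>\<^sub>m fl v\<close> by (intro exI conjI)
      show "\<forall>x \<sigma>. (x, \<sigma>) \<in> K \<longrightarrow> \<sigma> \<subseteq>\<^sub>m v \<longrightarrow> ht x < ht v \<longrightarrow> (\<exists>j<?m. c {x, y j})"
        by (intro allI impI, rule bad1)
      show "\<forall>j<?m. \<forall>x \<sigma>. (x, \<sigma>) \<in> K \<longrightarrow> \<sigma> \<subseteq>\<^sub>m fl v \<longrightarrow> ht x < ht v \<longrightarrow> (\<exists>k<?m. c {x, y' j k})"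
        by (intro allI impI, rule bad2)
    qed (fact tx(2) v(3) v(1) pair_x)+
    then show ?thesis by blast
  qed
  \<comment> \<open>Recursion on the countable ordinals, each block lying above all earlier ones.
    This yields the separated heights in \<open>C0n\<close> and the disjointness of the families
    \<open>XX i\<close>.\<close>
  obtain f where f: "\<And>\<alpha>::omega1. \<exists>\<gamma>. (\<forall>\<beta><\<alpha>. (case f \<beta> of (x, x', v, y, y', \<theta>) \<Rightarrow> \<theta>) \<le> \<gamma>) \<and> Q \<gamma> (f \<alpha>)"
  proof -
    define \<theta>f where "\<theta>f = (\<lambda>b :: node \<times> node \<times> node \<times> (nat \<Rightarrow> node) \<times> (nat \<Rightarrow> nat \<Rightarrow> node) \<times> omega1.
      case b of (x, x', v, y, y', \<theta>) \<Rightarrow> \<theta>)"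
    define P where "P f \<alpha> b \<longleftrightarrow> (\<exists>\<gamma>. (\<forall>\<beta><\<alpha>. \<theta>f (f \<beta>) \<le> \<gamma>) \<and> Q \<gamma> b)" for f and \<alpha> :: omega1 and b
    have "\<exists>f. \<forall>\<alpha>. P f \<alpha> (f \<alpha>)"
    proof (rule dependent_wellorder_choice)
      show "P f \<alpha> r = P g \<alpha> r" if "\<And>y. y < \<alpha> \<Longrightarrow> f y = g y" for r f g \<alpha>
        using that by (simp add: P_def)
      show "\<exists>r. P f \<alpha> r" for \<alpha> f
      proof -
        obtain \<gamma> where "\<forall>\<beta>\<in>(\<lambda>\<beta>. \<theta>f (f \<beta>)) ` {..<\<alpha>}. \<beta> < \<gamma>"
          using omega1_bounded[of "(\<lambda>\<beta>. \<theta>f (f \<beta>)) ` {..<\<alpha>}"] countable_initial_segment_omega1 by auto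
        then have "\<forall>\<beta><\<alpha>. \<theta>f (f \<beta>) \<le> \<gamma>" by force
        then show ?thesis using block unfolding P_def by blast
      qed
    qed
    then obtain f where "\<forall>\<alpha>. P f \<alpha> (f \<alpha>)" ..
    then show ?thesis using that[of f] unfolding P_def \<theta>f_def by simp
  qed
  define X where "X \<alpha> = fst (f \<alpha>)" for \<alpha>
  define X' where "X' \<alpha> = fst (snd (f \<alpha>))" for \<alpha>
  define V where "V \<alpha> = fst (snd (snd (f \<alpha>)))" for \<alpha>
  define Y where "Y \<alpha> = fst (snd (snd (snd (f \<alpha>))))" for \<alpha>
  define Y' where "Y' \<alpha> = fst (snd (snd (snd (snd (f \<alpha>)))))" for \<alpha>
  define \<Theta> where "\<Theta> \<alpha> = snd (snd (snd (snd (snd (f \<alpha>)))))" for \<alpha>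
  have f_eq: "f \<alpha> = (X \<alpha>, X' \<alpha>, V \<alpha>, Y \<alpha>, Y' \<alpha>, \<Theta> \<alpha>)" for \<alpha>
    by (simp add: X_def X'_def V_def Y_def Y'_def \<Theta>_def)
  have q: "\<exists>\<gamma>. (\<forall>\<beta><\<alpha>. \<Theta> \<beta> \<le> \<gamma>) \<and> Q \<gamma> (X \<alpha>, X' \<alpha>, V \<alpha>, Y \<alpha>, Y' \<alpha>, \<Theta> \<alpha>)" for \<alpha>
    using f[of \<alpha>] by (simp add: f_eq)
  have qs: "\<And>\<beta>. \<beta> < \<alpha> \<Longrightarrow> \<Theta> \<beta> < ht (X \<alpha>)" "ht (X' \<alpha>) < ht (V \<alpha>)" "V \<alpha> \<in> S" "flip_pair s0 (X \<alpha>) (X' \<alpha>)"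
    "\<And>j k. j < ?m \<Longrightarrow> k < ?m \<Longrightarrow> V \<alpha> \<subseteq>\<^sub>m Y \<alpha> j \<and> flip_pair s0 (Y \<alpha> j) (Y' \<alpha> j k) \<and> ht (Y' \<alpha> j k) < \<Theta> \<alpha>"
    "\<exists>\<sigma>. (X \<alpha>, \<sigma>) \<in> K \<and> \<sigma> \<subseteq>\<^sub>m V \<alpha>" "\<exists>\<sigma>. (X' \<alpha>, \<sigma>) \<in> K \<and> \<sigma> \<subseteq>\<^sub>m fl (V \<alpha>)"
    "\<And>x \<sigma>. (x, \<sigma>) \<in> K \<Longrightarrow> \<sigma> \<subseteq>\<^sub>m V \<alpha> \<Longrightarrow> ht x < ht (V \<alpha>) \<Longrightarrow> (\<exists>j<?m. c {x, Y \<alpha> j})"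
    "\<And>j x \<sigma>. j < ?m \<Longrightarrow> (x, \<sigma>) \<in> K \<Longrightarrow> \<sigma> \<subseteq>\<^sub>m fl (V \<alpha>) \<Longrightarrow> ht x < ht (V \<alpha>) \<Longrightarrow> (\<exists>k<?m. c {x, Y' \<alpha> j k})"
    for \<alpha>
  proof -
    obtain \<gamma> where 1: "\<forall>\<beta><\<alpha>. \<Theta> \<beta> \<le> \<gamma>" and 2: "Q \<gamma> (X \<alpha>, X' \<alpha>, V \<alpha>, Y \<alpha>, Y' \<alpha>, \<Theta> \<alpha>)" using q[of \<alpha>] by blast
    note 3 = 2[unfolded Q_def split_conv]
    show "\<Theta> \<beta> < ht (X \<alpha>)" if "\<beta> < \<alpha>" for \<beta> using 1 that conjunct1[OF 3] by (meson le_less_trans)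
    show "ht (X' \<alpha>) < ht (V \<alpha>)" "V \<alpha> \<in> S" "flip_pair s0 (X \<alpha>) (X' \<alpha>)"
      "\<exists>\<sigma>. (X \<alpha>, \<sigma>) \<in> K \<and> \<sigma> \<subseteq>\<^sub>m V \<alpha>" "\<exists>\<sigma>. (X' \<alpha>, \<sigma>) \<in> K \<and> \<sigma> \<subseteq>\<^sub>m fl (V \<alpha>)"
      using 3 by simp_all
    show "V \<alpha> \<subseteq>\<^sub>m Y \<alpha> j \<and> flip_pair s0 (Y \<alpha> j) (Y' \<alpha> j k) \<and> ht (Y' \<alpha> j k) < \<Theta> \<alpha>"
      if "j < ?m" "k < ?m" for j k using 3 that by meson
    show "\<exists>j<?m. c {x, Y \<alpha> j}" if "(x, \<sigma>) \<in> K" "\<sigma> \<subseteq>\<^sub>m V \<alpha>" "ht x < ht (V \<alpha>)" for x \<sigma>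
      using 3 that by meson
    show "\<exists>k<?m. c {x, Y' \<alpha> j k}" if "j < ?m" "(x, \<sigma>) \<in> K" "\<sigma> \<subseteq>\<^sub>m fl (V \<alpha>)" "ht x < ht (V \<alpha>)" for j x \<sigma>
      using 3 that by meson
  qed
  note q1 = qs(1) and q2 = qs(2) and q3 = qs(3) and q4 = qs(4) and q5 = qs(5) and q6 = qs(6) and q7 = qs(7)
    and q8 = qs(8) and q9 = qs(9)
  have h1: "ht (X \<alpha>) < ht (X' \<alpha>)" for \<alpha> using q4[of \<alpha>] by (simp add: flip_pair_def)
  have h2: "ht (V \<alpha>) \<le> ht (Y \<alpha> j)" if "j < ?m" for \<alpha> j
    using q5[OF that that, of \<alpha>] q3[of \<alpha>] sub_ht[of "V \<alpha>" "Y \<alpha> j"] by (auto simp: flip_pair_def)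
  have h3: "ht (Y \<alpha> j) < ht (Y' \<alpha> j k)" "ht (Y' \<alpha> j k) < \<Theta> \<alpha>" if "j < ?m" "k < ?m" for \<alpha> j k
    using q5[OF that, of \<alpha>] by (auto simp: flip_pair_def)
  \<comment> \<open>Index 0 is the pair from \<open>K\<close>; index \<open>Suc (j * ?m + k)\<close>
    is the pair \<open>{Y \<alpha> j, Y' \<alpha> j k}\<close>.\<close>
  define B where "B i \<alpha> = (if i = 0 then {X \<alpha>, X' \<alpha>} else {Y \<alpha> ((i-1) div ?m), Y' \<alpha> ((i-1) div ?m) ((i-1) mod ?m)})"
    for i :: nat and \<alpha>
  \<comment> \<open>The pair from \<open>K\<close> and a pair of bad nodes share a family, so that
    \<open>phi0\<close> compares the former at \<alpha> with the latter at \<beta>.\<close>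
  define XX where "XX i \<alpha> = {B 0 \<alpha>, B (Suc i) \<alpha>}" for i \<alpha>
  define AA where "AA i = (\<Union>\<alpha>. XX i \<alpha>)" for i
  have idx: "i div ?m < ?m" "i mod ?m < ?m" if "i < ?m * ?m" for i
    using that by (auto simp: less_mult_imp_div_less)
  define lo where "lo i \<alpha> = (if i = 0 then X \<alpha> else Y \<alpha> ((i-1) div ?m))" for i :: nat and \<alpha>
  define hi where "hi i \<alpha> = (if i = 0 then X' \<alpha> else Y' \<alpha> ((i-1) div ?m) ((i-1) mod ?m))" for i :: nat and \<alpha>
  have B_eq: "B i \<alpha> = {lo i \<alpha>, hi i \<alpha>}" for i \<alpha> by (simp add: B_def lo_def hi_def)
  have lohi: "flip_pair s0 (lo i \<alpha>) (hi i \<alpha>)" "ht (X \<alpha>) \<le> ht (lo i \<alpha>)" "ht (hi i \<alpha>) < \<Theta> \<alpha>"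
    "0 < i \<Longrightarrow> ht (X' \<alpha>) < ht (lo i \<alpha>)" if i: "i \<le> ?m * ?m" for i \<alpha>
  proof -
    have *: "i = 0 \<or> i - 1 < ?m * ?m" using i by linarith
    show "flip_pair s0 (lo i \<alpha>) (hi i \<alpha>)" using q4 q5 idx * by (auto simp: lo_def hi_def)
    have 0: "ht (X' \<alpha>) < \<Theta> \<alpha>" using q2[of \<alpha>] h2[of 0 \<alpha>] h3[of 0 0 \<alpha>] by simp
    show "ht (hi i \<alpha>) < \<Theta> \<alpha>" using 0 idx * h3 by (auto simp: hi_def)
    have 1: "ht (X' \<alpha>) < ht (Y \<alpha> j)" if "j < ?m" for j using q2[of \<alpha>] h2[OF that, of \<alpha>] by order
    have 2: "ht (X \<alpha>) \<le> ht (Y \<alpha> j)" if "j < ?m" for j using 1[OF that] h1[of \<alpha>] by order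
    show "ht (X \<alpha>) \<le> ht (lo i \<alpha>)" using 2 * idx by (auto simp: lo_def)
    show "0 < i \<Longrightarrow> ht (X' \<alpha>) < ht (lo i \<alpha>)" using 1 * idx by (auto simp: lo_def)
  qed
  have lohi_lt: "ht (lo i \<alpha>) < ht (hi i \<alpha>)" if "i \<le> ?m * ?m" for i \<alpha>
    using lohi(1)[OF that] by (simp add: flip_pair_def)
  have sep: "ht (hi i \<alpha>) < ht (lo i' \<beta>)" if "\<alpha> < \<beta>" "i \<le> ?m * ?m" "i' \<le> ?m * ?m" for i i' \<alpha> \<beta>
    using lohi(3)[OF that(2), of \<alpha>] q1[OF that(1)] lohi(2)[OF that(3), of \<beta>] by order
  have B_inj: "B i \<alpha> \<noteq> B i' \<beta>" if "\<alpha> < \<beta>" "i \<le> ?m * ?m" "i' \<le> ?m * ?m" for i i' \<alpha> \<beta>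
  proof -
    have "ht (lo i \<alpha>) < ht (lo i' \<beta>)" "ht (lo i \<alpha>) < ht (hi i' \<beta>)"
      using sep[OF that] lohi_lt[OF that(2), of \<alpha>] lohi_lt[OF that(3), of \<beta>] by order+
    then show ?thesis unfolding B_eq by (auto simp: doubleton_eq_iff)
  qed
  have C01: "AA i \<in> C0n S 1" if i: "i < ?m * ?m" for i
  proof (rule C0n_1I[OF s0(1)])
    have "inj (B 0)"
      by (rule linorder_injI) (use B_inj[of _ _ 0 0] in auto)
    then have "uncountable (range (B 0))" using uncountable_omega1 countable_image_inj_on by blast
    moreover have "range (B 0) \<subseteq> AA i" by (auto simp: AA_def XX_def)
    ultimately show "uncountable (AA i)" using countable_subset by blast
    show "\<exists>p q. a = {p, q} \<and> flip_pair s0 p q" if "a \<in> AA i" for a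
    proof -
      obtain \<alpha> i' where "a = B i' \<alpha>" "i' \<le> ?m * ?m" using \<open>a \<in> AA i\<close> i
        unfolding AA_def XX_def by (metis (no_types, lifting) UN_E insertE singletonD Suc_leI le0)
      then show ?thesis using lohi(1) B_eq by blast
    qed
    fix p q p' q'
    assume a: "{p, q} \<in> AA i" "{p', q'} \<in> AA i" "flip_pair s0 p q" "flip_pair s0 p' q'" "{p, q} \<noteq> {p', q'}"
    obtain \<alpha> i1 where 1: "{p, q} = B i1 \<alpha>" "i1 = 0 \<or> i1 = Suc i" using a by (auto simp: AA_def XX_def)
    obtain \<beta> i2 where 2: "{p', q'} = B i2 \<beta>" "i2 = 0 \<or> i2 = Suc i" using a by (auto simp: AA_def XX_def)
    have i12: "i1 \<le> ?m * ?m" "i2 \<le> ?m * ?m" using 1 2 i by auto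
    have e1: "p = lo i1 \<alpha>" "q = hi i1 \<alpha>"
      using 1(1) lohi(1)[OF i12(1), of \<alpha>] a(3) unfolding B_eq by (auto simp: flip_pair_def doubleton_eq_iff)
    have e2: "p' = lo i2 \<beta>" "q' = hi i2 \<beta>"
      using 2(1) lohi(1)[OF i12(2), of \<beta>] a(4) unfolding B_eq by (auto simp: flip_pair_def doubleton_eq_iff)
    show "ht q < ht p' \<or> ht q' < ht p"
    proof (cases \<alpha> \<beta> rule: linorder_cases[case_names less equal greater])
      case equal
      then have "i1 \<noteq> i2" using 1 2 a(5) by auto
      then consider "i1 = 0" "0 < i2" | "i2 = 0" "0 < i1" using 1 2 by auto
      then show ?thesis
        using lohi(4)[OF i12(2), of \<alpha>] lohi(4)[OF i12(1), of \<alpha>] equal e1 e2 by cases (auto simp: hi_def)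
    qed (use sep i12 e1 e2 in auto)
  qed
  have "AA i \<in> C0 S" if "i < ?m * ?m" for i
    using C01[OF that] by (auto simp: C0_def)
  have N1: "N_of S (AA i) = 1" if "i < ?m * ?m" for i
    using N_of_C0n[OF C01[OF that]] by simp
  have VV: "ht (V \<alpha>) < ht (V \<beta>)" if "\<alpha> < \<beta>" for \<alpha> \<beta>
    using h2[of 0 \<alpha>] h3[of 0 0 \<alpha>] q1[OF that] h1[of \<beta>] q2[of \<beta>] by (auto intro: less_trans less_le_trans)
  have "inj V" by (rule linorder_injI) (use VV in force)
  have disj: "disjoint_family (XX i)" if "i < ?m * ?m" for i
    unfolding disjoint_family_on_def
  proof (intro ballI impI)
    fix \<alpha> \<beta> :: omega1 assume "\<alpha> \<noteq> \<beta>"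
    then have "B i1 \<alpha> \<noteq> B i2 \<beta>" if "i1 \<le> ?m * ?m" "i2 \<le> ?m * ?m" for i1 i2
      using B_inj[of \<alpha> \<beta> i1 i2] B_inj[of \<beta> \<alpha> i2 i1] that by (metis linorder_neqE)
    moreover have "0 \<le> ?m * ?m" "Suc i \<le> ?m * ?m" using \<open>i < ?m * ?m\<close> by simp_all
    ultimately show "XX i \<alpha> \<inter> XX i \<beta> = {}"
      unfolding XX_def by blast
  qed
  have "\<exists>\<alpha> \<beta>. \<alpha> < \<beta> \<and> tree_less (V \<alpha>) (V \<beta>) \<and>
     (\<forall>i<?m * ?m. \<forall>a\<in>XX i \<alpha>. \<forall>b\<in>XX i \<beta>. \<exists>j. \<forall>k<N_of S (AA i). \<forall>k'<N_of S (AA i).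
        c {ho_nth a k, ho_nth b k'} = j \<and>
        c {ho_nth a (N_of S (AA i) + k), ho_nth b (N_of S (AA i) + k')} = (\<not> j))"
  proof (rule phi[unfolded phi0_def, rule_format])
    show "0 < ?m * ?m" by simp
    show "\<And>i. i < ?m * ?m \<Longrightarrow> AA i \<in> C0 S" by fact
    show "\<And>\<alpha>. V \<alpha> \<in> S" by (rule q3)
    show "inj V" by fact
    show "\<And>i \<alpha>. i < ?m * ?m \<Longrightarrow> finite (XX i \<alpha>) \<and> XX i \<alpha> \<subseteq> AA i" unfolding AA_def XX_def by blast
    show "\<And>i. i < ?m * ?m \<Longrightarrow> disjoint_family (XX i)" by (rule disj)
  qed
  then obtain \<alpha> \<beta> where ab: "\<alpha> < \<beta>" "tree_less (V \<alpha>) (V \<beta>)"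
    and col: "\<And>i a b. i < ?m * ?m \<Longrightarrow> a \<in> XX i \<alpha> \<Longrightarrow> b \<in> XX i \<beta> \<Longrightarrow> \<exists>j. \<forall>k<N_of S (AA i). \<forall>k'<N_of S (AA i).
        c {ho_nth a k, ho_nth b k'} = j \<and>
        c {ho_nth a (N_of S (AA i) + k), ho_nth b (N_of S (AA i) + k')} = (\<not> j)"
    by blast
  have col': "c {X' \<alpha>, Y' \<beta> j k} = (\<not> c {X \<alpha>, Y \<beta> j})" if jk: "j < ?m" "k < ?m" for j k
  proof -
    define i where "i = j * ?m + k"
    have "i < ?m * ?m"
    proof -
      have "i < j * ?m + ?m" using jk by (simp add: i_def)
      also have "\<dots> = Suc j * ?m" by simp
      also have "\<dots> \<le> ?m * ?m" using jk(1) by (intro mult_le_mono1) simp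
      finally show ?thesis .
    qed
    have dm: "i div ?m = j" "i mod ?m = k"
      unfolding i_def using jk(2) by (metis div_mult_self3 div_less add_0_right nat.distinct(1),
        metis mod_mult_self3 mod_less)
    have e: "ho_enum (B 0 \<alpha>) = [X \<alpha>, X' \<alpha>]" "ho_enum (B (Suc i) \<beta>) = [Y \<beta> j, Y' \<beta> j k]"
      using ho_enum_pair h1 h3 jk dm by (simp_all add: B_def)
    have "B 0 \<alpha> \<in> XX i \<alpha>" "B (Suc i) \<beta> \<in> XX i \<beta>" by (auto simp: XX_def)
    from col[OF \<open>i < ?m * ?m\<close> this] show ?thesis
      using e N1[OF \<open>i < ?m * ?m\<close>] by simp
  qed
  have VV': "V \<alpha> \<subseteq>\<^sub>m V \<beta>" "ht (V \<alpha>) < ht (V \<beta>)" using ab VV by (auto simp: tree_less_def)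
  obtain \<sigma> where \<sigma>: "(X \<alpha>, \<sigma>) \<in> K" "\<sigma> \<subseteq>\<^sub>m V \<alpha>" using q6 by blast
  obtain \<sigma>' where \<sigma>': "(X' \<alpha>, \<sigma>') \<in> K" "\<sigma>' \<subseteq>\<^sub>m fl (V \<alpha>)" using q7 by blast
  have hx: "ht (X \<alpha>) < ht (V \<beta>)" "ht (X' \<alpha>) < ht (V \<beta>)" using h1[of \<alpha>] q2[of \<alpha>] VV'(2) by order+
  have "\<sigma> \<subseteq>\<^sub>m V \<beta>" using \<sigma> VV' map_le_trans by blast
  from q8[OF \<sigma>(1) this hx(1)] obtain j where j: "j < ?m" "c {X \<alpha>, Y \<beta> j}" by blast
  have "fl (V \<alpha>) \<subseteq>\<^sub>m fl (V \<beta>)" using VV' by simp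
  then have "\<sigma>' \<subseteq>\<^sub>m fl (V \<beta>)" using \<sigma>' map_le_trans by blast
  from q9[OF j(1) \<sigma>'(1) this hx(2)] obtain k where "k < ?m" "c {X' \<alpha>, Y' \<beta> j k}" by blast
  then show False using col' j by blast
qed

text \<open>If \<open>s\<close> does not force the set named by \<open>A\<close> to be unbounded,
  some extension forces a bound on it, and beyond this bound only \<open>B\<close> can
  contribute.\<close>

lemma large_Un:
  assumes "large (A \<union> B) s"
  shows "large A s \<or> (\<exists>s'\<in>S. s \<subseteq>\<^sub>m s' \<and> large B s')"
proof (cases "large A s")
  case False
  then obtain s' \<alpha> where s': "s' \<in> S" "s \<subseteq>\<^sub>m s'"
    and *: "\<And>x \<sigma>. (x, \<sigma>) \<in> A \<Longrightarrow> s' \<subseteq>\<^sub>m \<sigma> \<Longrightarrow> \<not> \<alpha> \<le> ht x"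
    unfolding large_def by blast
  have "large B s'"
    unfolding large_def
  proof (intro ballI impI allI)
    fix t \<beta> assume t: "t \<in> S" "s' \<subseteq>\<^sub>m t"
    then have "s \<subseteq>\<^sub>m t" using s' map_le_trans by blast
    then obtain x \<sigma> where x: "(x, \<sigma>) \<in> A \<union> B" "t \<subseteq>\<^sub>m \<sigma>" "max \<alpha> \<beta> \<le> ht x"
      using assms t(1) unfolding large_def by meson
    then have "(x, \<sigma>) \<notin> A" using * t map_le_trans by (metis max.bounded_iff)
    then show "\<exists>x \<sigma>. (x, \<sigma>) \<in> B \<and> t \<subseteq>\<^sub>m \<sigma> \<and> \<beta> \<le> ht x" using x by auto
  qed
  then show ?thesis using s' by blast
qed simp

lemma large_UN:
  assumes "finite I" "large (\<Union>i\<in>I. K i) s" "s \<in> S"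
  shows "\<exists>i\<in>I. \<exists>s'\<in>S. s \<subseteq>\<^sub>m s' \<and> large (K i) s'"
  using assms
proof (induction I arbitrary: s)
  case empty
  then show ?case unfolding large_def using map_le_refl by auto
next
  case (insert i I)
  from large_Un[of "K i" "\<Union>i\<in>I. K i" s] insert.prems
  consider "large (K i) s" | s' where "s' \<in> S" "s \<subseteq>\<^sub>m s'" "large (\<Union>i\<in>I. K i) s'" by auto
  then show ?case
  proof cases
    case 1
    then show ?thesis using insert.prems map_le_refl by blast
  next
    case 2
    then show ?thesis using insert.IH[OF 2(3,1)] map_le_trans by blast
  qed
qed

text \<open>The form of avoidance needed for the nodes above a model: each \<open>y\<close> extends
  some flip of \<open>v\<close> instead of \<open>v\<close>, and only those \<open>y\<close> that
  extend \<open>x\<close> count, because conditions constrain the colours of comparable pairs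
  only.\<close>

definition avoids :: "(node set \<Rightarrow> bool) \<Rightarrow> (node \<times> node) set \<Rightarrow> node \<Rightarrow> nat \<Rightarrow> omega1 set set \<Rightarrow> bool" where
  "avoids c K v n Es \<longleftrightarrow> (\<forall>Y\<subseteq>S. finite Y \<longrightarrow> card Y \<le> n \<longrightarrow> (\<forall>y\<in>Y. \<exists>E\<in>Es. flip E v \<subseteq>\<^sub>m y) \<longrightarrow>
     (\<exists>x \<sigma>. (x, \<sigma>) \<in> K \<and> \<sigma> \<subseteq>\<^sub>m v \<and> ht x < ht v \<and> (\<forall>y\<in>Y. x \<subseteq>\<^sub>m y \<longrightarrow> \<not> c {x, y})))"

lemma avoids_mono:
  assumes "avoids c K v n Es" "v \<in> S" "w \<in> S" "v \<subseteq>\<^sub>m w"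
  shows "avoids c K w n Es"
  unfolding avoids_def
proof (intro allI impI)
  fix Y assume Y: "Y \<subseteq> S" "finite Y" "card Y \<le> n" "\<forall>y\<in>Y. \<exists>E\<in>Es. flip E w \<subseteq>\<^sub>m y"
  have "\<forall>y\<in>Y. \<exists>E\<in>Es. flip E v \<subseteq>\<^sub>m y"
    using Y(4) flip_mono[OF assms(4)] map_le_trans by blast
  then obtain x \<sigma> where "(x, \<sigma>) \<in> K" "\<sigma> \<subseteq>\<^sub>m v" "ht x < ht v" "\<forall>y\<in>Y. x \<subseteq>\<^sub>m y \<longrightarrow> \<not> c {x, y}"
    using assms(1) Y unfolding avoids_def by meson
  moreover have "ht v \<le> ht w" using sub_ht assms by blast
  ultimately show "\<exists>x \<sigma>. (x, \<sigma>) \<in> K \<and> \<sigma> \<subseteq>\<^sub>m w \<and> ht x < ht w \<and> (\<forall>y\<in>Y. x \<subseteq>\<^sub>m y \<longrightarrow> \<not> c {x, y})"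
    using assms(4) map_le_trans by (meson less_le_trans)
qed

text \<open>If no node above \<open>s0\<close> avoids, then each \<open>x\<close> from
  \<open>K\<close> must lie below one of the flips of a suitable \<sigma>, and by
  \<open>large_UN\<close> one \<open>E\<close> accounts for a large part of \<open>K\<close>.
  Flipping by \<open>E\<close> reduces the claim to \<open>phi0_avoid\<close>, because an
  \<open>x\<close> taller than all flipped coordinates can lie below only one of the flips.\<close>

lemma phi0_avoids:
  assumes phi: "phi0 S c" and K: "K \<subseteq> S \<times> S" and s0: "s0 \<in> S" "large K s0"
    and Es: "finite Es" "\<And>E. E \<in> Es \<Longrightarrow> finite E"
  shows "\<exists>v\<in>S. s0 \<subseteq>\<^sub>m v \<and> avoids c K v n Es"
proof (rule ccontr)
  assume neg: "\<not> ?thesis"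
  define K' where "K' E = {(x, \<sigma>). x \<in> S \<and> \<sigma> \<in> S \<and> s0 \<subseteq>\<^sub>m \<sigma> \<and> (\<exists>\<sigma>1. (x, \<sigma>1) \<in> K \<and> \<sigma>1 \<subseteq>\<^sub>m \<sigma>) \<and>
     ht x < ht \<sigma> \<and> x \<subseteq>\<^sub>m flip E \<sigma>}" for E
  have "large (\<Union>E\<in>Es. K' E) s0"
    unfolding large_def
  proof (intro ballI impI allI)
    fix s \<alpha> assume s: "s \<in> S" "s0 \<subseteq>\<^sub>m s"
    then obtain x \<sigma>1 where x: "(x, \<sigma>1) \<in> K" "s \<subseteq>\<^sub>m \<sigma>1" "\<alpha> \<le> ht x"
      using s0 unfolding large_def by blast
    have "\<sigma>1 \<in> S" "x \<in> S" using x K by auto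
    then obtain \<sigma> where \<sigma>: "\<sigma> \<in> S" "\<sigma>1 \<subseteq>\<^sub>m \<sigma>" "ht x < ht \<sigma>"
      using extension_above[of \<sigma>1 "{ht x}"] by auto
    then have s\<sigma>: "s \<subseteq>\<^sub>m \<sigma>" "s0 \<subseteq>\<^sub>m \<sigma>" using x s map_le_trans by blast+
    \<comment> \<open>A counterexample \<open>Y\<close> at \<sigma> must contain an extension of
      \<open>x\<close>; otherwise \<open>x\<close> would avoid the colour vacuously.\<close>
    then have "\<not> avoids c K \<sigma> n Es" using neg \<sigma> by blast
    then obtain Y where Y: "Y \<subseteq> S" "\<forall>y\<in>Y. \<exists>E\<in>Es. flip E \<sigma> \<subseteq>\<^sub>m y"
      and *: "\<And>x \<sigma>'. (x, \<sigma>') \<in> K \<Longrightarrow> \<sigma>' \<subseteq>\<^sub>m \<sigma> \<Longrightarrow> ht x < ht \<sigma> \<Longrightarrow> \<exists>y\<in>Y. x \<subseteq>\<^sub>m y"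
      unfolding avoids_def by meson
    from *[OF x(1) \<sigma>(2,3)] obtain y where y: "y \<in> Y" "x \<subseteq>\<^sub>m y" by blast
    then obtain E where E: "E \<in> Es" "flip E \<sigma> \<subseteq>\<^sub>m y" using Y by blast
    have "flip E \<sigma> \<in> S" using E Es flip_in \<sigma>(1) by blast
    then have "x \<subseteq>\<^sub>m flip E \<sigma>" using sub_chain[OF \<open>x \<in> S\<close> _ y(2) E(2)] \<sigma>(3) by auto
    then have "(x, \<sigma>) \<in> K' E" using \<open>x \<in> S\<close> \<sigma> s\<sigma> x by (auto simp: K'_def)
    then show "\<exists>x \<sigma>. (x, \<sigma>) \<in> (\<Union>E\<in>Es. K' E) \<and> s \<subseteq>\<^sub>m \<sigma> \<and> \<alpha> \<le> ht x"
      using E(1) s\<sigma>(1) x(3) by blast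
  qed
  from large_UN[OF Es(1) this s0(1)] obtain E s1 where E: "E \<in> Es"
    and s1: "s1 \<in> S" "s0 \<subseteq>\<^sub>m s1" "large (K' E) s1" by blast
  have "finite (\<Union>Es)" using Es by blast
  then obtain s2 where s2: "s2 \<in> S" "s1 \<subseteq>\<^sub>m s2" "\<And>\<xi>. \<xi> \<in> \<Union>Es \<Longrightarrow> \<xi> < ht s2"
    using extension_above[OF s1(1), of "\<Union>Es"] countable_finite by metis
  have lK': "large (K' E) s2" using large_mono s1 s2 by blast
  have finE: "finite E" using E Es by blast
  \<comment> \<open>After the flip, \<open>x\<close> lies below its own witness, as
    \<open>phi0_avoid\<close> demands; and \<open>x\<close> is taller than every coordinate in
    \<open>\<Union>Es\<close>.\<close>
  define K2 where "K2 = {(x, \<sigma>). (x, flip E \<sigma>) \<in> K' E \<and> ht s2 \<le> ht x}"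
  have K2S: "K2 \<subseteq> S \<times> S"
  proof
    fix p assume "p \<in> K2"
    then obtain x \<sigma> where p: "p = (x, \<sigma>)" "x \<in> S" "flip E \<sigma> \<in> S" by (auto simp: K2_def K'_def)
    then show "p \<in> S \<times> S" using flip_in[OF p(3) finE] by simp
  qed
  have K2le: "x \<subseteq>\<^sub>m \<sigma>" if "(x, \<sigma>) \<in> K2" for x \<sigma> using that by (auto simp: K2_def K'_def)
  have "large K2 (flip E s2)"
    unfolding large_def
  proof (intro ballI impI allI)
    fix s \<alpha> assume s: "s \<in> S" "flip E s2 \<subseteq>\<^sub>m s"
    have "flip E s \<in> S" "s2 \<subseteq>\<^sub>m flip E s" using flip_in[OF s(1) finE] flip_mono[OF s(2), of E] by auto
    then obtain x \<sigma> where x: "(x, \<sigma>) \<in> K' E" "flip E s \<subseteq>\<^sub>m \<sigma>" "max \<alpha> (ht s2) \<le> ht x"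
      using lK' unfolding large_def by meson
    have "(x, flip E \<sigma>) \<in> K2" "s \<subseteq>\<^sub>m flip E \<sigma>" using x flip_mono[OF x(2), of E] by (auto simp: K2_def)
    then show "\<exists>x \<sigma>. (x, \<sigma>) \<in> K2 \<and> s \<subseteq>\<^sub>m \<sigma> \<and> \<alpha> \<le> ht x" using x(3) by auto
  qed
  from phi0_avoid[OF phi K2S K2le flip_in[OF s2(1) finE] this, of n]
  obtain v where v: "v \<in> S" "flip E s2 \<subseteq>\<^sub>m v" and
    av: "\<And>Y. Y \<subseteq> {y \<in> S. v \<subseteq>\<^sub>m y} \<Longrightarrow> finite Y \<Longrightarrow> card Y \<le> n \<Longrightarrow>
       \<exists>x \<sigma>. (x, \<sigma>) \<in> K2 \<and> \<sigma> \<subseteq>\<^sub>m v \<and> ht x < ht v \<and> (\<forall>y\<in>Y. \<not> c {x, y})" by blast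
  have "s2 \<subseteq>\<^sub>m flip E v" using flip_mono[OF v(2), of E] by simp
  then have "s0 \<subseteq>\<^sub>m flip E v" using s1 s2 map_le_trans by blast
  moreover have "flip E v \<in> S" using flip_in[OF v(1) finE] .
  moreover have "avoids c K (flip E v) n Es"
    unfolding avoids_def
  proof (intro allI impI)
    fix Y assume Y: "Y \<subseteq> S" "finite Y" "card Y \<le> n" "\<forall>y\<in>Y. \<exists>E'\<in>Es. flip E' (flip E v) \<subseteq>\<^sub>m y"
    let ?Y = "{y \<in> Y. v \<subseteq>\<^sub>m y}"
    have "card ?Y \<le> n" using Y card_mono[of Y ?Y] by auto
    then obtain x \<sigma> where x: "(x, \<sigma>) \<in> K2" "\<sigma> \<subseteq>\<^sub>m v" "ht x < ht v" "\<forall>y\<in>?Y. \<not> c {x, y}"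
      using av[of ?Y] Y by auto
    obtain \<sigma>1 where \<sigma>1: "(x, \<sigma>1) \<in> K" "\<sigma>1 \<subseteq>\<^sub>m flip E \<sigma>" using x(1) by (auto simp: K2_def K'_def)
    have "\<sigma>1 \<subseteq>\<^sub>m flip E v" using \<sigma>1 flip_mono[OF x(2), of E] map_le_trans by blast
    have xv: "x \<in> S" "x \<subseteq>\<^sub>m v" "ht s2 \<le> ht x" using x K2le map_le_trans K2S by (blast, blast, auto simp: K2_def)
    have "\<not> c {x, y}" if y: "y \<in> Y" "x \<subseteq>\<^sub>m y" for y
    proof -
      obtain E' where E': "E' \<in> Es" "flip E' (flip E v) \<subseteq>\<^sub>m y" using Y y by blast
      \<comment> \<open>Both \<open>v\<close> and \<open>y\<close> extend \<open>x\<close>, so they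
        agree at all coordinates of \<open>E\<close> and \<open>E'\<close>; hence the two flips
        between them must cancel.\<close>
      have "E' = E"
      proof (rule ccontr)
        assume "E' \<noteq> E"
        then obtain \<xi> where \<xi>: "\<xi> \<in> E' \<longleftrightarrow> \<xi> \<notin> E" by blast
        then have "\<xi> \<in> \<Union>Es" using E E' by blast
        then have "\<xi> < ht x" using s2(3) xv(3) less_le_trans by blast
        then have d: "\<xi> \<in> dom x" "\<xi> \<in> dom v"
          using dom_node[OF xv(1)] dom_node[OF v(1)] x(3) by auto
        then have "\<xi> \<in> dom (flip E' (flip E v))" by simp
        then have "flip E' (flip E v) \<xi> = y \<xi>" using E'(2) unfolding map_le_def by blast
        moreover have "flip E' (flip E v) \<xi> = map_option Not (v \<xi>)" using \<xi> by (auto simp: flip_def)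
        moreover have "x \<xi> = v \<xi>" "x \<xi> = y \<xi>" using xv(2) y(2) d(1) unfolding map_le_def by blast+
        ultimately have "map_option Not (v \<xi>) = v \<xi>" by simp
        then show False using d(2) by (cases "v \<xi>") auto
      qed
      then have "v \<subseteq>\<^sub>m y" using E'(2) by simp
      then show ?thesis using x(4) y by blast
    qed
    then show "\<exists>x \<sigma>. (x, \<sigma>) \<in> K \<and> \<sigma> \<subseteq>\<^sub>m flip E v \<and> ht x < ht (flip E v) \<and> (\<forall>y\<in>Y. x \<subseteq>\<^sub>m y \<longrightarrow> \<not> c {x, y})"
      using \<sigma>1(1) \<open>\<sigma>1 \<subseteq>\<^sub>m flip E v\<close> x(3) by auto
  qed
  ultimately show False using neg by blast
qed

text \<open>By \<open>phi0_avoids\<close> the avoiding nodes are dense above \<open>s0\<close>, and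
  by \<open>avoids_mono\<close> they are upward closed; \<open>suslin_dense\<close> turns this into
  a bound on heights.\<close>

lemma avoids_threshold:
  assumes phi: "phi0 S c" and K: "K \<subseteq> S \<times> S" and s0: "s0 \<in> S" "large K s0"
    and Es: "finite Es" "\<And>E. E \<in> Es \<Longrightarrow> finite E"
  shows "\<exists>\<gamma>. \<forall>v\<in>S. s0 \<subseteq>\<^sub>m v \<longrightarrow> \<gamma> \<le> ht v \<longrightarrow> avoids c K v n Es"
proof -
  let ?B = "{v \<in> S. avoids c K v n Es}"
  obtain \<gamma> where \<gamma>: "\<And>v w. v \<in> S \<Longrightarrow> \<gamma> \<le> ht v \<Longrightarrow> w \<in> ?B \<Longrightarrow> v \<subseteq>\<^sub>m w \<Longrightarrow> v \<in> ?B"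
    using suslin_dense[of ?B] avoids_mono by blast
  have "avoids c K v n Es" if v: "v \<in> S" "s0 \<subseteq>\<^sub>m v" "\<gamma> \<le> ht v" for v
    using phi0_avoids[OF phi K v(1) large_mono[OF s0(2) v(2)] Es, of n] \<gamma>[OF v(1,3)] by blast
  then show ?thesis by blast
qed

text \<open>The nodes that force the set named by \<open>K\<close> to be bounded are upward closed,
  so from some level on a node with an extension among them is one of them. That level is countable,
  so the bounds forced by its nodes have a common upper bound, which then serves both as level and
  as bound.\<close>

lemma large_threshold:
  "\<exists>\<gamma>. \<forall>v\<in>S. \<gamma> \<le> ht v \<longrightarrow> large K v \<or> (\<forall>x \<sigma>. (x, \<sigma>) \<in> K \<longrightarrow> \<gamma> \<le> ht x \<longrightarrow> \<not> v \<subseteq>\<^sub>m \<sigma>)"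
proof -
  let ?P = "\<lambda>v \<alpha>. \<forall>x \<sigma>. (x, \<sigma>) \<in> K \<longrightarrow> \<alpha> \<le> ht x \<longrightarrow> \<not> v \<subseteq>\<^sub>m \<sigma>"
  let ?B = "{v \<in> S. \<exists>\<alpha>. ?P v \<alpha>}"
  have "w \<in> ?B" if "v \<in> ?B" "w \<in> S" "v \<subseteq>\<^sub>m w" for v w
    using that map_le_trans by blast
  then obtain \<gamma> where \<gamma>: "\<And>v w. v \<in> S \<Longrightarrow> \<gamma> \<le> ht v \<Longrightarrow> w \<in> ?B \<Longrightarrow> v \<subseteq>\<^sub>m w \<Longrightarrow> v \<in> ?B"
    using suslin_dense[of ?B] by blast
  define a where "a v = (SOME \<alpha>. ?P v \<alpha>)" for v
  have a: "?P v (a v)" if "v \<in> ?B" for v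
    unfolding a_def by (rule someI_ex) (use that in blast)
  obtain \<delta> where \<delta>: "\<forall>\<alpha>\<in>insert \<gamma> (a ` {v \<in> S. ht v = \<gamma>}). \<alpha> < \<delta>"
    using omega1_bounded[of "insert \<gamma> (a ` {v \<in> S. ht v = \<gamma>})"] countable_level by auto
  have "large K v \<or> ?P v \<delta>" if v: "v \<in> S" "\<delta> \<le> ht v" for v
  proof -
    let ?v = "v |` {..<\<gamma>}"
    have "\<gamma> < \<delta>" using \<delta> by simp
    then have "\<gamma> \<le> ht v" using v(2) by order
    then have v': "?v \<in> S" "ht ?v = \<gamma>" "?v \<subseteq>\<^sub>m v" using cut_in ht_cut cut_le v by blast+
    show ?thesis
    proof (cases "?v \<in> ?B")
      case True
      have "a ?v < \<delta>" using \<delta> v' by blast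
      then have "?P ?v \<delta>" using a[OF True] by (meson less_imp_le order_trans)
      then show ?thesis using v'(3) map_le_trans by blast
    next
      case False
      have "large K ?v"
        unfolding large_def
      proof (intro ballI impI allI)
        fix s \<alpha> assume s: "s \<in> S" "?v \<subseteq>\<^sub>m s"
        have "s \<notin> ?B"
        proof
          assume "s \<in> ?B"
          moreover have "\<gamma> \<le> ht ?v" using v'(2) by simp
          ultimately have "?v \<in> ?B" using \<gamma>[OF v'(1) _ _ s(2)] by blast
          with False show False by contradiction
        qed
        then show "\<exists>x \<sigma>. (x, \<sigma>) \<in> K \<and> s \<subseteq>\<^sub>m \<sigma> \<and> \<alpha> \<le> ht x" using s(1) by blast
      qed
      then show ?thesis using large_mono v'(3) by blast
    qed
  qed
  then show ?thesis by blast
qed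

end

section \<open>The poset\<close>

definition pairing :: "nat \<times> omega1 \<Rightarrow> omega1" where
  "pairing = (SOME f. inj f)"

lemma inj_pairing: "inj pairing"
proof -
  have inf: "infinite (UNIV :: omega1 set)" using uncountable_omega1 countable_finite by blast
  have "|UNIV :: nat set| \<le>o |UNIV :: omega1 set|"
    using inf infinite_iff_card_of_nat by blast
  then have "|(UNIV :: nat set) \<times> (UNIV :: omega1 set)| \<le>o |UNIV :: omega1 set|"
    using card_of_Times_infinite[OF inf, of "UNIV :: nat set"] card_of_Times_commute ordIso_imp_ordLeq ordIso_ordLeq_trans
    by (metis UNIV_not_empty)
  then have "\<exists>f :: nat \<times> omega1 \<Rightarrow> omega1. inj f"
    unfolding UNIV_Times_UNIV card_of_ordLeq[symmetric] by auto
  then show ?thesis unfolding pairing_def by (rule someI_ex)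
qed

text \<open>
  A function \<^term>\<open>f :: omega1 \<Rightarrow> omega1\<close> codes the pair of an ordinal \<open>side_ord f\<close> and a nonempty
  countable set \<open>side_fun f\<close> of functions, so that a side condition can be an element of another one.
\<close>

definition omega1_zero :: omega1 where
  "omega1_zero = (LEAST \<alpha>. True)"

definition side_ord :: "(omega1 \<Rightarrow> omega1) \<Rightarrow> omega1" where
  "side_ord f = f (pairing (0, omega1_zero))"

definition side_fun :: "(omega1 \<Rightarrow> omega1) \<Rightarrow> (omega1 \<Rightarrow> omega1) set" where
  "side_fun f = range (\<lambda>n \<xi>. f (pairing (Suc n, \<xi>)))"

lemma countable_side_fun: "countable (side_fun f)"
  by (simp add: side_fun_def)

lemma side_code:
  assumes "countable \<Phi>" "\<Phi> \<noteq> {}"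
  obtains f where "side_ord f = \<delta>" "side_fun f = \<Phi>"
proof
  let ?f = "\<lambda>z. case inv pairing z of (n, \<xi>) \<Rightarrow> if n = 0 then \<delta> else from_nat_into \<Phi> (n - 1) \<xi>"
  show "side_ord ?f = \<delta>" by (simp add: side_ord_def inj_pairing)
  show "side_fun ?f = \<Phi>" using assms by (simp add: side_fun_def inj_pairing range_from_nat_into)
qed

text \<open>The relation between two members of an increasing chain of countable models: the first
  is an element of the second and is contained in it.\<close>

definition side_less :: "(omega1 \<Rightarrow> omega1) \<Rightarrow> (omega1 \<Rightarrow> omega1) \<Rightarrow> bool" where
  "side_less f g \<longleftrightarrow> side_ord f < side_ord g \<and> f \<in> side_fun g \<and> side_fun f \<subseteq> side_fun g"

lemma side_less_trans: "side_less f g \<Longrightarrow> side_less g h \<Longrightarrow> side_less f h"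
  unfolding side_less_def by (auto intro: less_trans)

type_synonym cond = "node set \<times> (omega1 \<Rightarrow> omega1) set"

definition stronger :: "cond \<Rightarrow> cond \<Rightarrow> bool" where
  "stronger p q \<longleftrightarrow> fst q \<subseteq> fst p \<and> snd q \<subseteq> snd p"

lemma stronger_refl [simp]: "stronger p p"
  by (simp add: stronger_def)

lemma stronger_trans: "stronger p q \<Longrightarrow> stronger q r \<Longrightarrow> stronger p r"
  by (auto simp: stronger_def)

section \<open>Conditions, candidate sets and thresholds\<close>

locale coloured_tree = cc_suslin +
  fixes c :: "node set \<Rightarrow> bool"
  assumes phi: "phi0 S c"
begin

text \<open>Distinct heights allow the nodes of \<open>F\<close> to be listed by height. The last
  clause is separation by models: above the ordinal of a side condition, none of its functions leads
  from the height of a node up to that of a taller one. This gap allows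
  \<open>avoid_condition\<close> to infer largeness from a single node.\<close>

definition conds :: "cond set" where
  "conds = {(F, N). F \<subseteq> S \<and> finite F \<and> finite N \<and> inj_on ht F \<and>
     (\<forall>x\<in>F. \<forall>y\<in>F. tree_less x y \<longrightarrow> \<not> c {x, y}) \<and>
     (\<forall>f\<in>N. \<forall>g\<in>N. f = g \<or> side_less f g \<or> side_less g f) \<and>
     (\<forall>f\<in>N. \<forall>g\<in>side_fun f. \<forall>\<xi><side_ord f. g \<xi> < side_ord f) \<and>
     (\<forall>f\<in>N. \<forall>g\<in>side_fun f. \<forall>x\<in>F. \<forall>y\<in>F. side_ord f \<le> ht x \<longrightarrow> ht x < ht y \<longrightarrow> g (ht x) < ht y)}"

text \<open>
  \<open>cand D F0 N0 k xs\<close> is the set of nodes \<open>s\<close> which, as conditions of the forcing \<open>S\<close>, force that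
  \<open>k\<close> times in a row one can append a node to \<open>xs\<close>, each time from an uncountable set, so as to
  obtain the new part of a condition that lies in \<open>D\<close> together with the generic branch.
\<close>

primrec cand :: "(cond \<times> node) set \<Rightarrow> node set \<Rightarrow> (omega1 \<Rightarrow> omega1) set \<Rightarrow> nat \<Rightarrow> node list \<Rightarrow> node set" where
  "cand D F0 N0 0 xs = {s \<in> S. \<exists>r\<in>conds. (r, s) \<in> D \<and> fst r = F0 \<union> set xs \<and> N0 \<subseteq> snd r}"
| "cand D F0 N0 (Suc k) xs = {s \<in> S. large {(x, \<sigma>). x \<in> S \<and> \<sigma> \<in> cand D F0 N0 k (xs @ [x])} s}"

definition one_step :: "(cond \<times> node) set \<Rightarrow> node set \<Rightarrow> (omega1 \<Rightarrow> omega1) set \<Rightarrow> nat \<Rightarrow> node list \<Rightarrow> (node \<times> node) set" where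
  "one_step D F0 N0 k xs = {(x, \<sigma>). x \<in> S \<and> \<sigma> \<in> cand D F0 N0 k (xs @ [x])}"

lemma cand_Suc: "cand D F0 N0 (Suc k) xs = {s \<in> S. large (one_step D F0 N0 k xs) s}"
  by (simp add: one_step_def)

lemma cand_subset: "cand D F0 N0 k xs \<subseteq> S"
  by (cases k) auto

lemma one_step_subset: "one_step D F0 N0 k xs \<subseteq> S \<times> S"
  unfolding one_step_def using cand_subset by blast

definition upward :: "(cond \<times> node) set \<Rightarrow> bool" where
  "upward D \<longleftrightarrow> (\<forall>r s t. (r, s) \<in> D \<longrightarrow> t \<in> S \<longrightarrow> s \<subseteq>\<^sub>m t \<longrightarrow> (r, t) \<in> D)"

lemma cand_upward:
  assumes "upward D" "s \<in> cand D F0 N0 k xs" "t \<in> S" "s \<subseteq>\<^sub>m t"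
  shows "t \<in> cand D F0 N0 k xs"
proof (cases k)
  case 0
  then obtain r where "s \<in> S" "r \<in> conds" "(r, s) \<in> D" "fst r = F0 \<union> set xs" "N0 \<subseteq> snd r"
    using assms(2) by auto
  then have "t \<in> S \<and> (\<exists>r\<in>conds. (r, t) \<in> D \<and> fst r = F0 \<union> set xs \<and> N0 \<subseteq> snd r)"
    using assms unfolding upward_def by blast
  then show ?thesis using 0 by simp
next
  case (Suc k)
  then show ?thesis using assms large_mono by (auto simp del: cand.simps simp: cand_Suc)
qed

definition nodes_upto :: "omega1 \<Rightarrow> node set" where
  "nodes_upto \<alpha> = {x \<in> S. ht x \<le> \<alpha>}"

text \<open>The bounds from \<open>large_threshold\<close>, \<open>avoids_threshold\<close> and
  \<open>suslin_dense\<close>, uniformly for all parameters below \<alpha>. Such a function exists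
  because these parameters are countably many: lists of nodes of bounded height and finite sets of
  finite sets of bounded ordinals.\<close>

definition is_threshold :: "(cond \<times> node) set \<Rightarrow> node set \<Rightarrow> (omega1 \<Rightarrow> omega1) set \<Rightarrow> nat \<Rightarrow> (omega1 \<Rightarrow> omega1) \<Rightarrow> bool" where
  "is_threshold D F0 N0 n f \<longleftrightarrow>
    (\<forall>\<alpha>. \<alpha> < f \<alpha>) \<and>
    (\<forall>\<alpha> k xs v x \<sigma>. set xs \<subseteq> nodes_upto \<alpha> \<longrightarrow> v \<in> S \<longrightarrow> f \<alpha> \<le> ht v \<longrightarrow>
       (x, \<sigma>) \<in> one_step D F0 N0 k xs \<longrightarrow> f \<alpha> \<le> ht x \<longrightarrow> v \<subseteq>\<^sub>m \<sigma> \<longrightarrow> large (one_step D F0 N0 k xs) v) \<and>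
    (\<forall>\<alpha> k xs s Es v. set xs \<subseteq> nodes_upto \<alpha> \<longrightarrow> s \<in> nodes_upto \<alpha> \<longrightarrow> Es \<in> Fpow (Fpow {..\<alpha>}) \<longrightarrow>
       large (one_step D F0 N0 k xs) s \<longrightarrow> v \<in> S \<longrightarrow> s \<subseteq>\<^sub>m v \<longrightarrow> f \<alpha> \<le> ht v \<longrightarrow>
       avoids c (one_step D F0 N0 k xs) v n Es) \<and>
    (\<forall>\<alpha> v w. v \<in> S \<longrightarrow> f \<alpha> \<le> ht v \<longrightarrow> w \<in> cand D F0 N0 n [] \<longrightarrow> v \<subseteq>\<^sub>m w \<longrightarrow> v \<in> cand D F0 N0 n [])"

lemma threshold: "\<exists>f. is_threshold D F0 N0 n f" if assms: "upward D"
proof -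
  let ?K = "one_step D F0 N0"
  have "\<exists>a. \<forall>v\<in>S. a \<le> ht v \<longrightarrow> large (?K k xs) v \<or> (\<forall>x \<sigma>. (x, \<sigma>) \<in> ?K k xs \<longrightarrow> a \<le> ht x \<longrightarrow> \<not> v \<subseteq>\<^sub>m \<sigma>)" for k xs
    by (rule large_threshold)
  then obtain a where a: "\<And>k xs v x \<sigma>. v \<in> S \<Longrightarrow> a k xs \<le> ht v \<Longrightarrow> (x, \<sigma>) \<in> ?K k xs \<Longrightarrow>
      a k xs \<le> ht x \<Longrightarrow> v \<subseteq>\<^sub>m \<sigma> \<Longrightarrow> large (?K k xs) v" by metis
  have "\<exists>b. s \<in> S \<longrightarrow> large (?K k xs) s \<longrightarrow> finite Es \<longrightarrow> (\<forall>E\<in>Es. finite E) \<longrightarrow>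
     (\<forall>v\<in>S. s \<subseteq>\<^sub>m v \<longrightarrow> b \<le> ht v \<longrightarrow> avoids c (?K k xs) v n Es)" for k xs s Es
    using avoids_threshold[OF phi one_step_subset] by blast
  note ex_b = this
  define b where "b k xs s Es = (SOME b. s \<in> S \<longrightarrow> large (?K k xs) s \<longrightarrow> finite Es \<longrightarrow> (\<forall>E\<in>Es. finite E) \<longrightarrow>
     (\<forall>v\<in>S. s \<subseteq>\<^sub>m v \<longrightarrow> b \<le> ht v \<longrightarrow> avoids c (?K k xs) v n Es))" for k xs s Es
  have b: "avoids c (?K k xs) v n Es" if "s \<in> S" "large (?K k xs) s" "finite Es" "\<And>E. E \<in> Es \<Longrightarrow> finite E"
     "v \<in> S" "s \<subseteq>\<^sub>m v" "b k xs s Es \<le> ht v" for k xs s Es v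
  proof -
    note * = someI_ex[OF ex_b[of s k xs Es], folded b_def, rule_format]
    show ?thesis by (rule *) (fact that)+
  qed
  obtain d where d: "\<And>v w. v \<in> S \<Longrightarrow> d \<le> ht v \<Longrightarrow> w \<in> cand D F0 N0 n [] \<Longrightarrow> v \<subseteq>\<^sub>m w \<Longrightarrow> v \<in> cand D F0 N0 n []"
  proof -
    note d_that = that
    show ?thesis
    proof (rule suslin_dense[of "cand D F0 N0 n []"])
      show "w \<in> cand D F0 N0 n []" if "v \<in> cand D F0 N0 n []" "w \<in> S" "v \<subseteq>\<^sub>m w" for v w
        using cand_upward[OF assms that] .
      show "cand D F0 N0 n [] \<subseteq> S" by (rule cand_subset)
      show thesis if "\<And>v w. v \<in> S \<Longrightarrow> \<gamma> \<le> ht v \<Longrightarrow> w \<in> cand D F0 N0 n [] \<Longrightarrow> v \<subseteq>\<^sub>m w \<Longrightarrow> v \<in> cand D F0 N0 n []" for \<gamma>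
        by (rule d_that) (rule that)
    qed
  qed
  define C where "C \<alpha> = {\<alpha>, d} \<union> (\<lambda>(k, xs). a k xs) ` (UNIV \<times> lists (nodes_upto \<alpha>)) \<union>
    (\<lambda>(k, xs, s, Es). b k xs s Es) ` (UNIV \<times> lists (nodes_upto \<alpha>) \<times> nodes_upto \<alpha> \<times> Fpow (Fpow {..\<alpha>}))" for \<alpha>
  have nodes: "countable (nodes_upto \<alpha>)" for \<alpha> unfolding nodes_upto_def by (rule countable_below)
  have "countable (Fpow (Fpow {..\<alpha>}))" for \<alpha> :: omega1
    by (intro countable_Fpow countable_atMost_omega1)
  then have "countable (C \<alpha>)" for \<alpha>
    unfolding C_def using nodes by (intro countable_Un countable_image countable_SIGMA countable_lists) auto
  then have "\<exists>\<beta>. \<forall>\<gamma>\<in>C \<alpha>. \<gamma> < \<beta>" for \<alpha> using omega1_bounded by blast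
  then obtain f where f: "\<And>\<alpha> \<gamma>. \<gamma> \<in> C \<alpha> \<Longrightarrow> \<gamma> < f \<alpha>" by metis
  have "is_threshold D F0 N0 n f"
    unfolding is_threshold_def
  proof (intro conjI allI impI)
    show "\<alpha> < f \<alpha>" for \<alpha> by (rule f) (simp add: C_def)
    show "large (?K k xs) v" if "set xs \<subseteq> nodes_upto \<alpha>" "v \<in> S" "f \<alpha> \<le> ht v" "(x, \<sigma>) \<in> ?K k xs" "f \<alpha> \<le> ht x" "v \<subseteq>\<^sub>m \<sigma>"
      for \<alpha> k xs v x \<sigma>
    proof -
      have "a k xs \<in> C \<alpha>" using that(1) unfolding C_def by force
      from f[OF this] have "a k xs \<le> ht v" "a k xs \<le> ht x" using that(3,5) by order+
      then show ?thesis using a that by blast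
    qed
    show "avoids c (?K k xs) v n Es"
      if "set xs \<subseteq> nodes_upto \<alpha>" "s \<in> nodes_upto \<alpha>" "Es \<in> Fpow (Fpow {..\<alpha>})" "large (?K k xs) s" "v \<in> S" "s \<subseteq>\<^sub>m v"
        "f \<alpha> \<le> ht v" for \<alpha> k xs s Es v
    proof -
      have "b k xs s Es \<in> C \<alpha>" using that(1-3) unfolding C_def by force
      from f[OF this] have "b k xs s Es \<le> ht v" using that(7) by order
      then show ?thesis using b[of s k xs Es v] that by (auto simp: Fpow_def nodes_upto_def)
    qed
    show "v \<in> cand D F0 N0 n []" if "v \<in> S" "f \<alpha> \<le> ht v" "w \<in> cand D F0 N0 n []" "v \<subseteq>\<^sub>m w" for \<alpha> v w
    proof -
      have "d < f \<alpha>" by (rule f) (simp add: C_def)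
      then have "d \<le> ht v" using that(2) by order
      then show ?thesis using d that by blast
    qed
  qed
  then show ?thesis by - (rule exI)
qed

text \<open>A choice depending only on data inside a model; \<open>hull_step\<close> includes it, so
  that the model contains the function.\<close>

definition bound :: "(cond \<times> node) set \<Rightarrow> node set \<Rightarrow> (omega1 \<Rightarrow> omega1) set \<Rightarrow> nat \<Rightarrow> omega1 \<Rightarrow> omega1" where
  "bound D F0 N0 n = (SOME f. is_threshold D F0 N0 n f)"

lemma is_threshold_bound: "upward D \<Longrightarrow> is_threshold D F0 N0 n (bound D F0 N0 n)"
  unfolding bound_def by (rule someI_ex[OF threshold])

lemma conds_iff:
  "(F, N) \<in> conds \<longleftrightarrow> F \<subseteq> S \<and> finite F \<and> finite N \<and> inj_on ht F \<and>
     (\<forall>x\<in>F. \<forall>y\<in>F. tree_less x y \<longrightarrow> \<not> c {x, y}) \<and>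
     (\<forall>f\<in>N. \<forall>g\<in>N. f = g \<or> side_less f g \<or> side_less g f) \<and>
     (\<forall>f\<in>N. \<forall>g\<in>side_fun f. \<forall>\<xi><side_ord f. g \<xi> < side_ord f) \<and>
     (\<forall>f\<in>N. \<forall>g\<in>side_fun f. \<forall>x\<in>F. \<forall>y\<in>F. side_ord f \<le> ht x \<longrightarrow> ht x < ht y \<longrightarrow> g (ht x) < ht y)"
  by (simp add: conds_def)

lemma enumerate_by_height:
  assumes "finite F" "inj_on ht F"
  obtains ys where "set ys = F" "length ys = card F" "sorted_wrt (\<lambda>x y. ht x < ht y) ys"
proof
  let ?g = "inv_into F ht"
  let ?zs = "sorted_list_of_set (ht ` F)"
  have zs: "set ?zs = ht ` F" using assms by simp
  show "set (map ?g ?zs) = F" using zs inv_into_image_cancel[OF assms(2), of F] by simp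
  show "length (map ?g ?zs) = card F" using assms by (simp add: card_image)
  have *: "ht (?g z) = z" if "z \<in> set ?zs" for z using that zs f_inv_into_f by metis
  have "sorted_wrt (<) ?zs" by (rule strict_sorted_list_of_set)
  then show "sorted_wrt (\<lambda>x y. ht x < ht y) (map ?g ?zs)"
    unfolding sorted_wrt_map by (rule sorted_wrt_mono_rel[rotated]) (simp add: *)
qed

text \<open>Two inductions in opposite directions. Removing the nodes of \<open>F1\<close> from the
  tallest down shows that \<open>t\<close> forces each of them to be replaceable from an unbounded
  set, since one actual node beyond the threshold is evidence for largeness. Choosing the
  replacements in the original order then finds them below \<open>side_ord h\<close>, each by
  \<open>avoids\<close> against all of \<open>F1\<close> at once.\<close>

lemma avoid_condition:
  assumes r: "(F, N) \<in> conds" and h: "h \<in> N" and pos: "omega1_zero < side_ord h"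
    and D: "upward D" "((F, N), t) \<in> D"
    and t: "t \<in> S" "side_ord h \<le> ht t" "\<And>y. y \<in> F \<Longrightarrow> ht y \<le> ht t"
    and F0: "F0 = {x \<in> F. ht x < side_ord h}" and F1: "F1 = {x \<in> F. side_ord h \<le> ht x}" and N0: "N0 \<subseteq> N"
    and bd: "bound D F0 N0 (card F1) \<in> side_fun h"
  obtains xs s where "set xs \<subseteq> S" "\<And>x. x \<in> set xs \<Longrightarrow> ht x < side_ord h"
    "s \<in> cand D F0 N0 0 xs" "s \<subseteq>\<^sub>m t" "ht s < side_ord h"
    "\<And>x y. x \<in> set xs \<Longrightarrow> y \<in> F1 \<Longrightarrow> x \<subseteq>\<^sub>m y \<Longrightarrow> \<not> c {x, y}"
proof -
  let ?n = "card F1"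
  let ?\<delta> = "side_ord h"
  define f where "f = bound D F0 N0 ?n"
  have thr: "is_threshold D F0 N0 ?n f" unfolding f_def using is_threshold_bound[OF D(1)] .
  have f_gt: "\<alpha> < f \<alpha>" for \<alpha> using thr unfolding is_threshold_def by blast
  have f_large: "large (one_step D F0 N0 k xs) v" if "set xs \<subseteq> nodes_upto \<alpha>" "v \<in> S" "f \<alpha> \<le> ht v"
       "(x, \<sigma>) \<in> one_step D F0 N0 k xs" "f \<alpha> \<le> ht x" "v \<subseteq>\<^sub>m \<sigma>" for \<alpha> k xs v x \<sigma>
    using thr that unfolding is_threshold_def by meson
  have f_avoids: "avoids c (one_step D F0 N0 k xs) v ?n Es" if "set xs \<subseteq> nodes_upto \<alpha>" "s \<in> nodes_upto \<alpha>" "Es \<in> Fpow (Fpow {..\<alpha>})"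
       "large (one_step D F0 N0 k xs) s" "v \<in> S" "s \<subseteq>\<^sub>m v" "f \<alpha> \<le> ht v" for \<alpha> k xs s Es v
    using thr that unfolding is_threshold_def by meson
  have f_dense: "v \<in> cand D F0 N0 ?n []" if "v \<in> S" "f \<alpha> \<le> ht v" "w \<in> cand D F0 N0 ?n []" "v \<subseteq>\<^sub>m w" for \<alpha> v w
    using thr that unfolding is_threshold_def by meson
  have r': "F \<subseteq> S" "finite F" "inj_on ht F"
    and r_closed: "\<forall>f\<in>N. \<forall>g\<in>side_fun f. \<forall>\<xi><side_ord f. g \<xi> < side_ord f"
    and r_sep: "\<forall>f\<in>N. \<forall>g\<in>side_fun f. \<forall>x\<in>F. \<forall>y\<in>F. side_ord f \<le> ht x \<longrightarrow> ht x < ht y \<longrightarrow> g (ht x) < ht y"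
    using r unfolding conds_iff by simp_all
  have closed: "f \<xi> < ?\<delta>" if "\<xi> < ?\<delta>" for \<xi>
    using r_closed h bd that unfolding f_def by simp
  have separated: "f (ht x) < ht y" if "x \<in> F1" "y \<in> F1" "ht x < ht y" for x y
    using r_sep h bd that unfolding f_def F1 by simp
  have F1': "F1 \<subseteq> S" "finite F1" "inj_on ht F1" using r' F1 by (auto intro: inj_on_subset)
  obtain ys where ys: "set ys = F1" "length ys = ?n" "sorted_wrt (\<lambda>x y. ht x < ht y) ys"
    using enumerate_by_height[OF F1'(2,3)] .
  have cand_t: "t \<in> cand D F0 N0 k (take (?n - k) ys)" if "k \<le> ?n" for k
    using that
  proof (induction k)
    case 0
    have "F = F0 \<union> F1" unfolding F0 F1 by auto
    then have "F = F0 \<union> set ys" unfolding ys(1) .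
    then have "fst (F, N) = F0 \<union> set (take (?n - 0) ys) \<and> N0 \<subseteq> snd (F, N)" using N0 ys(2) by simp
    then show ?case unfolding cand.simps
      by (intro CollectI conjI bexI[of _ "(F, N)"] t(1) r D(2)) simp_all
  next
    case (Suc k)
    define i where "i = ?n - Suc k"
    have i: "i < ?n" "?n - k = Suc i" using Suc.prems by (auto simp: i_def)
    let ?x = "ys ! i"
    have x: "?x \<in> F1" using i ys by (metis nth_mem)
    have "take (Suc i) ys = take i ys @ [?x]" using i ys(2) by (simp add: take_Suc_conv_app_nth)
    then have "t \<in> cand D F0 N0 k (take i ys @ [?x])" using Suc i by simp
    then have step: "(?x, t) \<in> one_step D F0 N0 k (take i ys)" using x F1' by (auto simp: one_step_def)
    \<comment> \<open>The earlier nodes are bounded by the height of the last of them, whose image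
      under \<open>f\<close> is below the next node by separation. For the first node the closure of
      \<open>side_ord h\<close> under \<open>f\<close> takes over.\<close>
    obtain \<alpha> where \<alpha>: "set (take i ys) \<subseteq> nodes_upto \<alpha>" "f \<alpha> < ht ?x"
    proof (cases i)
      case 0
      then have "set (take i ys) \<subseteq> nodes_upto omega1_zero" by simp
      moreover have "f omega1_zero < ht ?x" using closed[OF pos] x F1 by auto
      ultimately show ?thesis using that by blast
    next
      case (Suc j)
      have "ht (ys ! j) < ht ?x" using ys(2,3) i Suc by (auto simp: sorted_wrt_iff_nth_less)
      moreover have "ys ! j \<in> F1" using ys i Suc by (metis Suc_lessD nth_mem)
      ultimately have "f (ht (ys ! j)) < ht ?x" using separated x by blast
      moreover have "set (take i ys) \<subseteq> nodes_upto (ht (ys ! j))"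
      proof
        fix z assume "z \<in> set (take i ys)"
        then obtain l where l: "l < i" "z = ys ! l" using i ys(2) by (auto simp: in_set_conv_nth)
        then have "l < j \<or> l = j" using Suc by auto
        then have "ht z \<le> ht (ys ! j)" using ys(2,3) i Suc l by (auto simp: sorted_wrt_iff_nth_less less_imp_le)
        moreover have "z \<in> S" using l i ys F1' by (metis nth_mem order.strict_trans subsetD)
        ultimately show "z \<in> nodes_upto (ht (ys ! j))" by (simp add: nodes_upto_def)
      qed
      ultimately show ?thesis using that by blast
    qed
    have "ht ?x \<le> ht t" using x F1 t(3) by auto
    then have "f \<alpha> \<le> ht t" using \<alpha>(2) by order
    then have "large (one_step D F0 N0 k (take i ys)) t"
      using f_large[OF \<alpha>(1) t(1) _ step _ map_le_refl] \<alpha>(2) by auto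
    then show ?case using t(1) unfolding cand_Suc i_def by simp
  qed
  have "?\<delta> \<le> ht t" by fact
  let ?Q = "\<lambda>k xs s. set xs \<subseteq> S \<and> (\<forall>x\<in>set xs. ht x < ?\<delta>) \<and> s \<in> cand D F0 N0 k xs \<and> s \<subseteq>\<^sub>m t \<and> ht s < ?\<delta> \<and>
    (\<forall>x\<in>set xs. \<forall>y\<in>F1. x \<subseteq>\<^sub>m y \<longrightarrow> \<not> c {x, y})"
  have "\<exists>xs s. ?Q (?n - i) xs s" if "i \<le> ?n" for i
    using that
  proof (induction i)
    case 0
    let ?\<gamma> = "f omega1_zero"
    have \<gamma>: "?\<gamma> < ?\<delta>" using closed pos by blast
    then have \<gamma>t: "?\<gamma> \<le> ht t" using t(2) by order
    \<comment> \<open>\<open>t\<close> itself is outside the model; \<open>f_dense\<close> keeps its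
      restriction to a height below \<open>side_ord h\<close> among the candidates.\<close>
    let ?s = "t |` {..<?\<gamma>}"
    have "?s \<in> cand D F0 N0 ?n []"
      using f_dense[of ?s omega1_zero t] cut_in[OF t(1) \<gamma>t] ht_cut[OF t(1) \<gamma>t] cut_le[of t "{..<?\<gamma>}"] cand_t[of ?n] by simp
    then have "?Q (?n - 0) [] ?s" using ht_cut[OF t(1) \<gamma>t] \<gamma> cut_le[of t "{..<?\<gamma>}"] by simp
    then show ?case by blast
  next
    case (Suc i)
    then obtain xs s where Q: "?Q (?n - i) xs s" by auto
    define k where "k = ?n - Suc i"
    have k: "?n - i = Suc k" using Suc.prems by (simp add: k_def)
    let ?K = "one_step D F0 N0 k xs"
    have s: "s \<in> S" "large ?K s" using Q unfolding k cand_Suc by simp_all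
    let ?u = "t |` {..<?\<delta>}"
    have u: "?u \<in> S" "ht ?u = ?\<delta>" using cut_in[OF t(1,2)] ht_cut[OF t(1,2)] by blast+
    \<comment> \<open>Here coherence enters: up to \<open>?\<delta>\<close>, each \<open>y\<close>
      in \<open>F1\<close> is a finite flip of \<open>t\<close>.\<close>
    have "\<exists>E. finite E \<and> E \<subseteq> {..<?\<delta>} \<and> flip E ?u \<subseteq>\<^sub>m y" if "y \<in> F1" for y
    proof -
      have y: "y \<in> S" "?\<delta> \<le> ht y" using that F1 r' by auto
      let ?y = "y |` {..<?\<delta>}"
      have "?y \<in> S" "ht ?u = ht ?y" using cut_in[OF y] ht_cut[OF y] u(2) by simp_all
      from coherence[OF u(1) this] obtain E where "finite E" "E \<subseteq> {..<?\<delta>}" "?y = flip E ?u"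
        unfolding u(2) by metis
      moreover have "?y \<subseteq>\<^sub>m y" by (rule cut_le)
      ultimately show ?thesis by metis
    qed
    then obtain e where e: "\<And>y. y \<in> F1 \<Longrightarrow> finite (e y)" "\<And>y. y \<in> F1 \<Longrightarrow> e y \<subseteq> {..<?\<delta>}"
        "\<And>y. y \<in> F1 \<Longrightarrow> flip (e y) ?u \<subseteq>\<^sub>m y" by metis
    \<comment> \<open>All parameters of this step: the height of \<open>s\<close>, those of the
      nodes chosen so far and the flipped coordinates. There are finitely many and all lie below
      \<open>?\<delta>\<close>, so their maximum does too.\<close>
    let ?A = "insert (ht s) (ht ` set xs \<union> (\<Union>y\<in>F1. e y))"
    have finA: "finite ?A" using e(1) F1' by auto
    define \<alpha> where "\<alpha> = Max ?A"
    have "?A \<subseteq> {..<?\<delta>}" using Q e(2) by auto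
    moreover have "\<alpha> \<in> ?A" unfolding \<alpha>_def using finA by (intro Max_in) auto
    ultimately have "\<alpha> < ?\<delta>" by blast
    have A_le: "a \<le> \<alpha>" if "a \<in> ?A" for a unfolding \<alpha>_def using finA that by (rule Max_ge)
    have \<gamma>: "f \<alpha> < ?\<delta>" using closed[OF \<open>\<alpha> < ?\<delta>\<close>] .
    then have \<gamma>t: "f \<alpha> \<le> ht t" using t(2) by order
    let ?v = "t |` {..<f \<alpha>}"
    have v: "?v \<in> S" "ht ?v = f \<alpha>" using cut_in[OF t(1) \<gamma>t] ht_cut[OF t(1) \<gamma>t] by auto
    have "ht s \<le> \<alpha>" by (rule A_le) simp
    then have "ht s \<le> ht ?v" using v(2) f_gt[of \<alpha>] by simp
    then have sv: "s \<subseteq>\<^sub>m ?v" using sub_chain[OF s(1) v(1) _ cut_le] Q by blast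
    have vu: "?v \<subseteq>\<^sub>m ?u" using sub_chain[OF v(1) u(1) cut_le cut_le] v(2) u(2) \<gamma> by simp
    have "avoids c ?K ?v ?n (e ` F1)"
    proof (rule f_avoids[OF _ _ _ s(2) v(1) sv])
      show "set xs \<subseteq> nodes_upto \<alpha>" using Q A_le by (auto simp: nodes_upto_def)
      show "s \<in> nodes_upto \<alpha>" using s A_le by (auto simp: nodes_upto_def)
      show "e ` F1 \<in> Fpow (Fpow {..\<alpha>})" using e(1) A_le F1' by (auto simp: Fpow_def)
      show "f \<alpha> \<le> ht ?v" using v(2) by simp
    qed
    moreover have "\<forall>y\<in>F1. \<exists>E\<in>e ` F1. flip E ?v \<subseteq>\<^sub>m y"
      using e(3) flip_mono[OF vu] map_le_trans by blast
    ultimately obtain x \<sigma> where x: "(x, \<sigma>) \<in> ?K" "\<sigma> \<subseteq>\<^sub>m ?v" "ht x < ht ?v" "\<forall>y\<in>F1. x \<subseteq>\<^sub>m y \<longrightarrow> \<not> c {x, y}"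
      using F1' unfolding avoids_def by blast
    have x': "x \<in> S" "\<sigma> \<in> cand D F0 N0 k (xs @ [x])" using x(1) by (auto simp: one_step_def)
    have "\<sigma> \<in> S" using x' cand_subset by blast
    have "ht \<sigma> < ?\<delta>" using sub_ht[OF \<open>\<sigma> \<in> S\<close> v(1) x(2)] v(2) \<gamma> by simp
    moreover have "\<sigma> \<subseteq>\<^sub>m t" using x(2) cut_le map_le_trans by blast
    moreover have "ht x < ?\<delta>" using x(3) v(2) \<gamma> by simp
    ultimately have "?Q k (xs @ [x]) \<sigma>" using Q x x' by auto
    then show ?case unfolding k_def by blast
  qed
  from this[of ?n] obtain xs s where "?Q 0 xs s" by auto
  then show ?thesis using that[of xs s] by blast
qed

end

lemma countable_closure:
  fixes cl :: "'a set \<Rightarrow> 'a set"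
  assumes cl: "\<And>u. finite u \<Longrightarrow> countable (cl u)" and X0: "countable X0"
  obtains X where "X0 \<subseteq> X" "countable X" "\<And>u. finite u \<Longrightarrow> u \<subseteq> X \<Longrightarrow> cl u \<subseteq> X"
proof -
  define Y where "Y n = ((\<lambda>Z. Z \<union> (\<Union>u\<in>Fpow Z. cl u)) ^^ n) X0" for n
  have Y_Suc: "Y (Suc n) = Y n \<union> (\<Union>u\<in>Fpow (Y n). cl u)" for n by (simp add: Y_def)
  have "countable (Y n)" for n
  proof (induction n)
    case 0
    then show ?case using X0 by (simp add: Y_def)
  next
    case (Suc n)
    then have "countable (Fpow (Y n))" by (rule countable_Fpow)
    then have "countable (\<Union>u\<in>Fpow (Y n). cl u)" by (rule countable_UN) (rule cl, simp add: Fpow_def)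
    then show ?case unfolding Y_Suc using Suc by simp
  qed
  then have c: "countable (\<Union>n. Y n)" by simp
  have mono: "Y m \<subseteq> Y n" if "m \<le> n" for m n
    by (rule lift_Suc_mono_le[OF _ that]) (auto simp: Y_Suc)
  have "cl u \<subseteq> (\<Union>n. Y n)" if u: "finite u" "u \<subseteq> (\<Union>n. Y n)" for u
  proof -
    have "\<exists>n. u \<subseteq> Y n"
      using u
    proof (induction u)
      case (insert x u)
      then obtain m n where "u \<subseteq> Y m" "x \<in> Y n" by auto
      then have "insert x u \<subseteq> Y (max m n)" using mono[of m "max m n"] mono[of n "max m n"] by auto
      then show ?case by blast
    qed simp
    then obtain n where "u \<subseteq> Y n" by blast
    then have "u \<in> Fpow (Y n)" using u by (simp add: Fpow_def)
    then have "cl u \<subseteq> Y (Suc n)" unfolding Y_Suc by blast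
    then show ?thesis by blast
  qed
  moreover have "X0 \<subseteq> (\<Union>n. Y n)" using UN_upper[of 0 UNIV Y] by (simp add: Y_def)
  ultimately show ?thesis using that c by blast
qed

text \<open>The objects that the genericity argument refers to. Countable sets of them closed under
  \<open>hull_step\<close> take the place of countable elementary submodels.\<close>

datatype elt = EOrd omega1 | EFun "omega1 \<Rightarrow> omega1" | ECond cond | EDense "(cond \<times> node) set"

section \<open>Countable hulls as models, and genericity over them\<close>

context coloured_tree
begin

definition wit :: "(cond \<times> node) set \<Rightarrow> node set \<Rightarrow> (omega1 \<Rightarrow> omega1) set \<Rightarrow> node list \<Rightarrow> node \<Rightarrow> cond" where
  "wit D F0 N0 xs s = (SOME r. r \<in> conds \<and> (r, s) \<in> D \<and> fst r = F0 \<union> set xs \<and> N0 \<subseteq> snd r)"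

lemma wit:
  assumes "s \<in> cand D F0 N0 0 xs"
  shows "wit D F0 N0 xs s \<in> conds" "(wit D F0 N0 xs s, s) \<in> D"
    "fst (wit D F0 N0 xs s) = F0 \<union> set xs" "N0 \<subseteq> snd (wit D F0 N0 xs s)"
proof -
  have "\<exists>r. r \<in> conds \<and> (r, s) \<in> D \<and> fst r = F0 \<union> set xs \<and> N0 \<subseteq> snd r"
    using assms by auto
  from someI_ex[OF this] show "wit D F0 N0 xs s \<in> conds" "(wit D F0 N0 xs s, s) \<in> D"
    "fst (wit D F0 N0 xs s) = F0 \<union> set xs" "N0 \<subseteq> snd (wit D F0 N0 xs s)"
    unfolding wit_def by blast+
qed

definition ords :: "elt set \<Rightarrow> omega1 set" where "ords u = {\<xi>. EOrd \<xi> \<in> u}"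
definition funs :: "elt set \<Rightarrow> (omega1 \<Rightarrow> omega1) set" where "funs u = {f. EFun f \<in> u}"
definition cnds :: "elt set \<Rightarrow> cond set" where "cnds u = {p \<in> conds. ECond p \<in> u}"
definition dens :: "elt set \<Rightarrow> (cond \<times> node) set set" where "dens u = {D. EDense D \<in> u}"

text \<open>A list of Skolem functions, one for each use of elementarity in the genericity argument;
  \<open>modelD\<close> collects what closure under them gives.\<close>

definition hull_step :: "elt set \<Rightarrow> elt set" where
  "hull_step u =
     insert (EOrd omega1_zero) (insert (EFun (\<lambda>_. omega1_zero))
     (EOrd ` (\<Union>\<xi>\<in>ords u. {..<\<xi>}) \<union> EOrd ` (\<lambda>(f, \<xi>). f \<xi>) ` (funs u \<times> ords u) \<union>
      EOrd ` side_ord ` funs u \<union> EFun ` (\<Union>f\<in>funs u. side_fun f) \<union>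
      EOrd ` (\<Union>p\<in>cnds u. ht ` fst p) \<union> EFun ` (\<Union>p\<in>cnds u. snd p) \<union>
      ECond ` ((\<Union>\<xi>\<in>ords u. Fpow (nodes_upto \<xi>)) \<times> Fpow (funs u)) \<union>
      (\<lambda>(D, p, n). EFun (bound D (fst p) (snd p) n)) ` (dens u \<times> cnds u \<times> UNIV) \<union>
      (\<lambda>(D, p, xs, s). ECond (wit D (fst p) (snd p) xs s)) `
        (dens u \<times> cnds u \<times> (\<Union>\<xi>\<in>ords u. lists (nodes_upto \<xi>)) \<times> (\<Union>\<xi>\<in>ords u. nodes_upto \<xi>))))"

lemma countable_hull_step:
  assumes u: "finite u"
  shows "countable (hull_step u)"
proof -
  have "finite (EOrd -` u)" "finite (EFun -` u)" "finite (ECond -` u)" "finite (EDense -` u)"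
    using u by (auto intro!: finite_vimageI simp: inj_on_def)
  moreover have "ords u = EOrd -` u" "funs u = EFun -` u" "cnds u \<subseteq> ECond -` u" "dens u = EDense -` u"
    by (auto simp: ords_def funs_def cnds_def dens_def)
  ultimately have c: "countable (ords u)" "countable (funs u)" "countable (cnds u)" "countable (dens u)"
    by (auto intro: countable_finite finite_subset)
  have n: "countable (nodes_upto \<xi>)" for \<xi> unfolding nodes_upto_def by (rule countable_below)
  have p: "countable (fst p)" "countable (snd p)" if "p \<in> cnds u" for p
    using that by (auto simp: cnds_def conds_def intro: countable_finite)
  have "countable (\<Union>\<xi>\<in>ords u. {..<\<xi>})" "countable (\<Union>f\<in>funs u. side_fun f)"
    "countable (\<Union>p\<in>cnds u. ht ` fst p)" "countable (\<Union>p\<in>cnds u. snd p)"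
    "countable (\<Union>\<xi>\<in>ords u. Fpow (nodes_upto \<xi>))" "countable (Fpow (funs u))"
    "countable (\<Union>\<xi>\<in>ords u. lists (nodes_upto \<xi>))" "countable (\<Union>\<xi>\<in>ords u. nodes_upto \<xi>)"
    using c n p countable_initial_segment_omega1 countable_side_fun
    by (auto intro!: countable_UN countable_Fpow)
  then show ?thesis
    unfolding hull_step_def using c
    by (intro countable_insert countable_Un countable_image countable_SIGMA) auto
qed

definition hull_closed :: "elt set \<Rightarrow> bool" where
  "hull_closed X \<longleftrightarrow> (\<forall>u. finite u \<longrightarrow> u \<subseteq> X \<longrightarrow> hull_step u \<subseteq> X)"

definition model :: "elt set \<Rightarrow> (omega1 \<Rightarrow> omega1) \<Rightarrow> bool" where
  "model X h \<longleftrightarrow> hull_closed X \<and> ords X = {..<side_ord h} \<and> funs X = side_fun h"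

text \<open>Closure under smaller ordinals makes the ordinals of \<open>X\<close> an initial
  segment, which is proper by countability. The constant function in \<open>hull_step\<close>
  ensures that the set of functions is nonempty, as \<open>side_code\<close> requires.\<close>

lemma model_exists:
  assumes "countable X" "hull_closed X"
  obtains h where "model X h"
proof -
  have inj: "inj_on EOrd A" "inj_on EFun B" for A B by (auto simp: inj_on_def)
  have "EOrd ` ords X \<subseteq> X" "EFun ` funs X \<subseteq> X" by (auto simp: ords_def funs_def)
  then have c: "countable (ords X)" "countable (funs X)"
    using assms(1) countable_subset countable_image_inj_on inj by metis+
  have "EFun (\<lambda>_. omega1_zero) \<in> hull_step {}" by (simp add: hull_step_def)
  then have "EFun (\<lambda>_. omega1_zero) \<in> X" using assms(2) unfolding hull_closed_def by blast
  then have "funs X \<noteq> {}" by (auto simp: funs_def)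
  define \<delta> where "\<delta> = (LEAST \<xi>. \<xi> \<notin> ords X)"
  have "\<exists>\<xi>. \<xi> \<notin> ords X" using omega1_bounded[OF c(1)] by blast
  then have \<delta>: "\<delta> \<notin> ords X" unfolding \<delta>_def by (rule LeastI_ex)
  have "ords X = {..<\<delta>}"
  proof (intro equalityI subsetI)
    fix \<xi> assume "\<xi> \<in> {..<\<delta>}"
    then show "\<xi> \<in> ords X" unfolding \<delta>_def using not_less_Least by auto
  next
    fix \<xi> assume \<xi>: "\<xi> \<in> ords X"
    have "\<delta> \<in> ords X" if "\<delta> < \<xi>"
    proof -
      have "EOrd \<delta> \<in> hull_step {EOrd \<xi>}" using that by (auto simp: hull_step_def ords_def)
      moreover have "{EOrd \<xi>} \<subseteq> X" using \<xi> by (simp add: ords_def)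
      ultimately show ?thesis using assms(2) unfolding hull_closed_def ords_def by blast
    qed
    then show "\<xi> \<in> {..<\<delta>}" using \<delta> \<xi> by (metis lessThan_iff linorder_neqE)
  qed
  moreover obtain h where "side_ord h = \<delta>" "side_fun h = funs X"
    using side_code[OF c(2) \<open>funs X \<noteq> {}\<close>] .
  ultimately have "model X h" using assms unfolding model_def by simp
  then show ?thesis by (rule that)
qed

lemma modelD:
  assumes "model X h"
  shows "omega1_zero < side_ord h"
    "\<And>f \<xi>. f \<in> side_fun h \<Longrightarrow> \<xi> < side_ord h \<Longrightarrow> f \<xi> < side_ord h"
    "\<And>f. f \<in> side_fun h \<Longrightarrow> side_less f h"
    "\<And>p x. p \<in> conds \<Longrightarrow> ECond p \<in> X \<Longrightarrow> x \<in> fst p \<Longrightarrow> ht x < side_ord h"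
    "\<And>p f. p \<in> conds \<Longrightarrow> ECond p \<in> X \<Longrightarrow> f \<in> snd p \<Longrightarrow> side_less f h"
    "\<And>F0 N0. finite F0 \<Longrightarrow> F0 \<subseteq> S \<Longrightarrow> (\<And>x. x \<in> F0 \<Longrightarrow> ht x < side_ord h) \<Longrightarrow> finite N0 \<Longrightarrow> N0 \<subseteq> side_fun h \<Longrightarrow>
        ECond (F0, N0) \<in> X"
    "\<And>D F0 N0 n. EDense D \<in> X \<Longrightarrow> (F0, N0) \<in> conds \<Longrightarrow> ECond (F0, N0) \<in> X \<Longrightarrow> bound D F0 N0 n \<in> side_fun h"
    "\<And>D F0 N0 xs s. EDense D \<in> X \<Longrightarrow> (F0, N0) \<in> conds \<Longrightarrow> ECond (F0, N0) \<in> X \<Longrightarrow> set xs \<subseteq> S \<Longrightarrow>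
       (\<And>x. x \<in> set xs \<Longrightarrow> ht x < side_ord h) \<Longrightarrow> s \<in> S \<Longrightarrow> ht s < side_ord h \<Longrightarrow> ECond (wit D F0 N0 xs s) \<in> X"
proof -
  have cl: "e \<in> X" if "e \<in> hull_step u" "finite u" "u \<subseteq> X" for e u
    using assms that unfolding model_def hull_closed_def by blast
  have ords: "EOrd \<xi> \<in> X \<longleftrightarrow> \<xi> < side_ord h" for \<xi>
    using assms unfolding model_def ords_def by (metis lessThan_iff mem_Collect_eq)
  have funs: "EFun f \<in> X \<longleftrightarrow> f \<in> side_fun h" for f
    using assms unfolding model_def funs_def by (metis mem_Collect_eq)
  have "EOrd omega1_zero \<in> hull_step {}" by (simp add: hull_step_def)
  from cl[OF this] show pos: "omega1_zero < side_ord h" by (simp add: ords)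
  show "f \<xi> < side_ord h" if "f \<in> side_fun h" "\<xi> < side_ord h" for f \<xi>
  proof -
    have "EOrd (f \<xi>) \<in> hull_step {EFun f, EOrd \<xi>}" by (force simp: hull_step_def ords_def funs_def)
    from cl[OF this] show ?thesis using that ords funs by auto
  qed
  show less: "side_less f h" if "f \<in> side_fun h" for f
  proof -
    have "EOrd (side_ord f) \<in> hull_step {EFun f}" by (simp add: hull_step_def funs_def)
    from cl[OF this] have "side_ord f < side_ord h" using that ords funs by auto
    moreover have "g \<in> side_fun h" if "g \<in> side_fun f" for g
    proof -
      have "EFun g \<in> hull_step {EFun f}" using that by (auto simp: hull_step_def funs_def)
      from cl[OF this] show ?thesis using \<open>f \<in> side_fun h\<close> funs by auto
    qed
    ultimately show ?thesis using that unfolding side_less_def by blast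
  qed
  show "ht x < side_ord h" if "p \<in> conds" "ECond p \<in> X" "x \<in> fst p" for p x
  proof -
    have "EOrd (ht x) \<in> hull_step {ECond p}" using that by (auto simp: hull_step_def cnds_def)
    from cl[OF this] show ?thesis using that ords by auto
  qed
  show "side_less f h" if "p \<in> conds" "ECond p \<in> X" "f \<in> snd p" for p f
  proof (rule less)
    have "EFun f \<in> hull_step {ECond p}" using that by (auto simp: hull_step_def cnds_def)
    from cl[OF this] show "f \<in> side_fun h" using that funs by auto
  qed
  have max: "\<exists>\<xi><side_ord h. A \<subseteq> nodes_upto \<xi>"
    if A: "finite A" "A \<subseteq> S" "\<And>x. x \<in> A \<Longrightarrow> ht x < side_ord h" for A
  proof (intro exI conjI)
    let ?\<xi> = "Max (insert omega1_zero (ht ` A))"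
    have "?\<xi> \<in> insert omega1_zero (ht ` A)" using A by (intro Max_in) auto
    then show "?\<xi> < side_ord h" using A pos by auto
    show "A \<subseteq> nodes_upto ?\<xi>" using A by (auto simp: nodes_upto_def)
  qed
  show "ECond (F0, N0) \<in> X"
    if F0: "finite F0" "F0 \<subseteq> S" "\<And>x. x \<in> F0 \<Longrightarrow> ht x < side_ord h" and N0: "finite N0" "N0 \<subseteq> side_fun h" for F0 N0
  proof -
    obtain \<xi> where \<xi>: "\<xi> < side_ord h" "F0 \<subseteq> nodes_upto \<xi>" using max[OF F0] by blast
    let ?u = "insert (EOrd \<xi>) (EFun ` N0)"
    have "\<xi> \<in> ords ?u" "F0 \<in> Fpow (nodes_upto \<xi>)" "N0 \<in> Fpow (funs ?u)"
      using \<xi> F0 N0 by (auto simp: ords_def funs_def Fpow_def)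
    then have "(F0, N0) \<in> (\<Union>\<xi>\<in>ords ?u. Fpow (nodes_upto \<xi>)) \<times> Fpow (funs ?u)" by (intro SigmaI UN_I)
    then have "ECond (F0, N0) \<in> hull_step ?u" unfolding hull_step_def by (simp only: Un_iff insert_iff imageI simp_thms)
    moreover have "finite ?u" using N0(1) by simp
    moreover have "?u \<subseteq> X" using \<xi>(1) N0(2) ords[of \<xi>] by (auto simp: funs)
    ultimately show ?thesis by (rule cl)
  qed
  show "bound D F0 N0 n \<in> side_fun h" if "EDense D \<in> X" "(F0, N0) \<in> conds" "ECond (F0, N0) \<in> X" for D F0 N0 n
  proof -
    have "EFun (bound D F0 N0 n) \<in> hull_step {EDense D, ECond (F0, N0)}"
      using that unfolding hull_step_def
      by (intro insertI2 UnI1[OF UnI2] image_eqI[of _ _ "(D, (F0, N0), n)"]) (auto simp: cnds_def dens_def)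
    from cl[OF this] show ?thesis using that by (simp add: funs)
  qed
  show "ECond (wit D F0 N0 xs s) \<in> X"
    if "EDense D \<in> X" "(F0, N0) \<in> conds" "ECond (F0, N0) \<in> X"
      and xs: "set xs \<subseteq> S" "\<And>x. x \<in> set xs \<Longrightarrow> ht x < side_ord h" and s: "s \<in> S" "ht s < side_ord h" for D F0 N0 xs s
  proof -
    obtain \<xi> where \<xi>: "\<xi> < side_ord h" "set xs \<subseteq> nodes_upto \<xi>" using max[of "set xs"] xs by auto
    let ?u = "{EDense D, ECond (F0, N0), EOrd \<xi>, EOrd (ht s)}"
    have "D \<in> dens ?u" "(F0, N0) \<in> cnds ?u" "xs \<in> (\<Union>\<xi>\<in>ords ?u. lists (nodes_upto \<xi>))" "s \<in> (\<Union>\<xi>\<in>ords ?u. nodes_upto \<xi>)"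
      using that \<xi> by (auto simp: dens_def cnds_def ords_def nodes_upto_def)
    then have "ECond (wit D (fst (F0, N0)) (snd (F0, N0)) xs s) \<in> hull_step ?u" unfolding hull_step_def
      by (intro insertI2 UnI2 image_eqI[of _ _ "(D, (F0, N0), xs, s)"]) auto
    from cl[OF this] show ?thesis using that \<xi> ords by auto
  qed
qed

text \<open>All nodes of \<open>p\<close> lie below \<open>side_ord h\<close>, so the separation
  clause for \<open>h\<close> is vacuous, and all side conditions of \<open>p\<close> are below
  \<open>h\<close>.\<close>

lemma add_model:
  assumes "model X h" "p \<in> conds" "ECond p \<in> X"
  shows "(fst p, insert h (snd p)) \<in> conds"
proof -
  note m = modelD[OF assms(1)]
  obtain F N where p: "p = (F, N)" by fastforce
  have F: "ht x < side_ord h" if "x \<in> F" for x using m(4)[OF assms(2,3)] that p by simp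
  have N: "side_less f h" if "f \<in> N" for f using m(5)[OF assms(2,3)] that p by simp
  show ?thesis
    using assms(2) unfolding p fst_conv snd_conv conds_iff
    using N m(2) by (intro conjI ballI allI impI) (auto dest: F)
qed

text \<open>\<open>(F', N')\<close> lives inside the model of \<open>h\<close>, keeps the part of
  \<open>(F, N)\<close> in that model and adds the nodes \<open>A\<close>. The only new comparable
  pairs that need a colour join a node of \<open>A\<close> to a node of \<open>F\<close> above the
  model, which is \<open>av\<close>. Gaps across \<open>side_ord h\<close> come from the closure of
  this ordinal under the functions of \<open>h\<close>.\<close>

lemma amalgamate:
  assumes r: "(F, N) \<in> conds" and h: "h \<in> N"
    and r': "(F', N') \<in> conds" and N': "\<And>f. f \<in> N' \<Longrightarrow> side_less f h"
    and F': "F' = {x \<in> F. ht x < side_ord h} \<union> A" "\<And>x. x \<in> A \<Longrightarrow> ht x < side_ord h"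
    and N0: "{f \<in> N. side_less f h} \<subseteq> N'"
    and av: "\<And>x y. x \<in> A \<Longrightarrow> y \<in> F \<Longrightarrow> side_ord h \<le> ht y \<Longrightarrow> x \<subseteq>\<^sub>m y \<Longrightarrow> \<not> c {x, y}"
  shows "(F \<union> F', N \<union> N') \<in> conds"
proof -
  let ?\<delta> = "side_ord h"
  have 1: "F \<subseteq> S" "finite F" "finite N" "inj_on ht F" "\<forall>x\<in>F. \<forall>y\<in>F. tree_less x y \<longrightarrow> \<not> c {x, y}"
     "\<forall>f\<in>N. \<forall>g\<in>N. f = g \<or> side_less f g \<or> side_less g f"
     "\<forall>f\<in>N. \<forall>g\<in>side_fun f. \<forall>\<xi><side_ord f. g \<xi> < side_ord f"
     "\<forall>f\<in>N. \<forall>g\<in>side_fun f. \<forall>x\<in>F. \<forall>y\<in>F. side_ord f \<le> ht x \<longrightarrow> ht x < ht y \<longrightarrow> g (ht x) < ht y"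
    using r unfolding conds_iff by simp_all
  have 2: "F' \<subseteq> S" "finite F'" "finite N'" "inj_on ht F'" "\<forall>x\<in>F'. \<forall>y\<in>F'. tree_less x y \<longrightarrow> \<not> c {x, y}"
     "\<forall>f\<in>N'. \<forall>g\<in>N'. f = g \<or> side_less f g \<or> side_less g f"
     "\<forall>f\<in>N'. \<forall>g\<in>side_fun f. \<forall>\<xi><side_ord f. g \<xi> < side_ord f"
     "\<forall>f\<in>N'. \<forall>g\<in>side_fun f. \<forall>x\<in>F'. \<forall>y\<in>F'. side_ord f \<le> ht x \<longrightarrow> ht x < ht y \<longrightarrow> g (ht x) < ht y"
    using r' unfolding conds_iff by simp_all
  have F'lt: "ht x < ?\<delta>" if "x \<in> F'" for x using that F' by auto
  have split: "x \<in> F' \<or> x \<in> F \<and> ?\<delta> \<le> ht x" if "x \<in> F \<union> F'" for x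
    using that F'(1) by (auto simp: not_less)
  have lo: "x \<in> F'" if "x \<in> F \<union> F'" "ht x < ?\<delta>" for x using split[OF that(1)] that(2) by auto
  have hi: "x \<in> F" if "x \<in> F \<union> F'" "?\<delta> \<le> ht x" for x using split[OF that(1)] F'lt[of x] that(2) by auto
  show ?thesis
    unfolding conds_iff
  proof (intro conjI ballI impI allI)
    show "F \<union> F' \<subseteq> S" "finite (F \<union> F')" "finite (N \<union> N')" using 1 2 by auto
    show "inj_on ht (F \<union> F')"
    proof (rule inj_onI)
      fix x y assume xy: "x \<in> F \<union> F'" "y \<in> F \<union> F'" "ht x = ht y"
      show "x = y"
      proof (cases "ht x < ?\<delta>")
        case True
        then show ?thesis using lo[OF xy(1)] lo[OF xy(2)] xy(3) 2(4) by (simp add: inj_on_def)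
      next
        case False
        then show ?thesis using hi[OF xy(1)] hi[OF xy(2)] xy(3) 1(4) by (simp add: inj_on_def not_less)
      qed
    qed
    fix x y assume xy: "x \<in> F \<union> F'" "y \<in> F \<union> F'" "tree_less x y"
    have xy': "x \<subseteq>\<^sub>m y" using xy by (simp add: tree_less_def)
    show "\<not> c {x, y}"
    proof (cases "ht y < ?\<delta>")
      case True
      have "ht x \<le> ht y" using sub_ht[OF _ _ xy'] xy 1(1) 2(1) by blast
      then show ?thesis using lo[OF xy(1)] lo[OF xy(2) True] True xy(3) 2(5) by simp
    next
      case False
      then have y: "y \<in> F" "?\<delta> \<le> ht y" using hi[OF xy(2)] by simp_all
      then show ?thesis using xy 1(5) F' av[OF _ y xy'] by blast
    qed
  next
    fix f g assume fg: "f \<in> N \<union> N'" "g \<in> N \<union> N'"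
    have mixed: "f = g \<or> side_less f g \<or> side_less g f" if "f \<in> N'" "g \<in> N" for f g
    proof -
      have "g = h \<or> side_less g h \<or> side_less h g" using 1(6) that h by blast
      then consider "g = h" | "g \<in> N'" | "side_less h g" using \<open>g \<in> N\<close> N0 by blast
      then show ?thesis using N'[OF that(1)] 2(6) that side_less_trans by cases blast+
    qed
    show "f = g \<or> side_less f g \<or> side_less g f"
      using fg 1(6) 2(6) mixed[of f g] mixed[of g f] by auto
  next
    fix f g \<xi> assume "f \<in> N \<union> N'" "g \<in> side_fun f" "\<xi> < side_ord f"
    then show "g \<xi> < side_ord f" using 1(7) 2(7) by auto
  next
    fix f g x y assume fg: "f \<in> N \<union> N'" "g \<in> side_fun f" and xy: "x \<in> F \<union> F'" "y \<in> F \<union> F'" "side_ord f \<le> ht x" "ht x < ht y"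
    show "g (ht x) < ht y"
    proof (cases "f \<in> N'")
      case True
      then have g: "g \<in> side_fun h" using N' fg unfolding side_less_def by blast
      show ?thesis
      proof (cases "ht y < ?\<delta>")
        case True
        then show ?thesis using lo[OF xy(1)] lo[OF xy(2)] xy fg 2(8) \<open>f \<in> N'\<close> by simp
      next
        case False
        show ?thesis
        proof (cases "ht x < ?\<delta>")
          case True
          then have "g (ht x) < ?\<delta>" using 1(7) h g by blast
          then show ?thesis using False by simp
        next
          case False
          then show ?thesis using hi[OF xy(1)] hi[OF xy(2)] xy 1(8) h g by (simp add: not_less)
        qed
      qed
    next
      case False
      then have f: "f \<in> N" "\<not> side_less f h" using fg N0 by auto
      then have "f = h \<or> side_less h f" using 1(6) h by blast
      then have "?\<delta> \<le> side_ord f" unfolding side_less_def by auto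
      then show ?thesis using hi[OF xy(1)] hi[OF xy(2)] xy f fg 1(8) by simp
    qed
  qed
qed

text \<open>Genericity over the model for the product with \<open>S\<close>, since the node
  \<open>s\<close> lies below the given \<open>t\<close>; sets \<open>D\<close> that ignore the node
  give genericity for the poset alone. The part of \<open>r\<close> inside the model belongs to
  \<open>X\<close>, the nodes above it get replacements by \<open>avoid_condition\<close>,
  \<open>wit\<close> completes them to a condition in \<open>X\<close>, and
  \<open>amalgamate\<close> combines this with \<open>r\<close>.\<close>

lemma model_generic:
  assumes X: "model X h" and r: "r \<in> conds" "h \<in> snd r" and D: "EDense D \<in> X" "upward D" "(r, t) \<in> D"
    and t: "t \<in> S" "side_ord h \<le> ht t"
  obtains r' s u where "ECond r' \<in> X" "r' \<in> conds" "(r', s) \<in> D" "s \<in> S" "s \<subseteq>\<^sub>m t" "ht s < side_ord h"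
    "u \<in> conds" "stronger u r" "stronger u r'"
proof -
  let ?\<delta> = "side_ord h"
  note m = modelD[OF X]
  obtain F N where rFN: "r = (F, N)" by fastforce
  have r': "(F, N) \<in> conds" "h \<in> N" using r rFN by auto
  have F: "F \<subseteq> S" "finite F" "finite N" using r' unfolding conds_iff by simp_all
  \<comment> \<open>\<open>avoid_condition\<close> asks for a node at least as tall as all of
    \<open>F\<close>. Nothing is lost, since the short \<open>s\<close> found below
    \<open>t'\<close> is also below \<open>t\<close>.\<close>
  obtain t' where t': "t' \<in> S" "t \<subseteq>\<^sub>m t'" "ht t < ht t'" "\<And>y. y \<in> F \<Longrightarrow> ht y \<le> ht t'"
  proof -
    obtain t' where t': "t' \<in> S" "t \<subseteq>\<^sub>m t'" "ht t < ht t'" "\<And>\<alpha>. \<alpha> \<in> ht ` F \<Longrightarrow> \<alpha> < ht t'"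
      using extension_above[OF t(1), of "ht ` F"] F(2) countable_finite by (metis finite_imageI)
    show ?thesis by (rule that[OF t'(1,2,3)]) (use t'(4) in \<open>auto intro: less_imp_le\<close>)
  qed
  have Dt': "((F, N), t') \<in> D" using D(2,3) t' rFN unfolding upward_def by blast
  define F0 where "F0 = {x \<in> F. ht x < ?\<delta>}"
  define N0 where "N0 = {f \<in> N. side_less f h}"
  have c0: "(F0, N0) \<in> conds"
    using r'(1) unfolding conds_iff F0_def N0_def by (auto intro: inj_on_subset)
  have X0: "ECond (F0, N0) \<in> X"
    using F by (intro m(6)) (auto simp: F0_def N0_def side_less_def)
  have \<delta>t': "?\<delta> \<le> ht t'" using t(2) t'(3) by order
  obtain xs s where xs: "set xs \<subseteq> S" "\<And>x. x \<in> set xs \<Longrightarrow> ht x < ?\<delta>" "s \<in> cand D F0 N0 0 xs" "s \<subseteq>\<^sub>m t'" "ht s < ?\<delta>"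
    "\<And>x y. x \<in> set xs \<Longrightarrow> y \<in> {x \<in> F. ?\<delta> \<le> ht x} \<Longrightarrow> x \<subseteq>\<^sub>m y \<Longrightarrow> \<not> c {x, y}"
  proof (rule avoid_condition[OF r' m(1) D(2) Dt' t'(1) \<delta>t' t'(4) F0_def refl])
    show "N0 \<subseteq> N" by (auto simp: N0_def)
    show "bound D F0 N0 (card {x \<in> F. ?\<delta> \<le> ht x}) \<in> side_fun h" by (rule m(7)[OF D(1) c0 X0])
  qed (assumption, rule that)
  let ?w = "wit D F0 N0 xs s"
  note w = wit[OF xs(3)]
  have sS: "s \<in> S" using xs(3) by simp
  have wX: "ECond ?w \<in> X" using m(8)[OF D(1) c0 X0 xs(1,2) sS xs(5)] .
  have "s \<subseteq>\<^sub>m t" using sub_chain[OF sS t(1) xs(4) t'(2)] xs(5) t(2) by simp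
  have wc: "(fst ?w, snd ?w) \<in> conds" using w(1) by simp
  have "(F \<union> fst ?w, N \<union> snd ?w) \<in> conds"
  proof (rule amalgamate[OF r' wc])
    show "side_less f h" if "f \<in> snd ?w" for f using m(5)[OF w(1) wX that] .
    show "fst ?w = {x \<in> F. ht x < ?\<delta>} \<union> set xs" using w(3) by (simp add: F0_def)
    show "{f \<in> N. side_less f h} \<subseteq> snd ?w" using w(4) by (simp add: N0_def)
  qed (use xs in auto)
  then show ?thesis
    using that[OF wX w(1,2) sS \<open>s \<subseteq>\<^sub>m t\<close> xs(5)] rFN unfolding stronger_def by auto
qed

end

section \<open>Forcing that \<open>S\<close> is Suslin\<close>

context cc_suslin
begin

lemma comparable_iff: "comparable s t \<longleftrightarrow> s \<subseteq>\<^sub>m t \<or> t \<subseteq>\<^sub>m s"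
  unfolding comparable_def tree_less_def by (auto simp: map_le_refl)

lemma comparable_below:
  assumes "s \<in> S" "s1 \<in> S" "s' \<in> S" "s1 \<subseteq>\<^sub>m s" "comparable s' s"
  shows "comparable s' s1"
  using assms sub_chain[of s' s1 s] sub_chain[of s1 s' s] map_le_trans
  unfolding comparable_iff by (metis linear)

lemma fmem_mono:
  assumes "trans r" "fmem P r x \<tau> p" "(q, p) \<in> r"
  shows "fmem P r x \<tau> q"
  using assms unfolding fmem_def by (meson transD)

text \<open>The nodes of height at most \<delta> have an enumeration in the ground model, and its
  canonical name is the name of a partial function that is required.\<close>

lemma fcountable_of_bounded:
  assumes r: "trans r" "\<And>p. p \<in> P \<Longrightarrow> (p, p) \<in> r"
    and bd: "\<And>q'. q' \<in> P \<Longrightarrow> (q', q) \<in> r \<Longrightarrow> \<exists>u\<in>P. (u, q') \<in> r \<and>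
      (\<exists>\<delta>. \<forall>a\<in>P. (a, u) \<in> r \<longrightarrow> (\<forall>s\<in>S. fmem P r s A a \<longrightarrow> ht s < \<delta>))"
  shows "fcountable P r S A q"
  unfolding fcountable_def fex_def[of P r "Pow ((UNIV \<times> S) \<times> P)"]
proof (intro ballI impI)
  fix q' assume q': "q' \<in> P" "(q', q) \<in> r"
  obtain u \<delta> where u: "u \<in> P" "(u, q') \<in> r"
    and \<delta>: "\<And>a s. a \<in> P \<Longrightarrow> (a, u) \<in> r \<Longrightarrow> s \<in> S \<Longrightarrow> fmem P r s A a \<Longrightarrow> ht s < \<delta>"
    using bd[OF q'] by blast
  let ?B = "{t \<in> S. ht t \<le> \<delta>}"
  define e where "e = from_nat_into ?B"
  have e: "\<exists>n. e n = s" if "s \<in> S" "ht s < \<delta>" for s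
    using from_nat_into_surj[OF countable_below, of s \<delta>] that unfolding e_def by simp
  define f where "f = {((n, x), v). v \<in> P \<and> x \<in> S \<and> e n = x}"
  have fm: "fmem P r (n, x) f a \<longleftrightarrow> x \<in> S \<and> e n = x" if "a \<in> P" for n x a
    unfolding fmem_def f_def using that r(2) by blast
  have "f \<in> Pow ((UNIV \<times> S) \<times> P)" by (auto simp: f_def)
  moreover have "fall (UNIV :: nat set) (\<lambda>n. fall S (\<lambda>x. fall S (\<lambda>y.
            fimp P r (fmem P r (n, x) f) (fimp P r (fmem P r (n, y) f) (\<lambda>_. x = y))))) u"
    unfolding fall_def fimp_def by (auto simp: fm)
  moreover have "fall S (\<lambda>x. fimp P r (fmem P r x A)
            (fex P r (UNIV :: nat set) (\<lambda>n. fmem P r (n, x) f))) u"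
    unfolding fall_def fimp_def fex_def
  proof (intro ballI impI)
    fix x a b assume *: "x \<in> S" "a \<in> P" "(a, u) \<in> r" "fmem P r x A a" "b \<in> P" "(b, a) \<in> r"
    then obtain n where "e n = x" using e \<delta> by blast
    then have "fmem P r (n, x) f b" using fm * by blast
    then show "\<exists>u\<in>P. (u, b) \<in> r \<and> (\<exists>x'\<in>UNIV. fmem P r (x', x) f u)" using * r(2) by blast
  qed
  ultimately show "\<exists>u\<in>P. (u, q') \<in> r \<and> (\<exists>f\<in>Pow ((UNIV \<times> S) \<times> P).
      fand (fall (UNIV :: nat set) (\<lambda>n. fall S (\<lambda>x. fall S (\<lambda>y.
            fimp P r (fmem P r (n, x) f) (fimp P r (fmem P r (n, y) f) (\<lambda>_. x = y))))))
         (fall S (\<lambda>x. fimp P r (fmem P r x A)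
            (fex P r (UNIV :: nat set) (\<lambda>n. fmem P r (n, x) f)))) u)"
    unfolding fand_def using u by blast
qed

definition dense_upward :: "'p set \<Rightarrow> 'p rel \<Rightarrow> ('p \<times> node) set \<Rightarrow> bool" where
  "dense_upward P r D \<longleftrightarrow> D \<subseteq> P \<times> S \<and>
     (\<forall>a s t. (a, s) \<in> D \<longrightarrow> t \<in> S \<longrightarrow> s \<subseteq>\<^sub>m t \<longrightarrow> (a, t) \<in> D) \<and>
     (\<forall>a\<in>P. \<forall>t\<in>S. \<exists>a' t'. (a', a) \<in> r \<and> t \<subseteq>\<^sub>m t' \<and> (a', t') \<in> D)"

text \<open>What \<open>model_generic\<close> provides, with the model reduced to its height
  \<delta>.\<close>

definition generic_below :: "'p set \<Rightarrow> 'p rel \<Rightarrow> ('p \<times> node) set \<Rightarrow> 'p \<Rightarrow> omega1 \<Rightarrow> bool" where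
  "generic_below P r D q \<delta> \<longleftrightarrow> (\<forall>a\<in>P. (a, q) \<in> r \<longrightarrow> (\<forall>t\<in>S. \<delta> \<le> ht t \<longrightarrow>
     (\<exists>a'\<in>P. \<exists>s\<in>S. (a', s) \<in> D \<and> s \<subseteq>\<^sub>m t \<and> ht s < \<delta> \<and> (\<exists>u\<in>P. (u, a) \<in> r \<and> (u, a') \<in> r))))"

lemma generic_belowE:
  assumes "generic_below P r D q \<delta>" "a \<in> P" "(a, q) \<in> r" "t \<in> S" "\<delta> \<le> ht t"
  obtains a' s u where "a' \<in> P" "s \<in> S" "(a', s) \<in> D" "s \<subseteq>\<^sub>m t" "ht s < \<delta>" "u \<in> P" "(u, a) \<in> r" "(u, a') \<in> r"
  using assms unfolding generic_below_def by blast

text \<open>The pairs that decide \<open>\<Phi>\<close>. In the applications a member of this set is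
  compatible with a pair that satisfies \<open>\<Phi>\<close>; this excludes the negative
  alternative, so the member itself satisfies \<open>\<Phi>\<close>.\<close>

lemma dense_upward_decide:
  assumes refl: "\<And>p. p \<in> P \<Longrightarrow> (p, p) \<in> r"
    and up: "\<And>a s t. s \<in> S \<Longrightarrow> t \<in> S \<Longrightarrow> s \<subseteq>\<^sub>m t \<Longrightarrow> \<Phi> a s \<Longrightarrow> \<Phi> a t"
  shows "dense_upward P r {(a, t). a \<in> P \<and> t \<in> S \<and>
    (\<Phi> a t \<or> (\<forall>a'\<in>P. (a', a) \<in> r \<longrightarrow> (\<forall>t'\<in>S. t \<subseteq>\<^sub>m t' \<longrightarrow> \<not> \<Phi> a' t')))}" (is "dense_upward P r ?D")
  unfolding dense_upward_def
proof (intro conjI allI impI ballI)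
  show "?D \<subseteq> P \<times> S" by auto
  show "(a, t) \<in> ?D" if as: "(a, s) \<in> ?D" "t \<in> S" "s \<subseteq>\<^sub>m t" for a s t
    using as up[OF _ as(2,3)] map_le_trans[OF as(3)] by blast
  show "\<exists>a' t'. (a', a) \<in> r \<and> t \<subseteq>\<^sub>m t' \<and> (a', t') \<in> ?D" if "a \<in> P" "t \<in> S" for a t
    using that refl[OF that(1)] map_le_refl[of t] by blast
qed

text \<open>In all three clauses a condition speaks about a node \<open>s\<close> of height at least
  \<delta>. Genericity along \<open>s\<close> itself gives a compatible deciding pair whose node is
  below \<open>s\<close> and shorter than \<delta>, and what this pair decides contradicts the
  height of \<open>s\<close> or the assumption on the name.\<close>

lemma forces_suslinI:
  assumes r: "trans r" "\<And>p. p \<in> P \<Longrightarrow> (p, p) \<in> r" "r \<subseteq> P \<times> P"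
    and gen: "\<And>p \<D>. p \<in> P \<Longrightarrow> countable \<D> \<Longrightarrow> (\<And>D. D \<in> \<D> \<Longrightarrow> dense_upward P r D) \<Longrightarrow>
       \<exists>q\<in>P. (q, p) \<in> r \<and> (\<exists>\<delta>. \<forall>D\<in>\<D>. generic_below P r D q \<delta>)"
  shows "forces_suslin P r S"
proof -
  note mono = fmem_mono[OF r(1)]
  have gen1: "\<exists>q\<in>P. (q, p) \<in> r \<and> (\<exists>\<delta>. generic_below P r D q \<delta>)" if "p \<in> P" "dense_upward P r D" for p D
    using gen[of p "{D}"] that by auto
  have "fnot P r (fcountable P r S (S \<times> P)) p" for p
    unfolding fnot_def
  proof (intro ballI impI notI)
    fix q assume q: "q \<in> P" and fc: "fcountable P r S (S \<times> P) q"
    then obtain u f where u: "u \<in> P" "(u, q) \<in> r"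
      and func: "\<And>n x y a. x \<in> S \<Longrightarrow> y \<in> S \<Longrightarrow> a \<in> P \<Longrightarrow> (a, u) \<in> r \<Longrightarrow> fmem P r (n :: nat, x) f a \<Longrightarrow> fmem P r (n, y) f a \<Longrightarrow> x = y"
      and tot: "\<And>x a b. x \<in> S \<Longrightarrow> a \<in> P \<Longrightarrow> (a, u) \<in> r \<Longrightarrow> fmem P r x (S \<times> P) a \<Longrightarrow>
         \<exists>b\<in>P. (b, a) \<in> r \<and> (\<exists>n. fmem P r (n, x) f b)"
    proof -
      from fc obtain u f where u: "u \<in> P" "(u, q) \<in> r" and *:
        "fall (UNIV :: nat set) (\<lambda>n. fall S (\<lambda>x. fall S (\<lambda>y.
            fimp P r (fmem P r (n, x) f) (fimp P r (fmem P r (n, y) f) (\<lambda>_. x = y))))) u"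
        "fall S (\<lambda>x. fimp P r (fmem P r x (S \<times> P)) (fex P r (UNIV :: nat set) (\<lambda>n. fmem P r (n, x) f))) u"
        unfolding fcountable_def fex_def[of P r "Pow ((UNIV \<times> S) \<times> P)"] fand_def using q r(2) by blast
      show thesis
      proof (rule that[OF u])
        show "x = y" if "x \<in> S" "y \<in> S" "a \<in> P" "(a, u) \<in> r" "fmem P r (n, x) f a" "fmem P r (n, y) f a" for n x y a
          using *(1) that r(2) unfolding fall_def fimp_def by blast
        show "\<exists>b\<in>P. (b, a) \<in> r \<and> (\<exists>n. fmem P r (n, x) f b)"
          if "x \<in> S" "a \<in> P" "(a, u) \<in> r" "fmem P r x (S \<times> P) a" for x a
          using *(2) that r(2) unfolding fall_def fimp_def fex_def by blast
      qed
    qed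
    \<comment> \<open>The node \<open>t\<close> serves as a bound here: the condition fixes the
      value at \<open>n\<close> as a node no taller than \<open>t\<close>. A value of height above
      \<delta> will contradict this.\<close>
    define \<Phi> where "\<Phi> n a t \<longleftrightarrow> (\<exists>x\<in>S. ht x \<le> ht t \<and> fmem P r (n, x) f a)" for n a and t :: node
    define D where "D n = {(a, t). a \<in> P \<and> t \<in> S \<and>
      (\<Phi> n a t \<or> (\<forall>a'\<in>P. (a', a) \<in> r \<longrightarrow> (\<forall>t'\<in>S. t \<subseteq>\<^sub>m t' \<longrightarrow> \<not> \<Phi> n a' t')))}" for n
    have "dense_upward P r (D n)" for n
      unfolding D_def
      by (rule dense_upward_decide[OF r(2)]) (use sub_ht in \<open>auto simp: \<Phi>_def intro: order_trans\<close>)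
    then obtain q1 \<delta> where q1: "q1 \<in> P" "(q1, u) \<in> r" "\<And>n. generic_below P r (D n) q1 \<delta>"
      using gen[OF u(1), of "range D"] by auto
    obtain s0 where "s0 \<in> S" using uncountable_S by fastforce
    then obtain s where s: "s \<in> S" "\<delta> < ht s" using extension_above[of s0 "{\<delta>}"] by auto
    have "fmem P r s (S \<times> P) q1" unfolding fmem_def using s r(2) by blast
    then obtain a n where a: "a \<in> P" "(a, q1) \<in> r" "fmem P r (n, s) f a" using tot[OF s(1) q1(1,2)] by blast
    obtain a' s' w where w: "a' \<in> P" "s' \<in> S" "(a', s') \<in> D n" "s' \<subseteq>\<^sub>m s" "ht s' < \<delta>" "w \<in> P" "(w, a) \<in> r" "(w, a') \<in> r"
      using generic_belowE[OF q1(3)[of n] a(1,2) s(1) less_imp_le[OF s(2)]] .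
    have fw: "fmem P r (n, s) f w" using mono[OF a(3) w(7)] .
    have wu: "(w, u) \<in> r" using transD[OF r(1) w(7) transD[OF r(1) a(2) q1(2)]] .
    obtain s2 where s2: "s2 \<in> S" "s' \<subseteq>\<^sub>m s2" "ht s < ht s2" using extension_above[OF w(2), of "{ht s}"] by auto
    then have "\<Phi> n w s2" unfolding \<Phi>_def using s(1) fw less_imp_le by blast
    then have "\<Phi> n a' s'" using w(3,6,8) s2 unfolding D_def by blast
    then obtain x where 1: "x \<in> S" "ht x \<le> ht s'" "fmem P r (n, x) f a'" unfolding \<Phi>_def by blast
    have "x = s" using func[OF 1(1) s(1) w(6) wu mono[OF 1(3) w(8)] fw] .
    then show False using 1(2) w(5) s(2) by simp
  qed
  moreover have "fcountable P r S C q"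
    if q: "q \<in> P" and chain: "fall S (\<lambda>s. fall S (\<lambda>t. fimp P r (fmem P r s C) (fimp P r (fmem P r t C) (\<lambda>_. comparable s t)))) q"
    for C q
  proof (rule fcountable_of_bounded[OF r(1,2)])
    fix q' assume q': "q' \<in> P" "(q', q) \<in> r"
    \<comment> \<open>Incomparability with \<open>t\<close> passes to the extensions of
      \<open>t\<close> by \<open>comparable_below\<close>, so this property is upward
      closed.\<close>
    define \<Phi> where "\<Phi> a t \<longleftrightarrow> (\<exists>s'\<in>S. fmem P r s' C a \<and> \<not> comparable s' t)" for a t
    define D where "D = {(a, t). a \<in> P \<and> t \<in> S \<and>
      (\<Phi> a t \<or> (\<forall>a'\<in>P. (a', a) \<in> r \<longrightarrow> (\<forall>t'\<in>S. t \<subseteq>\<^sub>m t' \<longrightarrow> \<not> \<Phi> a' t')))}"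
    have "dense_upward P r D"
      unfolding D_def
    proof (rule dense_upward_decide[OF r(2)])
      show "\<Phi> a t" if "s \<in> S" "t \<in> S" "s \<subseteq>\<^sub>m t" "\<Phi> a s" for a s t
        using that comparable_below[OF that(2,1) _ that(3)] unfolding \<Phi>_def by blast
    qed
    from gen1[OF q'(1) this] obtain u \<delta> where u: "u \<in> P" "(u, q') \<in> r" "generic_below P r D u \<delta>" by blast
    have "ht s < \<delta>" if a: "a \<in> P" "(a, u) \<in> r" "s \<in> S" "fmem P r s C a" for a s
    proof (rule ccontr)
      assume "\<not> ht s < \<delta>"
      then have "\<delta> \<le> ht s" by simp
      obtain a' s1 w where w: "a' \<in> P" "s1 \<in> S" "(a', s1) \<in> D" "s1 \<subseteq>\<^sub>m s" "ht s1 < \<delta>" "w \<in> P" "(w, a) \<in> r" "(w, a') \<in> r"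
        using generic_belowE[OF u(3) a(1,2,3) \<open>\<delta> \<le> ht s\<close>] .
      have sw: "fmem P r s C w" using mono[OF a(4) w(7)] .
      have wq: "(w, q) \<in> r" using transD[OF r(1) w(7) transD[OF r(1) a(2) transD[OF r(1) u(2) q'(2)]]] .
      have "\<Phi> a' s1 \<or> (\<forall>b\<in>P. (b, a') \<in> r \<longrightarrow> (\<forall>t'\<in>S. s1 \<subseteq>\<^sub>m t' \<longrightarrow> \<not> \<Phi> b t'))"
        using w(3) unfolding D_def by simp
      then consider s' where "s' \<in> S" "fmem P r s' C a'" "\<not> comparable s' s1"
        | "\<forall>b\<in>P. (b, a') \<in> r \<longrightarrow> (\<forall>t'\<in>S. s1 \<subseteq>\<^sub>m t' \<longrightarrow> \<not> \<Phi> b t')"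
        using \<Phi>_def[of a' s1] by metis
      then show False
      proof cases
        case 1
        have "fmem P r s' C w" using mono[OF 1(2) w(8)] .
        then have "comparable s' s"
          using chain 1(1) a(3) sw wq w(6) r(2) unfolding fall_def fimp_def by blast
        then show False using comparable_below[OF a(3) w(2) 1(1) w(4)] 1(3) by blast
      next
        case 2
        \<comment> \<open>Still an extension of \<open>s1\<close>, but incomparable with
          \<open>s\<close>, which is forced into \<open>C\<close>; so the negative alternative
          fails.\<close>
        let ?t = "flip {ht s1} s"
        have t: "?t \<in> S" "s1 \<subseteq>\<^sub>m ?t" using flip_in[OF a(3)] sub_flip_ht[OF w(2,4)] by auto
        then have "comparable s ?t" using 2 w(6,8) a(3) sw unfolding \<Phi>_def by blast
        then have "s = ?t" using sub_eq[OF a(3) t(1)] sub_eq[OF t(1) a(3)] unfolding comparable_iff by auto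
        then have "s (ht s1) = map_option Not (s (ht s1))" unfolding flip_def by (metis singletonI)
        moreover have "s (ht s1) \<noteq> None" using node_Some_iff[OF a(3), of "ht s1"] less_le_trans[OF w(5) \<open>\<delta> \<le> ht s\<close>] by simp
        ultimately show False by (cases "s (ht s1)") auto
      qed
    qed
    then show "\<exists>u\<in>P. (u, q') \<in> r \<and> (\<exists>\<delta>. \<forall>a\<in>P. (a, u) \<in> r \<longrightarrow> (\<forall>s\<in>S. fmem P r s C a \<longrightarrow> ht s < \<delta>))"
      using u by blast
  qed
  moreover have "fcountable P r S A q"
    if q: "q \<in> P" and anti: "fall S (\<lambda>s. fall S (\<lambda>t. fimp P r (fmem P r s A) (fimp P r (fmem P r t A)
       (\<lambda>_. comparable s t \<longrightarrow> s = t)))) q"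
    for A q
  proof (rule fcountable_of_bounded[OF r(1,2)])
    fix q' assume q': "q' \<in> P" "(q', q) \<in> r"
    define \<Phi> where "\<Phi> a t \<longleftrightarrow> (\<exists>s'\<in>S. fmem P r s' A a \<and> s' \<subseteq>\<^sub>m t)" for a t
    define D where "D = {(a, t). a \<in> P \<and> t \<in> S \<and>
      (\<Phi> a t \<or> (\<forall>a'\<in>P. (a', a) \<in> r \<longrightarrow> (\<forall>t'\<in>S. t \<subseteq>\<^sub>m t' \<longrightarrow> \<not> \<Phi> a' t')))}"
    have "dense_upward P r D"
      unfolding D_def
    proof (rule dense_upward_decide[OF r(2)])
      show "\<Phi> a t" if "s \<subseteq>\<^sub>m t" "\<Phi> a s" for a s t
        using that map_le_trans unfolding \<Phi>_def by blast
    qed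
    from gen1[OF q'(1) this] obtain u \<delta> where u: "u \<in> P" "(u, q') \<in> r" "generic_below P r D u \<delta>" by blast
    have "ht s < \<delta>" if a: "a \<in> P" "(a, u) \<in> r" "s \<in> S" "fmem P r s A a" for a s
    proof (rule ccontr)
      assume "\<not> ht s < \<delta>"
      then have "\<delta> \<le> ht s" by simp
      obtain a' s1 w where w: "a' \<in> P" "s1 \<in> S" "(a', s1) \<in> D" "s1 \<subseteq>\<^sub>m s" "ht s1 < \<delta>" "w \<in> P" "(w, a) \<in> r" "(w, a') \<in> r"
        using generic_belowE[OF u(3) a(1,2,3) \<open>\<delta> \<le> ht s\<close>] .
      have sw: "fmem P r s A w" using mono[OF a(4) w(7)] .
      have wq: "(w, q) \<in> r" using transD[OF r(1) w(7) transD[OF r(1) a(2) transD[OF r(1) u(2) q'(2)]]] .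
      have "\<Phi> w s" unfolding \<Phi>_def using sw a(3) map_le_refl by blast
      then have "\<Phi> a' s1" using w(3,4,6,8) a(3) unfolding D_def by blast
      then obtain s' where 1: "s' \<in> S" "fmem P r s' A a'" "s' \<subseteq>\<^sub>m s1" unfolding \<Phi>_def by blast
      have "s' \<subseteq>\<^sub>m s" using 1(3) w(4) map_le_trans by blast
      then have "comparable s' s" by (simp add: comparable_iff)
      moreover have "fmem P r s' A w" using mono[OF 1(2) w(8)] .
      ultimately have "s' = s"
        using anti 1(1) a(3) sw wq w(6) r(2) unfolding fall_def fimp_def by blast
      then show False using sub_ht[OF 1(1) w(2) 1(3)] w(5) \<open>\<delta> \<le> ht s\<close> by simp
    qed
    then show "\<exists>u\<in>P. (u, q') \<in> r \<and> (\<exists>\<delta>. \<forall>a\<in>P. (a, u) \<in> r \<longrightarrow> (\<forall>s\<in>S. fmem P r s A a \<longrightarrow> ht s < \<delta>))"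
      using u by blast
  qed
  ultimately show ?thesis
    unfolding forces_suslin_def fsuslin_def fand_def fall_def[of "Pow (S \<times> P)"] fimp_def[of P r "fall _ _"] by blast
qed

end

section \<open>Properness from closure operators\<close>

definition definable :: "((nat \<Rightarrow> 'q hset) \<Rightarrow> bool) \<Rightarrow> bool" where
  "definable R \<longleftrightarrow> (\<exists>\<phi>. \<forall>v. sat UNIV hmem \<phi> v = R v)"

lemma definable_mem: "definable (\<lambda>v. hmem (v i) (v j))"
  unfolding definable_def by (rule exI[of _ "Mem i j"]) simp

lemma definable_eq: "definable (\<lambda>v. v i = v j)"
  unfolding definable_def by (rule exI[of _ "Eq i j"]) simp

lemma definable_not:
  assumes "definable R"
  shows "definable (\<lambda>v. \<not> R v)"
proof -
  obtain \<phi> where "\<forall>v. sat UNIV hmem \<phi> v = R v" using assms unfolding definable_def ..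
  then have "\<forall>v. sat UNIV hmem (Neg \<phi>) v = (\<not> R v)" by simp
  then show ?thesis unfolding definable_def ..
qed

lemma definable_conj:
  assumes "definable R" "definable Q"
  shows "definable (\<lambda>v. R v \<and> Q v)"
proof -
  obtain \<phi> where "\<forall>v. sat UNIV hmem \<phi> v = R v" using assms(1) unfolding definable_def ..
  moreover obtain \<psi> where "\<forall>v. sat UNIV hmem \<psi> v = Q v" using assms(2) unfolding definable_def ..
  ultimately have "\<forall>v. sat UNIV hmem (Conj \<phi> \<psi>) v = (R v \<and> Q v)" by simp
  then show ?thesis unfolding definable_def ..
qed

lemma definable_disj:
  assumes "definable R" "definable Q"
  shows "definable (\<lambda>v. R v \<or> Q v)"
proof -
  have "definable (\<lambda>v. \<not> (\<not> R v \<and> \<not> Q v))"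
    by (rule definable_not, rule definable_conj; rule definable_not, rule assms)
  then show ?thesis by simp
qed

lemma definable_imp:
  assumes "definable R" "definable Q"
  shows "definable (\<lambda>v. R v \<longrightarrow> Q v)"
proof -
  have "definable (\<lambda>v. \<not> R v \<or> Q v)"
    by (rule definable_disj, rule definable_not) (rule assms)+
  then show ?thesis by (simp only: imp_conv_disj)
qed

lemma definable_iff:
  assumes "definable R" "definable Q"
  shows "definable (\<lambda>v. R v \<longleftrightarrow> Q v)"
proof -
  have "definable (\<lambda>v. (R v \<longrightarrow> Q v) \<and> (Q v \<longrightarrow> R v))"
    by (rule definable_conj; rule definable_imp; rule assms)
  moreover have "(\<lambda>v. R v \<longleftrightarrow> Q v) = (\<lambda>v. (R v \<longrightarrow> Q v) \<and> (Q v \<longrightarrow> R v))" by (rule ext) blast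
  ultimately show ?thesis by (simp only:)
qed

lemma definable_upd_ex:
  assumes "definable R"
  shows "definable (\<lambda>v. \<exists>x. R (v(i := x)))"
proof -
  obtain \<phi> where "\<forall>v. sat UNIV hmem \<phi> v = R v" using assms unfolding definable_def ..
  then have "\<forall>v. sat UNIV hmem (Ex i \<phi>) v = (\<exists>x. R (v(i := x)))" by simp
  then show ?thesis unfolding definable_def ..
qed

text \<open>The variable \<open>m\<close> has to be fresh for \<open>Q\<close>.\<close>

lemma definable_ex:
  assumes "definable (\<lambda>v. Q v (v m))" "\<And>v x y. Q (v(m := x)) y = Q v y"
  shows "definable (\<lambda>v. \<exists>x. Q v x)"
  using definable_upd_ex[OF assms(1), of m] by (simp add: assms(2))

lemma definable_all:
  assumes "definable (\<lambda>v. Q v (v m))" "\<And>v x y. Q (v(m := x)) y = Q v y"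
  shows "definable (\<lambda>v. \<forall>x. Q v x)"
proof -
  have "definable (\<lambda>v. \<exists>x. \<not> Q v x)"
    by (rule definable_ex[where m = m]) (use assms in \<open>auto intro: definable_not\<close>)
  from definable_not[OF this] show ?thesis by simp
qed

lemmas definable_intros =
  definable_conj definable_disj definable_imp definable_iff definable_not definable_mem definable_eq

text \<open>\<open>T I\<close> puts existential quantifiers over the variables in \<open>I\<close>
  in front of \<open>R\<close>; elementarity then supplies the witnesses one variable at a
  time.\<close>

lemma elementary_reflect:
  assumes M: "elementary_submodel M" and R: "definable R" and v: "range v \<subseteq> M"
    and w: "R w" "\<And>i. i \<notin> set I \<Longrightarrow> w i = v i"
  shows "\<exists>w. range w \<subseteq> M \<and> (\<forall>i. i \<notin> set I \<longrightarrow> w i = v i) \<and> R w"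
proof -
  define T where "T I v \<longleftrightarrow> (\<exists>w. (\<forall>i. i \<notin> set I \<longrightarrow> w i = v i) \<and> R w)" for I v
  have T_Nil: "T [] v = R v" for v
  proof -
    have "(\<forall>i. i \<notin> set [] \<longrightarrow> w i = v i) \<longleftrightarrow> w = v" for w by (simp add: fun_eq_iff)
    then show ?thesis unfolding T_def by simp
  qed
  have T_Cons: "T (j # I) v = (\<exists>x. T I (v(j := x)))" for j I v
  proof
    assume "T (j # I) v"
    then obtain w where "\<forall>i. i \<notin> set (j # I) \<longrightarrow> w i = v i" "R w" unfolding T_def by blast
    then have "T I (v(j := w j))" unfolding T_def by (intro exI[of _ w]) auto
    then show "\<exists>x. T I (v(j := x))" ..
  next
    assume "\<exists>x. T I (v(j := x))"
    then obtain x w where "\<forall>i. i \<notin> set I \<longrightarrow> w i = (v(j := x)) i" "R w" unfolding T_def by blast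
    then show "T (j # I) v" unfolding T_def by (intro exI[of _ w]) auto
  qed
  have def: "definable (T I)" for I
  proof (induction I)
    case Nil
    then show ?case using R T_Nil by (simp add: ext)
  next
    case (Cons j I)
    have "T (j # I) = (\<lambda>v. \<exists>x. T I (v(j := x)))" by (rule ext) (rule T_Cons)
    then show ?case using definable_upd_ex[OF Cons.IH, of j] by (simp only:)
  qed
  have main: "\<exists>w. range w \<subseteq> M \<and> (\<forall>i. i \<notin> set I \<longrightarrow> w i = v i) \<and> R w" if "range v \<subseteq> M" "T I v" for I v
    using that
  proof (induction I arbitrary: v)
    case Nil
    then show ?case by (intro exI[of _ v]) (simp add: T_Nil)
  next
    case (Cons j I)
    from def[of I] obtain \<phi> where \<phi>: "\<And>v. sat UNIV hmem \<phi> v = T I v" unfolding definable_def by blast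
    have "sat UNIV hmem (Ex j \<phi>) v" using Cons.prems(2) \<phi> T_Cons by simp
    then have "sat M hmem (Ex j \<phi>) v" using M Cons.prems(1) unfolding elementary_submodel_def by blast
    then obtain x where x: "x \<in> M" "sat M hmem \<phi> (v(j := x))" by auto
    have vM: "range (v(j := x)) \<subseteq> M" using Cons.prems(1) x(1) by auto
    then have "T I (v(j := x))" using x(2) M \<phi> unfolding elementary_submodel_def by blast
    from Cons.IH[OF vM this] obtain w where "range w \<subseteq> M" "\<forall>i. i \<notin> set I \<longrightarrow> w i = (v(j := x)) i" "R w" by blast
    then show ?case by (intro exI[of _ w]) auto
  qed
  have "T I v" unfolding T_def using w by blast
  from main[OF v this] show ?thesis .
qed

section \<open>Pairs, ordinals and first-order properties in H(\<theta>)\<close>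

lemma countable_ordLeq:
  assumes "countable A" "infinite (UNIV :: 'q set)"
  shows "|A| \<le>o |UNIV :: 'q set|"
  using assms by (meson countable_card_le_natLeq infinite_iff_natLeq_ordLeq ordLeq_transitive)

lemma hmem_doubleton:
  assumes "infinite (UNIV :: 'q set)"
  shows "hmem z (hset_of {x, y :: 'q hset}) \<longleftrightarrow> z = x \<or> z = y"
proof -
  have "|{x, y}| \<le>o |UNIV :: 'q set|"
    by (rule countable_ordLeq[OF _ assms]) simp
  then show ?thesis by (simp add: hmem_hset_of)
qed

lemma hset_of_pair_eq:
  assumes "infinite (UNIV :: 'q set)"
  shows "k = hset_of {x, y :: 'q hset} \<longleftrightarrow> (\<forall>z. hmem z k \<longleftrightarrow> z = x \<or> z = y)"
  using hmem_doubleton[OF assms] hset_extensional by metis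

lemma hpair_eq_iff:
  assumes "infinite (UNIV :: 'q set)"
  shows "hpair x y = hpair x' (y' :: 'q hset) \<longleftrightarrow> x = x' \<and> y = y'"
proof -
  have *: "hset_of {a, b} = hset_of {a', b'} \<longleftrightarrow> {a, b} = {a', b'}" for a b a' b' :: "'q hset"
    using hmem_doubleton[OF assms] by (metis doubleton_eq_iff)
  have **: "hset_of {a} = hset_of {a', b'} \<longleftrightarrow> {a} = {a', b'}" "hset_of {a} = hset_of {a'} \<longleftrightarrow> a = a'" for a b a' b' :: "'q hset"
    using *[of a a a' b'] *[of a a a' a'] by auto
  show ?thesis unfolding hpair_def * by (auto simp: doubleton_eq_iff ** * dest: sym)
qed

lemma definable_doubleton:
  assumes "infinite (UNIV :: 'q set)"
  shows "definable (\<lambda>v :: nat \<Rightarrow> 'q hset. v k = hset_of {v i, v j})"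
  unfolding hset_of_pair_eq[OF assms]
  by (rule definable_all[where m = "Suc (i + j + k)"]) (auto intro!: definable_intros)

lemma definable_hpair:
  assumes "infinite (UNIV :: 'q set)"
  shows "definable (\<lambda>v :: nat \<Rightarrow> 'q hset. v k = hpair (v i) (v j))"
proof -
  have eq: "z = hpair x y \<longleftrightarrow> (\<exists>a b. a = hset_of {x, x} \<and> b = hset_of {x, y} \<and> z = hset_of {a, b})" for x y z :: "'q hset"
    by (simp add: hpair_def)
  show ?thesis
    unfolding eq
    apply (rule definable_ex[where m = "Suc (i + j + k)"])
     apply (rule definable_ex[where m = "Suc (Suc (i + j + k))"])
      apply (intro definable_conj definable_doubleton[OF assms])
     apply auto
    done
qed

lemma definable_in_rel:
  assumes "infinite (UNIV :: 'q set)"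
  shows "definable (\<lambda>v :: nat \<Rightarrow> 'q hset. hmem (hpair (v i) (v j)) (v k))"
proof -
  have "definable (\<lambda>v :: nat \<Rightarrow> 'q hset. \<exists>z. z = hpair (v i) (v j) \<and> hmem z (v k))"
    by (rule definable_ex[where m = "Suc (i + j + k)"])
       (auto intro!: definable_conj definable_mem definable_hpair[OF assms])
  then show ?thesis by simp
qed

lemma wf_hmem: "wf {(x, y :: 'q hset). hmem x y}"
proof (rule wfUNIVI)
  fix Pr :: "'q hset \<Rightarrow> bool" and x
  assume *: "\<forall>x. (\<forall>y. (y, x) \<in> {(x, y). hmem x y} \<longrightarrow> Pr y) \<longrightarrow> Pr x"
  have "Pr (abs_hset c)" for c
  proof (induction c rule: hcode_induct)
    case (HCode f)
    have "Pr y" if "hmem y (abs_hset (HCode f))" for y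
      using that HCode unfolding hmem_abs_HCode by blast
    then show ?case using *[rule_format, of "abs_hset (HCode f)"] by simp
  qed
  then show "Pr x" by (metis Quotient3_abs_rep Quotient3_hset)
qed

lemma hmem_irrefl: "\<not> hmem x x"
  using wf_hmem wf_not_refl by fastforce

text \<open>The Mostowski collapse of a well-order of the type onto von Neumann ordinals;
  injectivity is irreflexivity of \<open>hmem\<close>.\<close>

lemma inj_into_hset: "\<exists>e :: 'q \<Rightarrow> 'q hset. inj e"
proof -
  obtain r where r: "well_order_on (UNIV :: 'q set) r" using well_order_on by blast
  then have wf: "wf (r - Id)" and tot: "total_on UNIV r" unfolding well_order_on_def linear_order_on_def by auto
  have "\<exists>e :: 'q \<Rightarrow> 'q hset. \<forall>x. e x = hset_of (e ` {y. (y, x) \<in> r - Id})"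
  proof (rule dependent_wf_choice[OF wf])
    fix f g :: "'q \<Rightarrow> 'q hset" and x z
    assume "\<And>y. (y, x) \<in> r - Id \<Longrightarrow> f y = g y"
    then have "f ` {y. (y, x) \<in> r - Id} = g ` {y. (y, x) \<in> r - Id}" by (intro image_cong) auto
    then show "(z = hset_of (f ` {y. (y, x) \<in> r - Id})) = (z = hset_of (g ` {y. (y, x) \<in> r - Id}))" by simp
  qed blast
  then obtain e :: "'q \<Rightarrow> 'q hset" where e: "\<And>x. e x = hset_of (e ` {y. (y, x) \<in> r - Id})" by blast
  have mem: "hmem z (e x) \<longleftrightarrow> (\<exists>y. (y, x) \<in> r - Id \<and> z = e y)" for z x
  proof -
    have "|e ` {y. (y, x) \<in> r - Id}| \<le>o |UNIV :: 'q set|"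
      by (meson card_of_image card_of_mono1 ordLeq_transitive subset_UNIV)
    then show ?thesis by (subst e) (auto simp: hmem_hset_of)
  qed
  have "inj e"
  proof (rule injI, rule ccontr)
    fix x y assume "e x = e y" "x \<noteq> y"
    then have "(x, y) \<in> r - Id \<or> (y, x) \<in> r - Id" using tot unfolding total_on_def by blast
    then have "hmem (e x) (e y) \<or> hmem (e y) (e x)" using mem by blast
    then show False using \<open>e x = e y\<close> hmem_irrefl by metis
  qed
  then show ?thesis by blast
qed

definition dense_h :: "'q hset \<Rightarrow> 'q hset \<Rightarrow> 'q hset \<Rightarrow> bool" where
  "dense_h P R D \<longleftrightarrow> (\<forall>d. hmem d D \<longrightarrow> hmem d P) \<and>
     (\<forall>p. hmem p P \<longrightarrow> (\<exists>d. hmem d D \<and> hmem (hpair d p) R))"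

text \<open>Existence of generic conditions as in \<open>proper\<close>, but with \<open>X\<close>,
  the poset and the dense sets all being elements of H(\<theta>), so that the statement can be
  reflected.\<close>

definition good_h :: "'q hset \<Rightarrow> 'q hset \<Rightarrow> 'q hset \<Rightarrow> bool" where
  "good_h X P R \<longleftrightarrow> (\<forall>p. hmem p X \<and> hmem p P \<longrightarrow> (\<exists>q. hmem q P \<and> hmem (hpair q p) R \<and>
     (\<forall>D. hmem D X \<and> dense_h P R D \<longrightarrow> (\<forall>q'. hmem q' P \<and> hmem (hpair q' q) R \<longrightarrow>
       (\<exists>d. hmem d D \<and> hmem d X \<and> (\<exists>u. hmem u P \<and> hmem (hpair u d) R \<and> hmem (hpair u q') R))))))"

definition closed_h :: "'q hset \<Rightarrow> bool" where
  "closed_h X \<longleftrightarrow> (\<forall>g x. hmem g X \<and> hmem x X \<longrightarrow> (\<exists>z. hmem (hpair x z) g) \<longrightarrow> (\<exists>z. hmem z X \<and> hmem (hpair x z) g))"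

text \<open>Injectivity of \<open>f\<close> is demanded on \<open>X\<close> only. With
  \<open>w\<close> countable this makes \<open>X\<close> countable; conversely a countable
  \<open>X\<close> embeds into any infinite \<open>w\<close>, so the reflected \<open>w\<close> may
  be arbitrary among the infinite ones.\<close>

definition embeds_h :: "'q hset \<Rightarrow> 'q hset \<Rightarrow> 'q hset \<Rightarrow> bool" where
  "embeds_h f X w \<longleftrightarrow> (\<forall>x. hmem x X \<longrightarrow> (\<exists>n. hmem n w \<and> hmem (hpair x n) f \<and> (\<forall>y. hmem y X \<and> hmem (hpair y n) f \<longrightarrow> y = x)))"

text \<open>By well-foundedness of \<^const>\<open>hmem\<close>, such a set is infinite.\<close>

definition infinite_h :: "'q hset \<Rightarrow> bool" where
  "infinite_h w \<longleftrightarrow> (\<exists>x. hmem x w) \<and> (\<forall>x. hmem x w \<longrightarrow> (\<exists>y. hmem y w \<and> hmem x y))"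

text \<open>
  The first-order property of the poset \<open>(v 1, v 2)\<close> and the parameters \<open>v 3, \<dots>, v 8\<close>
  that is reflected in the submodel.
\<close>

definition club_h :: "(nat \<Rightarrow> 'q hset) \<Rightarrow> bool" where
  "club_h v \<longleftrightarrow> infinite_h (v 3) \<and>
    (\<forall>X. \<forall>f. hmem (v 4) X \<and> hmem (v 5) X \<and> hmem (v 6) X \<and> hmem (v 7) X \<and> hmem (v 8) X \<and>
       closed_h X \<and> embeds_h f X (v 3) \<longrightarrow> good_h X (v 1) (v 2))"

text \<open>The number 20 keeps the free indices apart from the bound variables 20 and 21.\<close>

lemma definable_dense_h:
  assumes "infinite (UNIV :: 'q set)" "i < 20" "j < 20" "k < 20"
  shows "definable (\<lambda>v :: nat \<Rightarrow> 'q hset. dense_h (v i) (v j) (v k))"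
  unfolding dense_h_def
  apply (rule definable_conj)
   apply (rule definable_all[where m = 20])
    apply (intro definable_intros)
  using assms(2-4) apply simp
  apply (rule definable_all[where m = 20])
   apply (rule definable_imp, rule definable_mem)
   apply (rule definable_ex[where m = 21])
    apply (intro definable_intros definable_in_rel[OF assms(1)])
  using assms(2-4) by simp_all

lemma definable_good_h:
  assumes "infinite (UNIV :: 'q set)"
  shows "definable (\<lambda>v :: nat \<Rightarrow> 'q hset. good_h (v 9) (v 1) (v 2))"
  unfolding good_h_def
  apply (rule definable_all[where m = 11])
   apply (rule definable_imp, intro definable_intros)
   apply (rule definable_ex[where m = 12])
    apply (rule definable_conj, rule definable_mem, rule definable_conj, rule definable_in_rel[OF assms])
    apply (rule definable_all[where m = 13])
     apply (rule definable_imp, rule definable_conj, rule definable_mem, rule definable_dense_h[OF assms])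
        apply (simp, simp, simp)
     apply (rule definable_all[where m = 14])
      apply (rule definable_imp, rule definable_conj, rule definable_mem, rule definable_in_rel[OF assms])
      apply (rule definable_ex[where m = 15])
       apply (rule definable_conj, rule definable_mem, rule definable_conj, rule definable_mem)
       apply (rule definable_ex[where m = 16])
        apply (intro definable_intros definable_in_rel[OF assms])
       apply simp_all
  done

lemma definable_closed_h:
  assumes "infinite (UNIV :: 'q set)"
  shows "definable (\<lambda>v :: nat \<Rightarrow> 'q hset. closed_h (v 9))"
  unfolding closed_h_def
  apply (rule definable_all[where m = 11])
   apply (rule definable_all[where m = 12])
    apply (rule definable_imp, intro definable_intros)
    apply (rule definable_imp)
     apply (rule definable_ex[where m = 13])
      apply (rule definable_in_rel[OF assms])
     apply simp
    apply (rule definable_ex[where m = 13])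
     apply (intro definable_intros definable_in_rel[OF assms])
    apply simp_all
  done

lemma definable_embeds_h:
  assumes "infinite (UNIV :: 'q set)"
  shows "definable (\<lambda>v :: nat \<Rightarrow> 'q hset. embeds_h (v 10) (v 9) (v 3))"
  unfolding embeds_h_def
  apply (rule definable_all[where m = 11])
   apply (rule definable_imp, rule definable_mem)
   apply (rule definable_ex[where m = 12])
    apply (rule definable_conj, rule definable_mem, rule definable_conj, rule definable_in_rel[OF assms])
    apply (rule definable_all[where m = 13])
     apply (intro definable_intros definable_in_rel[OF assms])
    apply simp_all
  done

lemma definable_infinite_h: "definable (\<lambda>v. infinite_h (v 3))"
  unfolding infinite_h_def
  apply (rule definable_conj)
   apply (rule definable_ex[where m = 11])
    apply (rule definable_mem)
   apply simp
  apply (rule definable_all[where m = 11])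
   apply (rule definable_imp, rule definable_mem)
   apply (rule definable_ex[where m = 12])
    apply (intro definable_intros)
   apply simp_all
  done

lemma definable_club_h:
  assumes "infinite (UNIV :: 'q set)"
  shows "definable (\<lambda>v :: nat \<Rightarrow> 'q hset. v 0 = hpair (v 1) (v 2) \<and> club_h v)"
  unfolding club_h_def
  apply (rule definable_conj, rule definable_hpair[OF assms])
  apply (rule definable_conj, rule definable_infinite_h)
  apply (rule definable_all[where m = 9])
   apply (rule definable_all[where m = 10])
    apply (rule definable_imp)
     apply (intro definable_conj definable_mem definable_closed_h[OF assms] definable_embeds_h[OF assms])
    apply (rule definable_good_h[OF assms])
   apply simp_all
  done

lemma infinite_hI:
  assumes "infinite_h w"
  shows "infinite {x. hmem x w}"
proof
  let ?A = "{x. hmem x w}"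
  assume fin: "finite ?A"
  have "wf ({(x, y). hmem x y}\<inverse> \<inter> ?A \<times> ?A)"
  proof (rule finite_acyclic_wf)
    show "finite ({(x, y). hmem x y}\<inverse> \<inter> ?A \<times> ?A)" using fin by auto
    have "acyclic ({(x, y). hmem x y}\<inverse>)" using wf_acyclic[OF wf_hmem] by simp
    then show "acyclic ({(x, y). hmem x y}\<inverse> \<inter> ?A \<times> ?A)" by (rule acyclic_subset) auto
  qed
  moreover have "?A \<noteq> {}" using assms unfolding infinite_h_def by auto
  ultimately obtain x where "x \<in> ?A" "\<And>y. (y, x) \<in> {(x, y). hmem x y}\<inverse> \<inter> ?A \<times> ?A \<Longrightarrow> y \<notin> ?A"
    by (metis (no_types, lifting) wfE_min ex_in_conv)
  then show False using assms unfolding infinite_h_def by auto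
qed

text \<open>The Zermelo numerals: each is the only element of the next.\<close>

lemma infinite_h_exists:
  assumes "infinite (UNIV :: 'q set)"
  obtains w :: "'q hset" where "infinite_h w" "countable {x. hmem x w}"
proof -
  define num where "num = rec_nat (hset_of {}) (\<lambda>_ x :: 'q hset. hset_of {x, x})"
  define w where "w = hset_of (range num)"
  have w: "hmem x w \<longleftrightarrow> x \<in> range num" for x
    unfolding w_def by (rule hmem_hset_of, rule countable_ordLeq[OF _ assms]) simp
  have "hmem (num n) (num (Suc n))" for n
    unfolding num_def by (simp only: nat.rec hmem_doubleton[OF assms] simp_thms)
  then have "infinite_h w" unfolding infinite_h_def w by blast
  moreover have "countable {x. hmem x w}" unfolding w by simp
  ultimately show ?thesis using that by blast
qed

text \<open>Repetitions leave the length of a list free once its set is fixed, so the length can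
  carry a number.\<close>

lemma list_with_set:
  assumes "finite u" "u \<noteq> {}" "card u \<le> m"
  obtains xs where "set xs = u" "length xs = m"
proof -
  obtain ys where ys: "set ys = u" "distinct ys" using finite_distinct_list[OF assms(1)] by blast
  have "length ys = card u" using ys distinct_card by metis
  have "hd ys \<in> u" using ys assms(2) by (metis hd_in_set set_empty)
  then have "set (ys @ replicate (m - card u) (hd ys)) = u" using ys by (auto simp: set_replicate_conv_if)
  moreover have "length (ys @ replicate (m - card u) (hd ys)) = m" using \<open>length ys = card u\<close> assms(3) by simp
  ultimately show ?thesis using that by blast
qed

lemma hmem_hset_of_image:
  fixes f :: "'a \<Rightarrow> 'q hset"
  assumes "|A| \<le>o |UNIV :: 'q set|"
  shows "hmem z (hset_of (f ` A)) \<longleftrightarrow> z \<in> f ` A"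
  by (rule hmem_hset_of) (meson assms card_of_image ordLeq_transitive)

text \<open>
  Properness follows from the existence of a finitary closure operator \<open>cl\<close> on some type such that
  every countable closed set \<open>X\<close> has generic conditions; \<open>a p\<close> and \<open>b D\<close> represent a condition and
  a set of conditions in that type.  The operator is turned into the parameters of \<^const>\<open>club_h\<close>.
\<close>

theorem properI:
  fixes P :: "'p set" and r :: "'p rel" and cl :: "'z set \<Rightarrow> 'z set" and a :: "'p \<Rightarrow> 'z"
    and b :: "'p set \<Rightarrow> 'z" and k :: "'z list \<Rightarrow> 'p set"
  assumes inf: "infinite (UNIV :: 'p set)" and r: "r \<subseteq> P \<times> P" and k: "inj k"
    and inj_a: "inj_on a P"
    and cl: "\<And>u. finite u \<Longrightarrow> countable (cl u)"
    and gen: "\<And>X p. countable X \<Longrightarrow> (\<And>u. finite u \<Longrightarrow> u \<subseteq> X \<Longrightarrow> cl u \<subseteq> X) \<Longrightarrow> p \<in> P \<Longrightarrow> a p \<in> X \<Longrightarrow>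
      \<exists>q\<in>P. (q, p) \<in> r \<and> (\<forall>D. dense_in P r D \<longrightarrow> b D \<in> X \<longrightarrow>
        (\<forall>q'\<in>P. (q', q) \<in> r \<longrightarrow> (\<exists>d\<in>D. a d \<in> X \<and> compatible P r d q')))"
  shows "proper P r"
  unfolding proper_def
proof (intro allI impI ballI)
  fix e :: "'p \<Rightarrow> 'p set hset" and M p
  assume e: "inj_on e P" and M: "countable M" "elementary_submodel M" and code: "poset_code e P r \<in> M"
    and p: "p \<in> P" "e p \<in> M"
  have inf': "infinite (UNIV :: 'p set set)" using inf by (simp add: Finite_Set.finite_set)
  note hpair_eq = hpair_eq_iff[OF inf']
  obtain e0 :: "'p set \<Rightarrow> 'p set hset" where e0: "inj e0" using inj_into_hset by blast
  \<comment> \<open>Lists over \<open>'z\<close> become elements of H(\<theta>); a finite subset of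
    a closed set is handled through a list of its members.\<close>
  define \<iota> where "\<iota> xs = e0 (k xs)" for xs
  have \<iota>: "\<iota> xs = \<iota> ys \<longleftrightarrow> xs = ys" for xs ys unfolding \<iota>_def using e0 k by (auto simp: inj_def)
  have card_z: "|UNIV :: 'z list set| \<le>o |UNIV :: 'p set set|" using k card_of_ordLeq by blast
  have card_p: "|A| \<le>o |UNIV :: 'p set set|" for A :: "'p set"
    using card_of_Pow[of "UNIV :: 'p set"] by (metis Pow_UNIV card_of_mono1 ordLeq_ordLess_trans ordLess_imp_ordLeq subset_UNIV)
  have card_pp: "|A| \<le>o |UNIV :: 'p set set|" for A :: "'p set set"
    by (rule card_of_mono1) simp
  have card_r: "|r| \<le>o |UNIV :: 'p set set|"
  proof -
    have "|UNIV \<times> UNIV :: ('p \<times> 'p) set| =o |UNIV :: 'p set|" using card_of_Times_same_infinite[OF inf] .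
    then have "|r| \<le>o |UNIV :: 'p set|" by (metis UNIV_Times_UNIV card_of_mono1 ordLeq_ordIso_trans subset_UNIV)
    then show ?thesis using card_p ordLeq_transitive by blast
  qed
  \<comment> \<open>A list stands for a finite set together with an index stored in its length;
    varying the index runs through the closure of the set. \<open>cl {}\<close> is included because
    only nonempty lists are built from elements of \<open>Z\<close>.\<close>
  define g where "g xs = from_nat_into (cl {} \<union> cl (set xs)) (fst (prod_decode (length xs)))" for xs
  \<comment> \<open>Concatenation in curried form, so that closure under functions of one argument
    suffices to build all nonempty lists.\<close>
  define A where "A xs = hset_of (range (\<lambda>ys. hpair (\<iota> ys) (\<iota> (xs @ ys))))" for xs
  have A: "hmem z (A xs) \<longleftrightarrow> (\<exists>ys. z = hpair (\<iota> ys) (\<iota> (xs @ ys)))" for z xs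
    unfolding A_def hmem_hset_of_image[OF card_z] by auto
  define G1 where "G1 = hset_of (range (\<lambda>xs. hpair (\<iota> xs) (A xs)))"
  have G1: "hmem z G1 \<longleftrightarrow> (\<exists>xs. z = hpair (\<iota> xs) (A xs))" for z
    unfolding G1_def hmem_hset_of_image[OF card_z] by auto
  define G2 where "G2 = hset_of (range (\<lambda>xs. hpair (\<iota> xs) (\<iota> [g xs])))"
  have G2: "hmem z G2 \<longleftrightarrow> (\<exists>xs. z = hpair (\<iota> xs) (\<iota> [g xs]))" for z
    unfolding G2_def hmem_hset_of_image[OF card_z] by auto
  \<comment> \<open>\<open>G3\<close> and \<open>G4\<close> translate conditions into
    \<open>'z\<close> and back; \<open>G5\<close> translates sets of conditions into
    \<open>'z\<close>.\<close>
  define G3 where "G3 = hset_of ((\<lambda>p. hpair (e p) (\<iota> [a p])) ` P)"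
  have G3: "hmem z G3 \<longleftrightarrow> (\<exists>p\<in>P. z = hpair (e p) (\<iota> [a p]))" for z
    unfolding G3_def hmem_hset_of_image[OF card_p] by auto
  define G4 where "G4 = hset_of ((\<lambda>p. hpair (\<iota> [a p]) (e p)) ` P)"
  have G4: "hmem z G4 \<longleftrightarrow> (\<exists>p\<in>P. z = hpair (\<iota> [a p]) (e p))" for z
    unfolding G4_def hmem_hset_of_image[OF card_p] by auto
  define G5 where "G5 = hset_of ((\<lambda>D. hpair (hset_of (e ` D)) (\<iota> [b D])) ` Pow P)"
  have G5: "hmem z G5 \<longleftrightarrow> (\<exists>D\<subseteq>P. z = hpair (hset_of (e ` D)) (\<iota> [b D]))" for z
    unfolding G5_def hmem_hset_of_image[OF card_pp] by auto
  define Ph where "Ph = hset_of (e ` P)"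
  have Ph: "hmem z Ph \<longleftrightarrow> z \<in> e ` P" for z unfolding Ph_def by (rule hmem_hset_of_image[OF card_p])
  define Rh where "Rh = hset_of ((\<lambda>(p, q). hpair (e p) (e q)) ` r)"
  have Rh: "hmem z Rh \<longleftrightarrow> z \<in> (\<lambda>(p, q). hpair (e p) (e q)) ` r" for z
    unfolding Rh_def by (rule hmem_hset_of_image[OF card_r])
  have Rh': "hmem (hpair (e x) (e y)) Rh \<longleftrightarrow> (x, y) \<in> r" if "x \<in> P" "y \<in> P" for x y
  proof
    assume "hmem (hpair (e x) (e y)) Rh"
    then obtain x' y' where xy': "(x', y') \<in> r" "e x = e x'" "e y = e y'" unfolding Rh by (auto simp: hpair_eq)
    then have "x' \<in> P" "y' \<in> P" using r by blast+
    then have "x = x'" "y = y'" using xy' that inj_onD[OF e] by simp_all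
    then show "(x, y) \<in> r" using xy' by simp
  next
    assume "(x, y) \<in> r"
    then show "hmem (hpair (e x) (e y)) Rh" unfolding Rh by (intro image_eqI[of _ _ "(x, y)"]) simp_all
  qed
  have code_eq: "poset_code e P r = hpair Ph Rh" by (simp add: poset_code_def Ph_def Rh_def)
  have eD: "hmem z (hset_of (e ` D)) \<longleftrightarrow> z \<in> e ` D" for z D by (rule hmem_hset_of_image[OF card_p])
  have dense_h_iff: "dense_h Ph Rh (hset_of (e ` D)) \<longleftrightarrow> dense_in P r D" if "D \<subseteq> P" for D
  proof -
    have "(\<exists>d. d \<in> e ` D \<and> hmem (hpair d (e q)) Rh) \<longleftrightarrow> (\<exists>d\<in>D. (d, q) \<in> r)" if "q \<in> P" for q
      using Rh'[OF _ that] \<open>D \<subseteq> P\<close> by (auto simp: subset_iff)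
    then show ?thesis unfolding dense_h_def dense_in_def eD Ph using that by auto
  qed
  obtain w where w: "infinite_h w" "countable {x :: 'p set hset. hmem x w}" using infinite_h_exists[OF inf'] .
  \<comment> \<open>The code of the poset is the one parameter taken from \<open>M\<close> and sits
    at every index outside 1 to 8. Indices 1 and 2 are its components, 3 to 8 the objects for which
    elementarity finds substitutes in \<open>M\<close>.\<close>
  define v where "v = (\<lambda>_ :: nat. hpair Ph Rh)(1 := Ph, 2 := Rh, 3 := w, 4 := G1, 5 := G2, 6 := G3, 7 := G4, 8 := G5)"
  have "club_h v"
    unfolding club_h_def
  proof (intro conjI allI impI)
    show "infinite_h (v 3)" using w by (simp add: v_def)
    fix X f assume "hmem (v 4) X \<and> hmem (v 5) X \<and> hmem (v 6) X \<and> hmem (v 7) X \<and> hmem (v 8) X \<and> closed_h X \<and> embeds_h f X (v 3)"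
    then have G: "hmem G1 X" "hmem G2 X" "hmem G3 X" "hmem G4 X" "hmem G5 X" and cX: "closed_h X" and emb: "embeds_h f X w"
      by (simp_all add: v_def)
    have app: "\<exists>z. hmem z X \<and> hmem (hpair x z) g" if "hmem g X" "hmem x X" "hmem (hpair x z) g" for g x z
      using cX that unfolding closed_h_def by blast
    have cnt: "countable {x. hmem x X}"
    proof -
      obtain n where n: "\<And>x. hmem x X \<Longrightarrow> hmem (n x) w \<and> hmem (hpair x (n x)) f \<and> (\<forall>y. hmem y X \<and> hmem (hpair y (n x)) f \<longrightarrow> y = x)"
        using emb unfolding embeds_h_def by metis
      have "inj_on n {x. hmem x X}" using n by (intro inj_onI) (metis mem_Collect_eq)
      moreover have "countable (n ` {x. hmem x X})" using n w(2) by (auto intro: countable_subset[rotated])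
      ultimately show ?thesis using countable_image_inj_on by blast
    qed
    \<comment> \<open>\<open>gen\<close> is applied to this set: it is countable because
      \<open>X\<close> is, and \<open>G1\<close> and \<open>G2\<close> close it under
      \<open>cl\<close>.\<close>
    define Z where "Z = {z. hmem (\<iota> [z]) X}"
    have cZ: "countable Z"
    proof -
      have "inj_on (\<lambda>z. \<iota> [z]) Z" using \<iota> by (intro inj_onI) simp
      moreover have "countable ((\<lambda>z. \<iota> [z]) ` Z)" using cnt by (auto simp: Z_def intro: countable_subset[rotated])
      ultimately show ?thesis using countable_image_inj_on by blast
    qed
    have append: "hmem (\<iota> (xs @ ys)) X" if "hmem (\<iota> xs) X" "hmem (\<iota> ys) X" for xs ys
    proof -
      obtain z where "hmem z X" "hmem (hpair (\<iota> xs) z) G1" using app[OF G(1) \<open>hmem (\<iota> xs) X\<close>] G1 by blast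
      then have "hmem (A xs) X" unfolding G1 by (auto simp: hpair_eq \<iota>)
      then obtain z where "hmem z X" "hmem (hpair (\<iota> ys) z) (A xs)" using app[OF _ \<open>hmem (\<iota> ys) X\<close>] A by blast
      then show ?thesis unfolding A by (auto simp: hpair_eq \<iota>)
    qed
    have lists: "hmem (\<iota> xs) X" if "xs \<noteq> []" "set xs \<subseteq> Z" for xs
      using that
    proof (induction xs rule: list_nonempty_induct)
      case (cons x xs)
      then show ?case using append[of "[x]" xs] by (simp add: Z_def)
    qed (simp add: Z_def)
    have gZ: "g xs \<in> Z" if xs: "xs \<noteq> []" "set xs \<subseteq> Z" for xs
    proof -
      obtain z where "hmem z X" "hmem (hpair (\<iota> xs) z) G2" using app[OF G(2) lists[OF xs]] G2 by blast
      then show ?thesis unfolding G2 Z_def by (auto simp: hpair_eq \<iota>)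
    qed
    have clZ': "cl {} \<union> cl u \<subseteq> Z" if u: "finite u" "u \<noteq> {}" "u \<subseteq> Z" for u
    proof
      fix y assume y: "y \<in> cl {} \<union> cl u"
      have "countable (cl {} \<union> cl u)" using cl u by auto
      then obtain n where n: "from_nat_into (cl {} \<union> cl u) n = y" using from_nat_into_surj y by metis
      obtain xs where xs: "set xs = u" "length xs = prod_encode (n, card u)"
        using list_with_set[OF u(1,2) le_prod_encode_2] by metis
      have "g xs = y" unfolding g_def xs using n by simp
      then show "y \<in> Z" using gZ[of xs] xs u by auto
    qed
    show "good_h X (v 1) (v 2)"
      unfolding good_h_def
    proof (intro allI impI)
      fix ph assume "hmem ph X \<and> hmem ph (v 1)"
      then obtain p where p: "p \<in> P" "ph = e p" "hmem (e p) X" by (auto simp: v_def Ph)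
      have "e q = e q' \<Longrightarrow> q = q'" if "q \<in> P" "q' \<in> P" for q q' using e that by (simp add: inj_on_def)
      note inj_e = this
      obtain z where "hmem z X" "hmem (hpair (e p) z) G3" using app[OF G(3) p(3)] G3 p(1) by blast
      then have ap: "a p \<in> Z" unfolding G3 Z_def using inj_e p(1) by (auto simp: hpair_eq)
      \<comment> \<open>\<open>a p\<close> shows that \<open>Z\<close> is nonempty, so the closure
        of the empty set is covered as well.\<close>
      have clZ: "cl u \<subseteq> Z" if "finite u" "u \<subseteq> Z" for u
        using clZ'[of u] clZ'[of "{a p}"] that ap by (cases "u = {}") auto
      obtain q where q: "q \<in> P" "(q, p) \<in> r" and gq: "\<And>D q'. dense_in P r D \<Longrightarrow> b D \<in> Z \<Longrightarrow> q' \<in> P \<Longrightarrow> (q', q) \<in> r \<Longrightarrow>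
          \<exists>d\<in>D. a d \<in> Z \<and> compatible P r d q'"
        using gen[OF cZ clZ p(1) ap] by blast
      have "\<exists>d. hmem d D \<and> hmem d X \<and> (\<exists>u. hmem u Ph \<and> hmem (hpair u d) Rh \<and> hmem (hpair u qh) Rh)"
        if D: "hmem D X" "dense_h Ph Rh D" and qh: "hmem qh Ph" "hmem (hpair qh (e q)) Rh" for D qh
      proof -
        define D0 where "D0 = {d \<in> P. hmem (e d) D}"
        have D0: "D = hset_of (e ` D0)"
        proof (rule hset_extensional)
          show "hmem z D \<longleftrightarrow> hmem z (hset_of (e ` D0))" for z
            unfolding eD D0_def using D(2) unfolding dense_h_def Ph by blast
        qed
        have "D0 \<subseteq> P" by (auto simp: D0_def)
        have dense: "dense_in P r D0" using D(2) dense_h_iff[OF \<open>D0 \<subseteq> P\<close>] D0 by simp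
        have "hmem (hpair D (\<iota> [b D0])) G5" unfolding G5 using \<open>D0 \<subseteq> P\<close> D0 by blast
        then obtain z where z: "hmem z X" "hmem (hpair D z) G5" using app[OF G(5) D(1)] by blast
        then obtain D1 where D1: "D1 \<subseteq> P" "D = hset_of (e ` D1)" "z = \<iota> [b D1]" unfolding G5 by (auto simp: hpair_eq)
        have "hset_of (e ` D0) = hset_of (e ` D1)" by (rule trans[OF D0[symmetric] D1(2)])
        then have "e ` D0 = e ` D1" using eD[of _ D0] eD[of _ D1] by (intro set_eqI) simp
        then have "D0 = D1" using e \<open>D0 \<subseteq> P\<close> D1(1) by (simp add: inj_on_image_eq_iff)
        then have "b D0 \<in> Z" using z D1 by (simp add: Z_def)
        obtain q' where q': "q' \<in> P" "qh = e q'" using qh Ph by auto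
        then have "(q', q) \<in> r" using qh(2) Rh' q(1) by simp
        from gq[OF dense \<open>b D0 \<in> Z\<close> q'(1) this] obtain d where d: "d \<in> D0" "a d \<in> Z" "compatible P r d q'" by blast
        obtain u where u: "u \<in> P" "(u, d) \<in> r" "(u, q') \<in> r" using d(3) unfolding compatible_def by blast
        have dP: "d \<in> P" using d(1) \<open>D0 \<subseteq> P\<close> by blast
        have "hmem (\<iota> [a d]) X" using d(2) by (simp add: Z_def)
        moreover have "hmem (hpair (\<iota> [a d]) (e d)) G4" unfolding G4 using dP by blast
        ultimately obtain z where z: "hmem z X" "hmem (hpair (\<iota> [a d]) z) G4" using app[OF G(4)] by blast
        then have "z = e d" unfolding G4 using inj_a dP by (auto simp: hpair_eq \<iota> inj_on_def)
        then have "hmem (e d) X" using z by simp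
        moreover have "hmem (e d) D" using d(1) by (simp add: D0_def)
        moreover have "hmem (e u) Ph" "hmem (hpair (e u) (e d)) Rh" "hmem (hpair (e u) qh) Rh"
          using u dP q' Rh' Ph by auto
        ultimately show ?thesis by blast
      qed
      moreover have "hmem (e q) Ph" "hmem (hpair (e q) (e p)) Rh" using q p(1) Rh' Ph by auto
      ultimately show "\<exists>q. hmem q (v 1) \<and> hmem (hpair q ph) (v 2) \<and>
        (\<forall>D. hmem D X \<and> dense_h (v 1) (v 2) D \<longrightarrow> (\<forall>q'. hmem q' (v 1) \<and> hmem (hpair q' q) (v 2) \<longrightarrow>
       (\<exists>d. hmem d D \<and> hmem d X \<and> (\<exists>u. hmem u (v 1) \<and> hmem (hpair u d) (v 2) \<and> hmem (hpair u q') (v 2)))))"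
        unfolding p(2) by (intro exI[of _ "e q"]) (simp add: v_def)
    qed
  qed
  moreover have "v 0 = hpair (v 1) (v 2)" by (simp add: v_def)
  moreover have "range (\<lambda>_ :: nat. hpair Ph Rh) \<subseteq> M" using code code_eq by auto
  moreover have "v i = hpair Ph Rh" if "i \<notin> set [1..<9]" for i using that by (auto simp: v_def)
  ultimately obtain v' where v': "range v' \<subseteq> M" "\<forall>i. i \<notin> set [1..<9] \<longrightarrow> v' i = hpair Ph Rh"
    "v' 0 = hpair (v' 1) (v' 2)" "club_h v'"
    using elementary_reflect[OF M(2) definable_club_h[OF inf'], of "\<lambda>_. hpair Ph Rh" v "[1..<9]"] by blast
  have "v' 0 = hpair Ph Rh" using v'(2) by simp
  then have v'12: "v' 1 = Ph" "v' 2 = Rh" using v'(3) by (simp_all add: hpair_eq)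
  have v'M: "v' i \<in> M" for i using v'(1) by blast
  \<comment> \<open>Being countable, \<open>M\<close> is coded by an element of H(\<theta>), and the
    reflected statement applies to this element.\<close>
  let ?X = "hset_of M"
  have cM: "|M| \<le>o |UNIV :: 'p set set|" by (rule countable_ordLeq[OF M(1) inf'])
  have X: "hmem z ?X \<longleftrightarrow> z \<in> M" for z by (rule hmem_hset_of[OF cM])
  have "closed_h ?X"
    unfolding closed_h_def X
  proof (intro allI impI)
    fix g x assume gx: "g \<in> M \<and> x \<in> M" and "\<exists>z. hmem (hpair x z) g"
    then obtain z where z: "hmem (hpair x z) g" by blast
    let ?v = "(\<lambda>_ :: nat. x)(2 := g)"
    have "range ?v \<subseteq> M" using gx by auto
    from elementary_reflect[OF M(2) definable_in_rel[OF inf', of 0 1 2] this, of "?v(1 := z)" "[1]"]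
    obtain u where "range u \<subseteq> M" "\<forall>i. i \<notin> set [1] \<longrightarrow> u i = ?v i" "hmem (hpair (u 0) (u 1)) (u 2)"
      using z by auto
    then have "u 1 \<in> M" "hmem (hpair x (u 1)) g" by (blast, simp)
    then show "\<exists>z. z \<in> M \<and> hmem (hpair x z) g" by blast
  qed
  moreover have "\<exists>f. embeds_h f ?X (v' 3)"
  proof -
    have "infinite {x. hmem x (v' 3)}" using v'(4) infinite_hI unfolding club_h_def by blast
    then obtain j :: "nat \<Rightarrow> 'p set hset" where j: "inj j" "range j \<subseteq> {x. hmem x (v' 3)}"
      using infinite_countable_subset by blast
    let ?n = "\<lambda>x. j (to_nat_on M x)"
    define f where "f = hset_of ((\<lambda>x. hpair x (?n x)) ` M)"
    have f: "hmem z f \<longleftrightarrow> z \<in> (\<lambda>x. hpair x (?n x)) ` M" for z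
      unfolding f_def by (rule hmem_hset_of_image[OF cM])
    have inj_n: "?n x = ?n y \<longleftrightarrow> x = y" if "x \<in> M" "y \<in> M" for x y
      using j(1) that inj_on_to_nat_on[OF M(1)] by (auto simp: inj_def inj_on_def)
    have "embeds_h f ?X (v' 3)"
      unfolding embeds_h_def X
    proof (intro allI impI exI conjI)
      fix x assume x: "x \<in> M"
      show "hmem (?n x) (v' 3)" using j(2) by blast
      show "hmem (hpair x (?n x)) f" unfolding f using x by blast
      show "y = x" if "y \<in> M \<and> hmem (hpair y (?n x)) f" for y
        using that inj_n x unfolding f by (auto simp: hpair_eq)
    qed
    then show ?thesis by blast
  qed
  ultimately obtain f where "closed_h ?X" "embeds_h f ?X (v' 3)" by blast
  then have "good_h ?X Ph Rh"
    using conjunct2[OF v'(4)[unfolded club_h_def v'12], rule_format, of ?X f] X v'M by simp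
  note good = this[unfolded good_h_def, rule_format, of "e p"]
  have "hmem (e p) ?X \<and> hmem (e p) Ph" using p X Ph by blast
  from good[OF this] obtain qh where qh: "hmem qh Ph" "hmem (hpair qh (e p)) Rh"
    and gq: "\<And>D q'. hmem D ?X \<and> dense_h Ph Rh D \<Longrightarrow> hmem q' Ph \<and> hmem (hpair q' qh) Rh \<Longrightarrow>
       \<exists>d. hmem d D \<and> hmem d ?X \<and> (\<exists>u. hmem u Ph \<and> hmem (hpair u d) Rh \<and> hmem (hpair u q') Rh)"
    by blast
  obtain q where q: "q \<in> P" "qh = e q" using qh(1) Ph by auto
  show "\<exists>q\<in>P. (q, p) \<in> r \<and> generic_condition e P r M q"
  proof (intro bexI[OF _ q(1)] conjI)
    show "(q, p) \<in> r" using qh(2) q Rh' p(1) by simp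
    show "generic_condition e P r M q"
      unfolding generic_condition_def
    proof (intro allI impI ballI)
      fix D q' assume D: "dense_in P r D" "hset_of (e ` D) \<in> M" and q': "q' \<in> P" "(q', q) \<in> r"
      have DP: "D \<subseteq> P" using D(1) unfolding dense_in_def by blast
      have "hmem (hset_of (e ` D)) ?X \<and> dense_h Ph Rh (hset_of (e ` D))" using D DP X dense_h_iff by blast
      moreover have "hmem (e q') Ph \<and> hmem (hpair (e q') qh) Rh" using q q' Ph Rh' by blast
      ultimately obtain d u where d: "hmem d (hset_of (e ` D))" "hmem d ?X" "hmem u Ph" "hmem (hpair u d) Rh" "hmem (hpair u (e q')) Rh"
        using gq by meson
      obtain d' where d': "d' \<in> D" "d = e d'" using d(1) eD by auto
      obtain u' where u': "u' \<in> P" "u = e u'" using d(3) Ph by auto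
      have "compatible P r d' q'" unfolding compatible_def using d d' u' DP q' Rh' by (intro bexI[of _ u']) auto
      moreover have "e d' \<in> M" using d(2) d' X by simp
      ultimately show "\<exists>d\<in>D. e d \<in> M \<and> compatible P r d q'" using d'(1) by blast
    qed
  qed
qed

section \<open>The homogeneous set\<close>

lemma ex_inj_prod:
  assumes "infinite (UNIV :: 'c set)" "\<exists>f :: 'a \<Rightarrow> 'c. inj f" "\<exists>g :: 'b \<Rightarrow> 'c. inj g"
  shows "\<exists>h :: 'a \<times> 'b \<Rightarrow> 'c. inj h"
proof -
  obtain f :: "'a \<Rightarrow> 'c" and g :: "'b \<Rightarrow> 'c" where fg: "inj f" "inj g" using assms(2,3) by blast
  have "|UNIV \<times> UNIV :: ('c \<times> 'c) set| \<le>o |UNIV :: 'c set|"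
    using card_of_Times_same_infinite[OF assms(1)] ordIso_imp_ordLeq by blast
  then obtain m :: "'c \<times> 'c \<Rightarrow> 'c" where m: "inj m"
    unfolding card_of_ordLeq[symmetric] UNIV_Times_UNIV by blast
  have "inj (\<lambda>(x, y). m (f x, g y))"
  proof (rule injI, clarify)
    fix x y x' y' assume "m (f x, g y) = m (f x', g y')"
    then have "(f x, g y) = (f x', g y')" by (rule injD[OF m])
    then show "x = x' \<and> y = y'" using injD[OF fg(1)] injD[OF fg(2)] by simp
  qed
  then show ?thesis by - (rule exI)
qed

lemma ex_inj_compose: "(\<exists>f :: 'a \<Rightarrow> 'b. inj f) \<Longrightarrow> (\<exists>g :: 'b \<Rightarrow> 'c. inj g) \<Longrightarrow> \<exists>h :: 'a \<Rightarrow> 'c. inj h"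
  using inj_compose by blast

lemma ex_inj_set: "(\<exists>f :: 'a \<Rightarrow> 'b. inj f) \<Longrightarrow> \<exists>h :: 'a set \<Rightarrow> 'b set. inj h"
proof -
  assume "\<exists>f :: 'a \<Rightarrow> 'b. inj f"
  then obtain f :: "'a \<Rightarrow> 'b" where "inj f" ..
  then have "inj (image f)" by (intro injI) (simp add: inj_image_eq_iff)
  then show ?thesis by - (rule exI)
qed

lemma ex_inj_singleton: "\<exists>f :: 'a \<Rightarrow> 'a set. inj f"
  by (rule exI[of _ "\<lambda>x. {x}"]) (simp add: inj_def)

type_synonym payload = "cond \<times> node \<times> omega1 \<times> (omega1 \<Rightarrow> omega1)"

lemma inj_payload:
  assumes "\<exists>f :: node set set set \<Rightarrow> 'p. inj f"
  shows "\<exists>f :: nat \<times> nat \<times> payload \<Rightarrow> 'p. inj f"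
proof -
  have infinite_omega1: "infinite (UNIV :: omega1 set)" using uncountable_omega1 countable_finite by blast
  have on: "\<exists>f :: omega1 \<Rightarrow> node. inj f"
    by (rule exI[of _ "\<lambda>\<xi>. [\<xi> \<mapsto> True]"]) (auto simp: inj_def fun_eq_iff split: if_splits)
  then have infinite_node: "infinite (UNIV :: node set)"
    using infinite_omega1 by (meson finite_imageD finite_subset subset_UNIV)
  \<comment> \<open>A function is coded by its graph, through a pairing of ordinals, as a partial
    function whose only value is \<open>True\<close>.\<close>
  have fn: "\<exists>f :: (omega1 \<Rightarrow> omega1) \<Rightarrow> node. inj f"
  proof -
    obtain m :: "omega1 \<times> omega1 \<Rightarrow> omega1" where m: "inj m"
      using ex_inj_prod[OF infinite_omega1 exI exI, OF inj_on_id inj_on_id] by blast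
    define F where "F f = (\<lambda>\<zeta>. if \<exists>\<xi>. m (\<xi>, f \<xi>) = \<zeta> then Some True else None)" for f
    have F: "F f (m (\<xi>, \<eta>)) = Some True \<longleftrightarrow> f \<xi> = \<eta>" for f \<xi> \<eta>
      unfolding F_def inj_eq[OF m] by auto
    have "inj F"
    proof (intro injI ext)
      fix f g \<xi> assume "F f = F g"
      then show "f \<xi> = g \<xi>" using F[of f \<xi> "g \<xi>"] F[of g \<xi> "g \<xi>"] by simp
    qed
    then show ?thesis by - (rule exI)
  qed
  have i: "infinite (UNIV :: node set set set)"
    using infinite_node by (simp add: Finite_Set.finite_set)
  have s: "\<exists>f :: node set \<Rightarrow> node set set. inj f" "\<exists>f :: node \<Rightarrow> node set. inj f" by (rule ex_inj_singleton)+
  have n: "\<exists>f :: node \<Rightarrow> node set set. inj f" using ex_inj_compose s by blast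
  have "\<exists>f :: nat \<Rightarrow> node set set. inj f" using i infinite_countable_subset by blast
  moreover have "\<exists>f :: omega1 \<Rightarrow> node set set. inj f" by (rule ex_inj_compose[OF on n])
  moreover have "\<exists>f :: (omega1 \<Rightarrow> omega1) \<Rightarrow> node set set. inj f" by (rule ex_inj_compose[OF fn n])
  moreover have "\<exists>f :: (omega1 \<Rightarrow> omega1) set \<Rightarrow> node set set. inj f" by (rule ex_inj_compose[OF ex_inj_set[OF fn] s(1)])
  ultimately have "\<exists>f :: nat \<times> nat \<times> payload \<Rightarrow> node set set. inj f"
    using s(1) n by (intro ex_inj_prod[OF i])
  then have "\<exists>f :: nat \<times> nat \<times> payload \<Rightarrow> node set set set. inj f" by (rule ex_inj_compose) (rule ex_inj_singleton)
  then show ?thesis using assms by (rule ex_inj_compose)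
qed

text \<open>Tagged tuples. The entry \<open>(4, undefined)\<close> marks a dense set as such and
  keeps its code nonempty even when the set is empty.\<close>

definition elt_payload :: "elt \<Rightarrow> (nat \<times> payload) set" where
  "elt_payload x = (case x of
     EOrd \<xi> \<Rightarrow> {(0, undefined, undefined, \<xi>, undefined)}
   | EFun f \<Rightarrow> {(1, undefined, undefined, undefined, f)}
   | ECond p \<Rightarrow> {(2, p, undefined, undefined, undefined)}
   | EDense D \<Rightarrow> insert (4, undefined) ((\<lambda>(p, s). (3, p, s, undefined, undefined)) ` D))"

lemma inj_elt_payload: "inj elt_payload"
proof (rule injI)
  fix x y assume eq: "elt_payload x = elt_payload y"
  have D: "EDense D = EDense D'" if "elt_payload (EDense D) = elt_payload (EDense D')" for D D'
  proof -
    have "(p, s) \<in> D \<longleftrightarrow> (3, p, s, undefined, undefined) \<in> elt_payload (EDense D)" for p s D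
      by (auto simp: elt_payload_def)
    then show ?thesis using that by auto
  qed
  have 4: "(4, undefined) \<in> elt_payload x \<longleftrightarrow> (\<exists>D. x = EDense D)" for x
    by (auto simp: elt_payload_def split: elt.splits)
  then have "(\<exists>D. x = EDense D) \<longleftrightarrow> (\<exists>D. y = EDense D)" using eq by metis
  then show "x = y" using eq D by (cases x; cases y) (auto simp: elt_payload_def)
qed

text \<open>The list is stored as a relation between indices and entries; since no entry has an
  empty code, the length can be recovered.\<close>

lemma inj_elt_list:
  assumes "inj (J :: nat \<times> nat \<times> payload \<Rightarrow> 'p)"
  shows "inj (\<lambda>xs. J ` (SIGMA i:{..<length xs}. elt_payload (xs ! i)))"
proof (rule injI)
  fix xs ys assume "J ` (SIGMA i:{..<length xs}. elt_payload (xs ! i)) = J ` (SIGMA i:{..<length ys}. elt_payload (ys ! i))"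
  then have eq: "(SIGMA i:{..<length xs}. elt_payload (xs ! i)) = (SIGMA i:{..<length ys}. elt_payload (ys ! i))"
    using assms by (simp add: inj_image_eq_iff)
  have ne: "elt_payload x \<noteq> {}" for x by (auto simp: elt_payload_def split: elt.splits)
  have "fst ` (SIGMA i:{..<length xs}. elt_payload (xs ! i)) = {..<length xs}" for xs
    using ne by (auto simp: fst_image_Sigma)
  then have len: "{..<length xs} = {..<length ys}" using eq by metis
  then have len': "length xs = length ys" by simp
  show "xs = ys"
  proof (rule nth_equalityI[OF len'])
    fix i assume "i < length xs"
    moreover have "{y. (i, y) \<in> (SIGMA i:{..<length xs}. elt_payload (xs ! i))} =
        {y. (i, y) \<in> (SIGMA i:{..<length ys}. elt_payload (ys ! i))}" by (simp only: eq)
    ultimately have "elt_payload (xs ! i) = elt_payload (ys ! i)" using len' by simp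
    then show "xs ! i = ys ! i" using inj_elt_payload by (simp add: inj_eq)
  qed
qed

text \<open>The colour \<open>j\<close> in \<open>phi0\<close> is existentially quantified, so
  exchanging the colours merely renames it.\<close>

lemma phi0_neg:
  assumes "phi0 S c"
  shows "phi0 S (\<lambda>X. \<not> c X)"
  using assms unfolding phi0_def by (simp add: ex_bool_eq disj_commute)

section \<open>Homogeneous sets: refutation and existence\<close>

context coloured_tree
begin

text \<open>By \<open>suslin_dense\<close> the uncountable \<open>H\<close> is dense above some
  node, so its diagonal is large there. \<open>phi0_avoid\<close> for the exchanged colours, with
  tuples of length one, then gives two comparable elements of \<open>H\<close> of colour 1.\<close>

lemma no_homogeneous:
  assumes H: "H \<subseteq> S" "uncountable H" and hom: "\<And>x y. x \<in> H \<Longrightarrow> y \<in> H \<Longrightarrow> tree_less x y \<Longrightarrow> \<not> c {x, y}"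
  shows False
proof -
  let ?B = "{v \<in> S. \<forall>x\<in>H. \<not> v \<subseteq>\<^sub>m x}"
  have "\<And>v w. v \<in> ?B \<Longrightarrow> w \<in> S \<Longrightarrow> v \<subseteq>\<^sub>m w \<Longrightarrow> w \<in> ?B" using map_le_trans by blast
  then obtain \<gamma> where \<gamma>: "\<And>v w. v \<in> S \<Longrightarrow> \<gamma> \<le> ht v \<Longrightarrow> w \<in> ?B \<Longrightarrow> v \<subseteq>\<^sub>m w \<Longrightarrow> v \<in> ?B"
    using suslin_dense[of ?B] by blast
  obtain x where x: "x \<in> H" "\<gamma> < ht x"
  proof -
    have "\<not> H \<subseteq> {t \<in> S. ht t \<le> \<gamma>}" using countable_subset[OF _ countable_below[of \<gamma>], of H] H(2) by blast
    then obtain x where "x \<in> H" "\<not> ht x \<le> \<gamma>" using H(1) by blast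
    then show ?thesis using that by simp
  qed
  let ?s = "x |` {..<\<gamma>}"
  have xS: "x \<in> S" using x H by blast
  have s: "?s \<in> S" "ht ?s = \<gamma>" "?s \<subseteq>\<^sub>m x" using cut_in[OF xS] ht_cut[OF xS] x(2) cut_le by auto
  have dense: "\<exists>x\<in>H. w \<subseteq>\<^sub>m x" if "w \<in> S" "?s \<subseteq>\<^sub>m w" for w
  proof (rule ccontr)
    assume "\<not> (\<exists>x\<in>H. w \<subseteq>\<^sub>m x)"
    then have "?s \<in> ?B" using \<gamma>[OF s(1) _ _ that(2)] that(1) s(2) by auto
    then show False using x(1) s(3) by blast
  qed
  let ?K = "{(x, x) | x. x \<in> H}"
  have "large ?K ?s"
    unfolding large_def
  proof (intro ballI impI allI)
    fix t \<alpha> assume t: "t \<in> S" "?s \<subseteq>\<^sub>m t"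
    obtain w where w: "w \<in> S" "t \<subseteq>\<^sub>m w" "\<alpha> < ht w" using extension_above[OF t(1), of "{\<alpha>}"] by auto
    then obtain y where y: "y \<in> H" "w \<subseteq>\<^sub>m y" using dense t map_le_trans by blast
    have "ht w \<le> ht y" using sub_ht[OF w(1) _ y(2)] y(1) H by blast
    then have "\<alpha> \<le> ht y" using w(3) by order
    moreover have "t \<subseteq>\<^sub>m y" using w(2) y(2) map_le_trans by blast
    ultimately show "\<exists>x \<sigma>. (x, \<sigma>) \<in> ?K \<and> t \<subseteq>\<^sub>m \<sigma> \<and> \<alpha> \<le> ht x" using y(1) by blast
  qed
  have "?K \<subseteq> S \<times> S" using H by blast
  obtain v where v: "v \<in> S" "?s \<subseteq>\<^sub>m v" and av: "\<And>Y. Y \<subseteq> {y \<in> S. v \<subseteq>\<^sub>m y} \<Longrightarrow> finite Y \<Longrightarrow> card Y \<le> 1 \<Longrightarrow>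
     \<exists>x \<sigma>. (x, \<sigma>) \<in> ?K \<and> \<sigma> \<subseteq>\<^sub>m v \<and> ht x < ht v \<and> (\<forall>y\<in>Y. \<not> \<not> c {x, y})"
    using phi0_avoid[OF phi0_neg[OF phi] \<open>?K \<subseteq> S \<times> S\<close> _ s(1) \<open>large ?K ?s\<close>, of 1] map_le_refl by blast
  obtain y where y: "y \<in> H" "v \<subseteq>\<^sub>m y" using dense v by blast
  have yS: "y \<in> S" using y H by blast
  obtain x where x: "x \<in> H" "x \<subseteq>\<^sub>m v" "ht x < ht v" "c {x, y}" using av[of "{y}"] y yS by auto
  have "x \<subseteq>\<^sub>m y" using x(2) y(2) map_le_trans by blast
  moreover have "x \<noteq> y" using x(3) sub_ht[OF v(1) yS y(2)] by auto
  ultimately show False using hom[OF x(1) y(1)] x(4) unfolding tree_less_def by blast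
qed

lemma model_above:
  assumes "countable X0"
  obtains X h where "X0 \<subseteq> X" "model X h"
proof -
  obtain X where X: "X0 \<subseteq> X" "countable X" "\<And>u. finite u \<Longrightarrow> u \<subseteq> X \<Longrightarrow> hull_step u \<subseteq> X"
  proof (rule countable_closure[of hull_step X0])
    show "countable (hull_step u)" if "finite u" for u using that by (rule countable_hull_step)
  qed (rule assms, rule that)
  then have "hull_closed X" unfolding hull_closed_def by blast
  from model_exists[OF X(2) this] show ?thesis using that X(1) by blast
qed

text \<open>Otherwise every condition has an extension below which the nodes are bounded. Take this
  for \<open>({x}, {h})\<close> with \<open>x\<close> above the model of \<open>h\<close>:
  genericity for the set \<open>D\<close> of conditions paired with a node that bounds them produces
  a bound below \<open>side_ord h\<close> that applies to a condition containing
  \<open>x\<close>.\<close>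

lemma unbounded_cond:
  obtains e where "e \<in> conds"
    "\<And>p \<alpha>. p \<in> conds \<Longrightarrow> stronger p e \<Longrightarrow> \<exists>r\<in>conds. stronger r p \<and> (\<exists>x\<in>fst r. \<alpha> \<le> ht x)"
proof (rule ccontr)
  assume "\<not> thesis"
  note found = that
  have neg: "\<exists>p\<in>conds. stronger p e \<and> (\<exists>\<alpha>. \<forall>r\<in>conds. stronger r p \<longrightarrow> (\<forall>x\<in>fst r. ht x < \<alpha>))"
    if e: "e \<in> conds" for e
  proof (rule ccontr)
    assume *: "\<not> ?thesis"
    have "\<exists>r\<in>conds. stronger r p \<and> (\<exists>x\<in>fst r. \<alpha> \<le> ht x)" if "p \<in> conds" "stronger p e" for p \<alpha>
      using * that by (meson not_le)
    then have thesis using found[OF e] by blast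
    then show False using \<open>\<not> thesis\<close> by contradiction
  qed
  define D where "D = {(p, t). p \<in> conds \<and> t \<in> S \<and> (\<forall>r\<in>conds. stronger r p \<longrightarrow> (\<forall>x\<in>fst r. ht x < ht t))}"
  have "upward D"
    unfolding upward_def
  proof (intro allI impI)
    fix p s t assume *: "(p, s) \<in> D" "t \<in> S" "s \<subseteq>\<^sub>m t"
    then have "ht s \<le> ht t" using sub_ht by (auto simp: D_def)
    then show "(p, t) \<in> D" using * unfolding D_def by (auto dest: less_le_trans)
  qed
  obtain X h where X: "{EDense D} \<subseteq> X" "model X h" using model_above[of "{EDense D}"] by auto
  note m = modelD[OF X(2)]
  obtain s0 where "s0 \<in> S" using uncountable_S by fastforce
  then obtain x where x: "x \<in> S" "side_ord h < ht x" using extension_above[of s0 "{side_ord h}"] by auto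
  have "({x}, {h}) \<in> conds"
    unfolding conds_iff using x m(2) by (auto simp: tree_less_def)
  from neg[OF this] obtain p \<alpha> where p: "p \<in> conds" "stronger p ({x}, {h})"
    "\<forall>r\<in>conds. stronger r p \<longrightarrow> (\<forall>x\<in>fst r. ht x < \<alpha>)" by blast
  obtain t where t: "t \<in> S" "\<alpha> < ht t" "side_ord h < ht t"
    using extension_above[OF x(1), of "{\<alpha>, side_ord h}"]
    by (metis countable_empty countable_insert insertI1 insertI2)
  have "(p, t) \<in> D" using p(1,3) t unfolding D_def by (auto intro: less_trans)
  moreover have "h \<in> snd p" using p(2) by (simp add: stronger_def)
  moreover have "EDense D \<in> X" using X(1) by simp
  ultimately obtain r' s u where r': "(r', s) \<in> D" "ht s < side_ord h" "u \<in> conds" "stronger u p" "stronger u r'"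
    using model_generic[OF X(2) p(1) _ _ \<open>upward D\<close> _ t(1) less_imp_le[OF t(3)]] by metis
  have "x \<in> fst u" using r'(4) p(2) by (auto simp: stronger_def)
  then have "ht x < ht s" using r'(1,3,5) unfolding D_def by blast
  then show False using r'(2) x(2) by order
qed

lemma exists_homogeneous:
  assumes J: "inj (J :: nat \<times> nat \<times> payload \<Rightarrow> 'p)" and pfa: "PFA_S TYPE('p) S"
  shows "\<exists>H\<subseteq>S. uncountable H \<and> (\<forall>x\<in>H. \<forall>y\<in>H. tree_less x y \<longrightarrow> \<not> c {x, y})"
proof -
  obtain e where e: "e \<in> conds"
    and unbounded: "\<And>p \<alpha>. p \<in> conds \<Longrightarrow> stronger p e \<Longrightarrow> \<exists>r\<in>conds. stronger r p \<and> (\<exists>x\<in>fst r. \<alpha> \<le> ht x)"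
    using unbounded_cond by blast
  \<comment> \<open>Below \<open>e\<close>, conditions with arbitrarily tall nodes are dense. As
    \<open>PFA_S\<close> speaks of posets in \<open>'p\<close>, this part of the poset is copied
    into \<open>'p\<close> by \<open>j\<close>.\<close>
  define Q where "Q = {p \<in> conds. stronger p e}"
  define j :: "cond \<Rightarrow> 'p" where "j p = J (0, 0, p, undefined, undefined, undefined)" for p
  define d where "d = inv j"
  have "inj j" using J by (auto simp: j_def inj_def)
  then have dj [simp]: "d (j p) = p" for p by (simp add: d_def)
  define P where "P = j ` Q"
  define r where "r = {(j p, j q) | p q. p \<in> Q \<and> q \<in> Q \<and> stronger p q}"
  have jd: "j (d x) = x" "d x \<in> Q" if "x \<in> P" for x using that by (auto simp: P_def)
  have P_iff: "j p \<in> P \<longleftrightarrow> p \<in> Q" for p unfolding P_def by (rule inj_image_mem_iff[OF \<open>inj j\<close>])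
  have r_iff: "(x, y) \<in> r \<longleftrightarrow> x \<in> P \<and> y \<in> P \<and> stronger (d x) (d y)" for x y
  proof
    assume "(x, y) \<in> r"
    then obtain p q where "x = j p" "y = j q" "p \<in> Q" "q \<in> Q" "stronger p q" unfolding r_def by blast
    then show "x \<in> P \<and> y \<in> P \<and> stronger (d x) (d y)" by (simp add: P_iff)
  next
    assume *: "x \<in> P \<and> y \<in> P \<and> stronger (d x) (d y)"
    then have "x = j (d x)" "y = j (d y)" "d x \<in> Q" "d y \<in> Q" using jd by simp_all
    then show "(x, y) \<in> r" using * unfolding r_def by blast
  qed
  have down: "p \<in> Q" if "p \<in> conds" "q \<in> Q" "stronger p q" for p q
    using that stronger_trans by (auto simp: Q_def)
  have rP: "r \<subseteq> P \<times> P" by (auto simp: r_iff)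
  have trans_r: "trans r" by (rule transI) (auto simp: r_iff intro: stronger_trans)
  have refl_r: "(x, x) \<in> r" if "x \<in> P" for x using that by (simp add: r_iff)
  have antisym_r: "antisym r"
  proof (rule antisymI)
    fix x y assume "(x, y) \<in> r" "(y, x) \<in> r"
    then have "d x = d y" "x \<in> P" "y \<in> P" by (auto simp: r_iff stronger_def prod_eq_iff)
    then show "x = y" using jd by metis
  qed
  have order: "partial_order_on P r"
    unfolding partial_order_on_def preorder_on_def refl_on_def using rP trans_r refl_r antisym_r by auto
  have "e \<in> Q" using e by (simp add: Q_def)
  then have "P \<noteq> {}" by (auto simp: P_def)
  have generic: "\<exists>q\<in>P. (q, p) \<in> r \<and> h \<in> snd (d q)" if "model X h" "p \<in> P" "ECond (d p) \<in> X" for X h p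
  proof -
    let ?q = "(fst (d p), insert h (snd (d p)))"
    have dp: "d p \<in> Q" "d p \<in> conds" using jd(2)[OF that(2)] by (auto simp: Q_def)
    have "?q \<in> conds" by (rule add_model[OF that(1) dp(2) that(3)])
    moreover have "stronger ?q (d p)" by (auto simp: stronger_def)
    ultimately have "?q \<in> Q" using down dp by blast
    then show ?thesis using \<open>stronger ?q (d p)\<close> that(2) P_iff by (intro bexI[of _ "j ?q"]) (auto simp: r_iff)
  qed
  \<comment> \<open>Models contain sets of original conditions; this translates a set from
    \<open>'p\<close> back and restricts it to conditions below \<open>e\<close>.\<close>
  define tr where "tr D = {(p, s). (j p, s) \<in> D \<and> p \<in> Q}" for D :: "('p \<times> node) set"
  \<comment> \<open>The common core of properness and of the preservation of \<open>S\<close>: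
    density moves \<open>(a, t)\<close> into \<open>D\<close>, and \<open>model_generic\<close>
    reflects the result into the model.\<close>
  have meet: "\<exists>a'\<in>P. \<exists>s\<in>S. (a', s) \<in> D \<and> ECond (d a') \<in> X \<and> s \<subseteq>\<^sub>m t \<and> ht s < side_ord h \<and> (\<exists>u\<in>P. (u, a) \<in> r \<and> (u, a') \<in> r)"
    if X: "model X h" "EDense (tr D) \<in> X" and D: "dense_upward P r D" and a: "a \<in> P" "h \<in> snd (d a)"
      and t: "t \<in> S" "side_ord h \<le> ht t" for X h D a t
  proof -
    obtain a1 t1 where a1: "(a1, a) \<in> r" "t \<subseteq>\<^sub>m t1" "(a1, t1) \<in> D"
      using D a(1) t(1) unfolding dense_upward_def by blast
    have t1: "t1 \<in> S" "side_ord h \<le> ht t1"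
    proof -
      show "t1 \<in> S" using a1(3) D unfolding dense_upward_def by blast
      then have "ht t \<le> ht t1" using sub_ht[OF t(1) _ a1(2)] by blast
      then show "side_ord h \<le> ht t1" using t(2) by order
    qed
    have a1P: "a1 \<in> P" using a1(1) r_iff by blast
    have up: "upward (tr D)" using D unfolding upward_def tr_def dense_upward_def by blast
    have "(d a1, t1) \<in> tr D" using a1(3) jd[OF a1P] by (simp add: tr_def)
    moreover have "h \<in> snd (d a1)" using a1(1) a(2) by (auto simp: r_iff stronger_def)
    moreover have "d a1 \<in> conds" using jd(2)[OF a1P] by (simp add: Q_def)
    ultimately obtain r' s u where r': "ECond r' \<in> X" "(r', s) \<in> tr D" "s \<in> S" "s \<subseteq>\<^sub>m t1" "ht s < side_ord h"
      "u \<in> conds" "stronger u (d a1)" "stronger u r'"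
      using model_generic[OF X(1) _ _ X(2) up _ t1] by metis
    have "s \<subseteq>\<^sub>m t" using sub_chain[OF r'(3) t(1) r'(4) a1(2)] r'(5) t(2) by auto
    have r'Q: "r' \<in> Q" "(j r', s) \<in> D" using r'(2) by (auto simp: tr_def)
    have "u \<in> Q" using down[OF r'(6) jd(2)[OF a1P] r'(7)] .
    then have "(j u, a1) \<in> r" "(j u, j r') \<in> r" using r' r'Q a1P P_iff by (auto simp: r_iff)
    then have "(j u, a) \<in> r" using trans_r a1(1) by (meson transD)
    show ?thesis
      using r' r'Q \<open>u \<in> Q\<close> P_iff \<open>(j u, a) \<in> r\<close> \<open>(j u, j r') \<in> r\<close> \<open>s \<subseteq>\<^sub>m t\<close>
      by (intro bexI[of _ "j r'"] bexI[of _ s] conjI bexI[of _ "j u"]) simp_all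
  qed
  have high: "\<exists>t\<in>S. \<alpha> \<le> ht t" for \<alpha>
  proof -
    obtain s0 where "s0 \<in> S" using uncountable_S by fastforce
    then obtain t where "t \<in> S" "\<alpha> < ht t" using extension_above[of s0 "{\<alpha>}"] by auto
    then show ?thesis by (auto intro: less_imp_le)
  qed
  have inf: "infinite (UNIV :: 'p set)"
  proof
    assume fin: "finite (UNIV :: 'p set)"
    have "inj (\<lambda>n. J (n, undefined))" by (intro injI) (auto dest: injD[OF J])
    from range_inj_infinite[OF this] show False using finite_subset[OF subset_UNIV fin] by contradiction
  qed
  have proper: "proper P r"
  proof (rule properI[where a = "\<lambda>x. ECond (d x)" and b = "\<lambda>D. EDense (tr (D \<times> S))", OF inf rP inj_elt_list[OF J] _ countable_hull_step])
    show "inj_on (\<lambda>x. ECond (d x)) P" using jd(1) by (intro inj_onI) (metis elt.inject(3))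
    fix X p assume X: "countable X" "\<And>u. finite u \<Longrightarrow> u \<subseteq> X \<Longrightarrow> hull_step u \<subseteq> X" and p: "p \<in> P" "ECond (d p) \<in> X"
    have "hull_closed X" using X(2) unfolding hull_closed_def by blast
    from model_exists[OF X(1) this] obtain h where h: "model X h" .
    from generic[OF h p] obtain q where q: "q \<in> P" "(q, p) \<in> r" "h \<in> snd (d q)" by blast
    have "\<exists>a'\<in>D. ECond (d a') \<in> X \<and> compatible P r a' q'"
      if D: "dense_in P r D" "EDense (tr (D \<times> S)) \<in> X" and q': "q' \<in> P" "(q', q) \<in> r" for D q'
    proof -
      \<comment> \<open>For properness alone the node is left free: any \<open>t\<close> of
        sufficient height will do.\<close>
      have "dense_upward P r (D \<times> S)"
        using D(1) map_le_refl unfolding dense_upward_def dense_in_def by blast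
      moreover have "h \<in> snd (d q')" using q(3) q'(2) by (auto simp: r_iff stronger_def)
      moreover obtain t where "t \<in> S" "side_ord h \<le> ht t" using high by blast
      ultimately show ?thesis using meet[OF h D(2) _ q'(1)] unfolding compatible_def by blast
    qed
    then show "\<exists>q\<in>P. (q, p) \<in> r \<and> (\<forall>D. dense_in P r D \<longrightarrow> EDense (tr (D \<times> S)) \<in> X \<longrightarrow>
        (\<forall>q'\<in>P. (q', q) \<in> r \<longrightarrow> (\<exists>a'\<in>D. ECond (d a') \<in> X \<and> compatible P r a' q')))"
      using q by blast
  qed
  have suslin: "forces_suslin P r S"
  proof (rule forces_suslinI[OF trans_r refl_r rP])
    fix p \<D> assume p: "p \<in> P" and \<D>: "countable \<D>" "\<And>D. D \<in> \<D> \<Longrightarrow> dense_upward P r D"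
    obtain X h where X: "insert (ECond (d p)) ((\<lambda>D. EDense (tr D)) ` \<D>) \<subseteq> X" "model X h"
      using model_above[of "insert (ECond (d p)) ((\<lambda>D. EDense (tr D)) ` \<D>)"] \<D>(1) by auto
    from generic[OF X(2) p] X(1) obtain q where q: "q \<in> P" "(q, p) \<in> r" "h \<in> snd (d q)" by blast
    have "generic_below P r D q (side_ord h)" if "D \<in> \<D>" for D
      unfolding generic_below_def
    proof (intro ballI impI)
      fix a t assume a: "a \<in> P" "(a, q) \<in> r" and t: "t \<in> S" "side_ord h \<le> ht t"
      have "h \<in> snd (d a)" using q(3) a(2) by (auto simp: r_iff stronger_def)
      moreover have "EDense (tr D) \<in> X" using X(1) that by blast
      ultimately show "\<exists>a'\<in>P. \<exists>s\<in>S. (a', s) \<in> D \<and> s \<subseteq>\<^sub>m t \<and> ht s < side_ord h \<and> (\<exists>u\<in>P. (u, a) \<in> r \<and> (u, a') \<in> r)"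
        using meet[OF X(2) _ \<D>(2)[OF that] a(1) _ t] by blast
    qed
    then show "\<exists>q\<in>P. (q, p) \<in> r \<and> (\<exists>\<delta>. \<forall>D\<in>\<D>. generic_below P r D q \<delta>)" using q by blast
  qed
  define D where "D \<alpha> = {x \<in> P. \<exists>y\<in>fst (d x). \<alpha> \<le> ht y}" for \<alpha>
  have "dense_in P r (D \<alpha>)" for \<alpha>
    unfolding dense_in_def
  proof (intro conjI ballI)
    show "D \<alpha> \<subseteq> P" by (auto simp: D_def)
    fix p assume p: "p \<in> P"
    have dp: "d p \<in> conds" "stronger (d p) e" using jd(2)[OF p] by (auto simp: Q_def)
    from unbounded[OF this, of \<alpha>] obtain q where q: "q \<in> conds" "stronger q (d p)" "\<exists>x\<in>fst q. \<alpha> \<le> ht x" by blast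
    then have "q \<in> Q" using down jd(2)[OF p] by blast
    then show "\<exists>x\<in>D \<alpha>. (x, p) \<in> r"
      using q p P_iff by (intro bexI[of _ "j q"]) (auto simp: r_iff D_def)
  qed
  then obtain G where G: "poset_filter P r G" "\<And>\<alpha>. G \<inter> D \<alpha> \<noteq> {}"
    using pfa \<open>P \<noteq> {}\<close> order proper suslin unfolding PFA_S_def by meson
  define H where "H = (\<Union>x\<in>G. fst (d x))"
  have GP: "G \<subseteq> P" using G(1) unfolding poset_filter_def by blast
  have cS: "fst (d x) \<subseteq> S" if "x \<in> P" for x using jd(2)[OF that] by (auto simp: Q_def conds_def)
  have "H \<subseteq> S" using GP cS by (auto simp: H_def)
  moreover have "uncountable H"
  proof
    assume "countable H"
    then obtain \<beta> where \<beta>: "\<forall>\<alpha>\<in>ht ` H. \<alpha> < \<beta>" using omega1_bounded[of "ht ` H"] by auto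
    obtain x y where "x \<in> G" "y \<in> fst (d x)" "\<beta> \<le> ht y" using G(2)[of \<beta>] by (auto simp: D_def)
    then show False using \<beta> unfolding H_def by (auto simp: not_le[symmetric])
  qed
  moreover have "\<not> c {x, y}" if "x \<in> H" "y \<in> H" "tree_less x y" for x y
  proof -
    obtain p q where pq: "p \<in> G" "x \<in> fst (d p)" "q \<in> G" "y \<in> fst (d q)"
      using \<open>x \<in> H\<close> \<open>y \<in> H\<close> by (auto simp: H_def)
    then obtain u where u: "(u, p) \<in> r" "(u, q) \<in> r"
      using G(1) unfolding poset_filter_def by blast
    then have "x \<in> fst (d u)" "y \<in> fst (d u)" "d u \<in> conds"
      using jd(2)[of u] pq by (auto simp: r_iff stronger_def Q_def)
    then show ?thesis using that(3) by (auto simp: conds_def)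
  qed
  ultimately show ?thesis by blast
qed

end

theorem theorem4p19:
  fixes S :: "node set" and c :: "node set \<Rightarrow> bool"
  assumes "suslin_tree S" and "complete_coherent S"
    and "\<exists>f :: node set set set \<Rightarrow> 'p. inj f"
    and "PFA_S TYPE('p) S"
  shows "\<not> phi0 S c"
proof
  assume "phi0 S c"
  then interpret coloured_tree S c
    using assms(1,2) by unfold_locales
  obtain J :: "nat \<times> nat \<times> payload \<Rightarrow> 'p" where "inj J" using inj_payload[OF assms(3)] ..
  from exists_homogeneous[OF this assms(4)] show False using no_homogeneous by blast
qed

end
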